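(* Consider a Poisson manifold $(M,\Xi)$, a function $H:M\rightarrow\mathbb{R}$ with Hamiltonian vector field $X_H$, and a fibration $\Pi:M\rightarrow N$. 1. Suppose that there is a Lagrangian complete solution $\Sigma:N\times\Lambda\rightarrow M$ of the $\Pi$-HJE for $(M,X_{H})$. Then for every $m\in M$ there exists an open neighborhood $U$ of $m$ such that $(U,X_{H}|_{U})$ is commutative integrable (CI). 2. If $(M,X_{H})$ is CI by means of $F$, with $F$ and $\Pi$ transverse (i.e. $TM=\operatorname{Ker}\Pi_*\oplus\operatorname{Ker}F_*$), then for each $m\in M$ there exist an open neighborhood $U$ of $m$ and a Lagrangian complete solution $\Sigma$ of the $\Pi|_{U}$-HJE for $(U,X_{H}|_{U})$. 3. If $(M,X_{H})$ is CI, then for each $m\in M$ there exist an open neighborhood $U$ of $m$, a fibration $\pi:U\rightarrow\pi(U)$ and a Lagrangian complete solution $\Sigma$ of the $\pi$-HJE for $(U,X_{H}|_{U})$.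
   Context: All manifolds are smooth and finite-dimensional and all maps are smooth; $f_*$ denotes the tangent map of $f$; a superscript $0$ denotes annihilator. A fibration is a surjective submersion. A dynamical system $(M,X)$ is a manifold with a vector field. Given a fibration $\Pi:M\to N$, a section $\sigma:N\to M$ of $\Pi$ is a solution of the $\Pi$-Hamilton-Jacobi equation ($\Pi$-HJE) for $(M,X)$ if $\sigma_{\ast}\circ\Pi_{\ast}\circ X\circ\sigma=X\circ\sigma$. A complete solution of the $\Pi$-HJE for $(M,X)$ is a surjective local diffeomorphism $\Sigma:N\times\Lambda\to M$, with $\Lambda$ a manifold of dimension $\dim M-\dim N$, such that for each $\lambda\in\Lambda$ the map $\sigma_\lambda:=\Sigma(\cdot,\lambda)$ is a section of $\Pi$ solving the $\Pi$-HJE. For $U\subset M$ open, $\Pi|_U:U\to\Pi(U)$ is the restricted fibration and the same definitions are applied to $(U,X|_U)$. For a Poisson manifold $(M,\Xi)$, $\Xi^\sharp:T^*M\to TM$ is given by $\langle\alpha,\Xi^\sharp(\beta)\rangle=\Xi(\alpha,\beta)$ and $X_H=\Xi^\sharp\circ dH$. A subspace $V\subset T_mM$ is isotropic if $V\cap\operatorname{Im}\Xi^\sharp\subset\Xi^\sharp(V^0)$ and $V\subset\operatorname{Im}\Xi^\sharp$ (equivalently $V\subset\Xi^\sharp(V^0)$), co-isotropic if $\Xi^\sharp(V^0)\subset V$, and Lagrangian if it is isotropic and co-isotropic. A fibration $F$ is isotropic (Lagrangian) if each fiber of $\operatorname{Ker}F_*$ is so; a section $\sigma$ is Lagrangian if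 each fiber of $\operatorname{Im}\sigma_*$ is so; $\Sigma$ is Lagrangian if every $\sigma_\lambda$ is Lagrangian. $(M,X_H)$ is non-commutative integrable by means of $F$ if $F:M\to\Lambda$ is an isotropic fibration onto some manifold $\Lambda$ such that $\operatorname{Im}X_H\subset\operatorname{Ker}F_*$ and $\Xi^\sharp[(\operatorname{Ker}F_* )^0]$ is an integrable distribution; if in addition $F$ is Lagrangian, $(M,X_H)$ is commutative integrable (CI) by means of $F$. It is CI if such an $F$ exists. *)

theory Defs
  imports "HOL-Analysis.Analysis"
begin

section \<open>Smooth functions of n real variables\<close>

text \<open>The n-dimensional model space is the library's \<^const>\<open>Euclidean_space\<close>, the topology of all
  \<^typ>\<open>nat \<Rightarrow> real\<close> vanishing at indices \<open>\<ge> n\<close>. The dimension is thus a natural number,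
  possibly 0, that can be quantified over.\<close>

definition partial_deriv :: "nat \<Rightarrow> ((nat \<Rightarrow> real) \<Rightarrow> real) \<Rightarrow> (nat \<Rightarrow> real) \<Rightarrow> real" where
  "partial_deriv i f x = deriv (\<lambda>t. f (x(i := t))) (x i)"

text \<open>\<open>Ck_on k n W f\<close>: f is k times continuously differentiable on W, for W open in
  \<open>Euclidean_space n\<close>.\<close>

primrec Ck_on :: "nat \<Rightarrow> nat \<Rightarrow> (nat \<Rightarrow> real) set \<Rightarrow> ((nat \<Rightarrow> real) \<Rightarrow> real) \<Rightarrow> bool" where
  "Ck_on 0 n W f \<longleftrightarrow> continuous_on W f"
| "Ck_on (Suc k) n W f \<longleftrightarrow> continuous_on W f \<and>
     (\<forall>i<n. (\<forall>x\<in>W. (\<lambda>t. f (x(i := t))) field_differentiable at (x i)) \<and>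
            Ck_on k n W (partial_deriv i f))"

definition Cinf_on :: "nat \<Rightarrow> (nat \<Rightarrow> real) set \<Rightarrow> ((nat \<Rightarrow> real) \<Rightarrow> real) \<Rightarrow> bool" where
  "Cinf_on n W f \<longleftrightarrow> (\<forall>k. Ck_on k n W f)"


section \<open>Smooth manifolds and smooth maps\<close>

text \<open>A chart \<open>(V, \<phi>)\<close> consists of an open domain V and a map \<phi>, of which only the values on V
  matter; its inverse is \<open>inv_into V \<phi>\<close>. The atlas need not be maximal.\<close>

record 'a manifold =
  mtop :: "'a topology"
  mdim :: nat
  charts :: "('a set \<times> ('a \<Rightarrow> nat \<Rightarrow> real)) set"

definition is_chart :: "'a topology \<Rightarrow> nat \<Rightarrow> 'a set \<Rightarrow> ('a \<Rightarrow> nat \<Rightarrow> real) \<Rightarrow> bool" where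
  "is_chart X n V \<phi> \<longleftrightarrow> openin X V \<and> openin (Euclidean_space n) (\<phi> ` V) \<and>
     homeomorphic_map (subtopology X V) (subtopology (Euclidean_space n) (\<phi> ` V)) \<phi>"

definition smooth_manifold :: "'a manifold \<Rightarrow> bool" where
  "smooth_manifold M \<longleftrightarrow>
     Hausdorff_space (mtop M) \<and> second_countable (mtop M) \<and>
     (\<forall>(V, \<phi>) \<in> charts M. is_chart (mtop M) (mdim M) V \<phi>) \<and>
     topspace (mtop M) = (\<Union>(V, \<phi>) \<in> charts M. V) \<and>
     (\<forall>(V, \<phi>) \<in> charts M. \<forall>(W, \<psi>) \<in> charts M. \<forall>i < mdim M.
        Cinf_on (mdim M) (\<phi> ` (V \<inter> W)) (\<lambda>x. \<psi> (inv_into V \<phi> x) i))"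

definition submanifold :: "'a manifold \<Rightarrow> 'a set \<Rightarrow> 'a manifold" where
  "submanifold M U =
     \<lparr>mtop = subtopology (mtop M) U, mdim = mdim M, charts = (\<lambda>(V, \<phi>). (V \<inter> U, \<phi>)) ` charts M\<rparr>"
  \<comment> \<open>only meaningful for open U\<close>

definition prod_manifold :: "'a manifold \<Rightarrow> 'b manifold \<Rightarrow> ('a \<times> 'b) manifold" where
  "prod_manifold M N =
     \<lparr>mtop = prod_topology (mtop M) (mtop N), mdim = mdim M + mdim N,
      charts = (\<lambda>((V, \<phi>), (W, \<psi>)).
                  (V \<times> W, \<lambda>(x, y) i. if i < mdim M then \<phi> x i else \<psi> y (i - mdim M)))
               ` (charts M \<times> charts N)\<rparr>"

definition smooth_fun_on :: "'a manifold \<Rightarrow> 'a set \<Rightarrow> ('a \<Rightarrow> real) \<Rightarrow> bool" where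
  "smooth_fun_on M U f \<longleftrightarrow> openin (mtop M) U \<and>
     (\<forall>(V, \<phi>) \<in> charts M. Cinf_on (mdim M) (\<phi> ` (V \<inter> U)) (\<lambda>x. f (inv_into V \<phi> x)))"

definition smooth_near :: "'a manifold \<Rightarrow> 'a \<Rightarrow> ('a \<Rightarrow> real) \<Rightarrow> bool" where
  "smooth_near M m f \<longleftrightarrow> (\<exists>U. m \<in> U \<and> smooth_fun_on M U f)"

definition smooth_map :: "'a manifold \<Rightarrow> 'b manifold \<Rightarrow> ('a \<Rightarrow> 'b) \<Rightarrow> bool" where
  "smooth_map M N f \<longleftrightarrow> continuous_map (mtop M) (mtop N) f \<and>
     (\<forall>(V, \<phi>) \<in> charts M. \<forall>(W, \<psi>) \<in> charts N. \<forall>i < mdim N.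
        Cinf_on (mdim M) (\<phi> ` (V \<inter> f -` W)) (\<lambda>x. \<psi> (f (inv_into V \<phi> x)) i))"

definition diffeomorphism :: "'a manifold \<Rightarrow> 'b manifold \<Rightarrow> ('a \<Rightarrow> 'b) \<Rightarrow> bool" where
  "diffeomorphism M N f \<longleftrightarrow> smooth_map M N f \<and>
     (\<exists>g. smooth_map N M g \<and> (\<forall>x \<in> topspace (mtop M). g (f x) = x) \<and>
          (\<forall>y \<in> topspace (mtop N). f (g y) = y))"

definition local_diffeomorphism :: "'a manifold \<Rightarrow> 'b manifold \<Rightarrow> ('a \<Rightarrow> 'b) \<Rightarrow> bool" where
  "local_diffeomorphism M N f \<longleftrightarrow> smooth_map M N f \<and>
     (\<forall>m \<in> topspace (mtop M). \<exists>U V. openin (mtop M) U \<and> m \<in> U \<and> openin (mtop N) V \<and>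
        diffeomorphism (submanifold M U) (submanifold N V) f)"


section \<open>Tangent and cotangent spaces\<close>

text \<open>Tangent vectors at m are the derivations at m of the functions that are smooth near m,
  extended by 0 to all other functions. Such derivations only depend on germs; hence for U open
  and \<open>m \<in> U\<close>, the tangent spaces at m of M and of \<open>submanifold M U\<close> are the same set, and a
  tensor field on M restricts to U without any change.\<close>

type_synonym 'a tangent = "('a \<Rightarrow> real) \<Rightarrow> real"
type_synonym 'a covector = "'a tangent \<Rightarrow> real"
type_synonym 'a bivector = "'a \<Rightarrow> 'a covector \<Rightarrow> 'a covector \<Rightarrow> real"

definition tangent_space :: "'a manifold \<Rightarrow> 'a \<Rightarrow> 'a tangent set" where
  "tangent_space M m = {v.
     (\<forall>f. \<not> smooth_near M m f \<longrightarrow> v f = 0) \<and>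
     (\<forall>f g. smooth_near M m f \<longrightarrow> smooth_near M m g \<longrightarrow>
        v (\<lambda>x. f x + g x) = v f + v g \<and>
        v (\<lambda>x. f x * g x) = v f * g m + f m * v g) \<and>
     (\<forall>c f. smooth_near M m f \<longrightarrow> v (\<lambda>x. c * f x) = c * v f)}"

definition cotangent_space :: "'a manifold \<Rightarrow> 'a \<Rightarrow> 'a covector set" where
  "cotangent_space M m = {\<alpha>.
     (\<forall>v. v \<notin> tangent_space M m \<longrightarrow> \<alpha> v = 0) \<and>
     (\<forall>v \<in> tangent_space M m. \<forall>w \<in> tangent_space M m. \<alpha> (\<lambda>f. v f + w f) = \<alpha> v + \<alpha> w) \<and>
     (\<forall>c. \<forall>v \<in> tangent_space M m. \<alpha> (\<lambda>f. c * v f) = c * \<alpha> v)}"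

definition differential :: "'a manifold \<Rightarrow> ('a \<Rightarrow> real) \<Rightarrow> 'a \<Rightarrow> 'a covector" where
  "differential M f m = (\<lambda>v. if v \<in> tangent_space M m then v f else 0)"

definition annihilator :: "'a manifold \<Rightarrow> 'a \<Rightarrow> 'a tangent set \<Rightarrow> 'a covector set" where
  "annihilator M m V = {\<alpha> \<in> cotangent_space M m. \<forall>v \<in> V. \<alpha> v = 0}"

text \<open>\<open>tangent_map N f m\<close> is \<open>f\<^sub>*\<close> at m for a smooth map f into N.\<close>

definition tangent_map :: "'b manifold \<Rightarrow> ('a \<Rightarrow> 'b) \<Rightarrow> 'a \<Rightarrow> 'a tangent \<Rightarrow> 'b tangent" where
  "tangent_map N f m v = (\<lambda>g. if smooth_near N (f m) g then v (\<lambda>x. g (f x)) else 0)"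

definition tangent_ker :: "'a manifold \<Rightarrow> 'b manifold \<Rightarrow> ('a \<Rightarrow> 'b) \<Rightarrow> 'a \<Rightarrow> 'a tangent set" where
  "tangent_ker M N f m = {v \<in> tangent_space M m. tangent_map N f m v = (\<lambda>g. 0)}"

definition tangent_im :: "'a manifold \<Rightarrow> 'b manifold \<Rightarrow> ('a \<Rightarrow> 'b) \<Rightarrow> 'a \<Rightarrow> 'b tangent set" where
  "tangent_im M N f m = tangent_map N f m ` tangent_space M m"

definition fibration :: "'a manifold \<Rightarrow> 'b manifold \<Rightarrow> ('a \<Rightarrow> 'b) \<Rightarrow> bool" where
  "fibration M N f \<longleftrightarrow> smooth_map M N f \<and> f ` topspace (mtop M) = topspace (mtop N) \<and>
     (\<forall>m \<in> topspace (mtop M). tangent_im M N f m = tangent_space N (f m))"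

definition transverse ::
    "'a manifold \<Rightarrow> 'b manifold \<Rightarrow> ('a \<Rightarrow> 'b) \<Rightarrow> 'c manifold \<Rightarrow> ('a \<Rightarrow> 'c) \<Rightarrow> bool" where
  "transverse M N f L F \<longleftrightarrow> (\<forall>m \<in> topspace (mtop M).
     (\<forall>v \<in> tangent_space M m. \<exists>a \<in> tangent_ker M N f m. \<exists>b \<in> tangent_ker M L F m.
        v = (\<lambda>g. a g + b g)) \<and>
     tangent_ker M N f m \<inter> tangent_ker M L F m = {\<lambda>g. 0})"

text \<open>Integrability of a distribution, possibly of non-constant rank: through every point passes
  an immersed submanifold whose tangent spaces are the spaces of the distribution. As integral
  manifolds can be shrunk to a coordinate domain, carriers in \<^typ>\<open>nat \<Rightarrow> real\<close> are enough.\<close>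

definition integrable_distribution :: "'a manifold \<Rightarrow> ('a \<Rightarrow> 'a tangent set) \<Rightarrow> bool" where
  "integrable_distribution M D \<longleftrightarrow> (\<forall>m \<in> topspace (mtop M).
     \<exists>(S :: (nat \<Rightarrow> real) manifold) \<iota>. smooth_manifold S \<and> smooth_map S M \<iota> \<and>
       inj_on \<iota> (topspace (mtop S)) \<and> m \<in> \<iota> ` topspace (mtop S) \<and>
       (\<forall>s \<in> topspace (mtop S). inj_on (tangent_map M \<iota> s) (tangent_space S s) \<and>
          tangent_im S M \<iota> s = D (\<iota> s)))"


section \<open>Poisson manifolds\<close>

definition bracket ::
    "'a manifold \<Rightarrow> 'a bivector \<Rightarrow> ('a \<Rightarrow> real) \<Rightarrow> ('a \<Rightarrow> real) \<Rightarrow> 'a \<Rightarrow> real" where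
  "bracket M \<Xi> f g m = \<Xi> m (differential M f m) (differential M g m)"

definition poisson_manifold :: "'a manifold \<Rightarrow> 'a bivector \<Rightarrow> bool" where
  "poisson_manifold M \<Xi> \<longleftrightarrow> smooth_manifold M \<and>
     (\<forall>m \<in> topspace (mtop M). \<forall>\<alpha> \<in> cotangent_space M m. \<forall>\<beta> \<in> cotangent_space M m.
        \<Xi> m \<alpha> \<beta> = - \<Xi> m \<beta> \<alpha> \<and>
        (\<forall>\<gamma> \<in> cotangent_space M m. \<forall>c.
           \<Xi> m (\<lambda>v. c * \<alpha> v + \<beta> v) \<gamma> = c * \<Xi> m \<alpha> \<gamma> + \<Xi> m \<beta> \<gamma>)) \<and>
     (\<forall>U f g. smooth_fun_on M U f \<longrightarrow> smooth_fun_on M U g \<longrightarrow>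
        smooth_fun_on M U (bracket M \<Xi> f g)) \<and>
     (\<forall>U f g h. smooth_fun_on M U f \<longrightarrow> smooth_fun_on M U g \<longrightarrow> smooth_fun_on M U h \<longrightarrow>
        (\<forall>m \<in> U. bracket M \<Xi> f (bracket M \<Xi> g h) m + bracket M \<Xi> g (bracket M \<Xi> h f) m +
                  bracket M \<Xi> h (bracket M \<Xi> f g) m = 0))"

definition sharp :: "'a manifold \<Rightarrow> 'a bivector \<Rightarrow> 'a \<Rightarrow> 'a covector \<Rightarrow> 'a tangent" where
  "sharp M \<Xi> m \<beta> =
     (THE v. v \<in> tangent_space M m \<and> (\<forall>\<alpha> \<in> cotangent_space M m. \<alpha> v = \<Xi> m \<alpha> \<beta>))"

definition hamiltonian_field :: "'a manifold \<Rightarrow> 'a bivector \<Rightarrow> ('a \<Rightarrow> real) \<Rightarrow> 'a \<Rightarrow> 'a tangent" where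
  "hamiltonian_field M \<Xi> H m = sharp M \<Xi> m (differential M H m)"

definition isotropic :: "'a manifold \<Rightarrow> 'a bivector \<Rightarrow> 'a \<Rightarrow> 'a tangent set \<Rightarrow> bool" where
  "isotropic M \<Xi> m V \<longleftrightarrow>
     V \<inter> sharp M \<Xi> m ` cotangent_space M m \<subseteq> sharp M \<Xi> m ` annihilator M m V \<and>
     V \<subseteq> sharp M \<Xi> m ` cotangent_space M m"

definition coisotropic :: "'a manifold \<Rightarrow> 'a bivector \<Rightarrow> 'a \<Rightarrow> 'a tangent set \<Rightarrow> bool" where
  "coisotropic M \<Xi> m V \<longleftrightarrow> sharp M \<Xi> m ` annihilator M m V \<subseteq> V"

definition lagrangian :: "'a manifold \<Rightarrow> 'a bivector \<Rightarrow> 'a \<Rightarrow> 'a tangent set \<Rightarrow> bool" where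
  "lagrangian M \<Xi> m V \<longleftrightarrow> isotropic M \<Xi> m V \<and> coisotropic M \<Xi> m V"


section \<open>The Hamilton--Jacobi equation\<close>

definition smooth_section :: "'a manifold \<Rightarrow> 'b manifold \<Rightarrow> ('a \<Rightarrow> 'b) \<Rightarrow> ('b \<Rightarrow> 'a) \<Rightarrow> bool" where
  "smooth_section M N p \<sigma> \<longleftrightarrow> smooth_map N M \<sigma> \<and> (\<forall>n \<in> topspace (mtop N). p (\<sigma> n) = n)"

definition HJE_solution ::
    "'a manifold \<Rightarrow> ('a \<Rightarrow> 'a tangent) \<Rightarrow> 'b manifold \<Rightarrow> ('a \<Rightarrow> 'b) \<Rightarrow> ('b \<Rightarrow> 'a) \<Rightarrow> bool" where
  "HJE_solution M X N p \<sigma> \<longleftrightarrow> smooth_section M N p \<sigma> \<and>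
     (\<forall>n \<in> topspace (mtop N).
        tangent_map M \<sigma> n (tangent_map N p (\<sigma> n) (X (\<sigma> n))) = X (\<sigma> n))"

definition complete_solution ::
    "'a manifold \<Rightarrow> ('a \<Rightarrow> 'a tangent) \<Rightarrow> 'b manifold \<Rightarrow> ('a \<Rightarrow> 'b) \<Rightarrow>
     'c manifold \<Rightarrow> ('b \<times> 'c \<Rightarrow> 'a) \<Rightarrow> bool" where
  "complete_solution M X N p L \<Sigma> \<longleftrightarrow>
     smooth_manifold L \<and> mdim M = mdim N + mdim L \<and>
     local_diffeomorphism (prod_manifold N L) M \<Sigma> \<and>
     \<Sigma> ` topspace (mtop (prod_manifold N L)) = topspace (mtop M) \<and>
     (\<forall>l \<in> topspace (mtop L). HJE_solution M X N p (\<lambda>n. \<Sigma> (n, l)))"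

definition lagrangian_complete_solution ::
    "'a manifold \<Rightarrow> 'a bivector \<Rightarrow> ('a \<Rightarrow> 'a tangent) \<Rightarrow> 'b manifold \<Rightarrow> ('a \<Rightarrow> 'b) \<Rightarrow>
     'c manifold \<Rightarrow> ('b \<times> 'c \<Rightarrow> 'a) \<Rightarrow> bool" where
  "lagrangian_complete_solution M \<Xi> X N p L \<Sigma> \<longleftrightarrow>
     complete_solution M X N p L \<Sigma> \<and>
     (\<forall>l \<in> topspace (mtop L). \<forall>n \<in> topspace (mtop N).
        lagrangian M \<Xi> (\<Sigma> (n, l)) (tangent_im N M (\<lambda>n. \<Sigma> (n, l)) n))"


section \<open>Integrability\<close>

definition noncomm_integrable_by ::
    "'a manifold \<Rightarrow> 'a bivector \<Rightarrow> ('a \<Rightarrow> 'a tangent) \<Rightarrow> 'c manifold \<Rightarrow> ('a \<Rightarrow> 'c) \<Rightarrow> bool" where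
  "noncomm_integrable_by M \<Xi> X L F \<longleftrightarrow>
     smooth_manifold L \<and> fibration M L F \<and>
     (\<forall>m \<in> topspace (mtop M). isotropic M \<Xi> m (tangent_ker M L F m)) \<and>
     (\<forall>m \<in> topspace (mtop M). X m \<in> tangent_ker M L F m) \<and>
     integrable_distribution M (\<lambda>m. sharp M \<Xi> m ` annihilator M m (tangent_ker M L F m))"

definition comm_integrable_by ::
    "'a manifold \<Rightarrow> 'a bivector \<Rightarrow> ('a \<Rightarrow> 'a tangent) \<Rightarrow> 'c manifold \<Rightarrow> ('a \<Rightarrow> 'c) \<Rightarrow> bool" where
  "comm_integrable_by M \<Xi> X L F \<longleftrightarrow> noncomm_integrable_by M \<Xi> X L F \<and>
     (\<forall>m \<in> topspace (mtop M). lagrangian M \<Xi> m (tangent_ker M L F m))"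

text \<open>HOL cannot quantify over the type of points of the base L, so it is a parameter. As an
  assumption, \<open>comm_integrable\<close> is to be used at an arbitrary type; as a conclusion, at
  \<^typ>\<open>nat \<Rightarrow> real\<close>, which has a copy of every (second countable) manifold.\<close>

definition comm_integrable ::
    "'c itself \<Rightarrow> 'a manifold \<Rightarrow> 'a bivector \<Rightarrow> ('a \<Rightarrow> 'a tangent) \<Rightarrow> bool" where
  "comm_integrable (T :: 'c itself) M \<Xi> X \<longleftrightarrow>
     (\<exists>(L :: 'c manifold) F. comm_integrable_by M \<Xi> X L F)"

end

theory Submission
  imports Defs
begin

text \<open>Both directions say the same thing in suitable coordinates. Around a point of M take coordinates
  \<open>(l, x)\<close>, with \<open>l\<close> of dimension \<open>dim \<Lambda>\<close> and \<open>x\<close> of dimension \<open>dim N\<close>, whose image is a cube, and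
  consider the slices on which \<open>l\<close> is constant. They are at once the fibers of \<open>F = (l)\<close> and the images of
  the sections \<open>\<sigma>\<^sub>l\<close> of \<open>\<Pi> = (x)\<close>, so \<open>Ker F\<^sub>* = Im (\<sigma>\<^sub>l)\<^sub>*\<close>, and the two notions of being
  Lagrangian coincide. Moreover \<open>\<sigma>\<^sub>l\<close> solves the Hamilton--Jacobi equation iff \<open>X\<close> is tangent to the slice:
  \<open>(\<sigma>\<^sub>l)\<^sub>* \<circ> \<Pi>\<^sub>*\<close> is a projection onto \<open>Im (\<sigma>\<^sub>l)\<^sub>*\<close>. This is the locale \<open>product_coordinates\<close>, and it
  remains to find such coordinates.

  For statement 1, compose charts of N and \<open>\<Lambda>\<close> with a local inverse of \<open>\<Sigma>\<close> (\<open>coord_transport\<close>). The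
  distribution \<open>\<Xi>\<^sup>\<sharp>[(Ker F\<^sub>*)\<^sup>0]\<close> is \<open>Ker F\<^sub>*\<close> itself, since \<open>Ker F\<^sub>*\<close> is Lagrangian, and the slices are
  its integral manifolds. For statements 2 and 3, \<open>l\<close> is \<open>F\<close> in a chart; \<open>x\<close> is \<open>\<Pi>\<close> in a chart, respectively
  any completion of \<open>l\<close> to a coordinate system. Both follow from the local theorem that functions with
  linearly independent differentials at a point are part of a coordinate system around it
  (\<open>complete_to_coordinates\<close>). In statement 2 transversality makes the differentials of the components of
  \<open>F\<close> and \<open>\<Pi>\<close> independent and lets them exhaust the dimension.

  The local theorem is proved in the manner of the Steinitz exchange lemma, one coordinate at a time. If
  \<open>\<partial>\<^sub>k f \<noteq> 0\<close>, then \<open>f\<close> can replace the k-th coordinate; inverting \<open>x \<mapsto> x(k := f x)\<close> means solving one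
  equation in one unknown, by the intermediate value theorem (\<open>ediff_replace_coordinate\<close>). All this works for
  every natural number as the dimension, with linear algebra reduced to partial derivatives.

  Tangent vectors are derivations. That they form the span of the coordinate derivations is Hadamard's lemma
  (\<open>Hadamard\<close>, \<open>tangent_expand\<close>). It identifies kernels and images of tangent maps, and it makes the
  tangent space reflexive, so that the vector described by \<open>sharp\<close> exists (\<open>sharp_tangent\<close>).\<close>


section \<open>Cubes and open sets of Euclidean space\<close>

text \<open>Only the first n entries of the center c matter. Hence the same c also describes the projection of the
  cube to its first coordinates.\<close>

definition cube :: "nat \<Rightarrow> (nat \<Rightarrow> real) \<Rightarrow> real \<Rightarrow> (nat \<Rightarrow> real) set" where
  "cube n c e = {x. (\<forall>i\<ge>n. x i = 0) \<and> (\<forall>i<n. \<bar>x i - c i\<bar> < e)}"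

abbreviation eopen :: "nat \<Rightarrow> (nat \<Rightarrow> real) set \<Rightarrow> bool" where
  "eopen n W \<equiv> openin (Euclidean_space n) W"

lemma continuous_on_coordinate: "continuous_on S (\<lambda>x::nat \<Rightarrow> real. x i)"
  by (rule continuous_on_subset[OF continuous_on_product_coordinates]) simp

lemma eopen_iff_trace: "eopen n W \<longleftrightarrow> (\<exists>T. open T \<and> W = T \<inter> {x. \<forall>i\<ge>n. x i = 0})"
  unfolding Euclidean_space_def euclidean_product_topology openin_subtopology
  by (simp only: open_openin)

lemma eopen_Collect:
  assumes "finite I" "\<And>i. i \<in> I \<Longrightarrow> open (S i)"
  shows "eopen n {x. (\<forall>i\<ge>n. x i = 0) \<and> (\<forall>i\<in>I. x i \<in> S i)}"
proof -
  have "open ((\<lambda>x::nat \<Rightarrow> real. x i) -` S i)" if "i \<in> I" for i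
    using assms(2)[OF that] by (rule open_vimage) (rule continuous_on_coordinate)
  then have "open (\<Inter>i\<in>I. (\<lambda>x::nat \<Rightarrow> real. x i) -` S i)"
    using assms(1) by (intro open_INT) auto
  moreover have "{x. (\<forall>i\<ge>n. x i = 0) \<and> (\<forall>i\<in>I. x i \<in> S i)} =
    (\<Inter>i\<in>I. (\<lambda>x::nat \<Rightarrow> real. x i) -` S i) \<inter> {x. \<forall>i\<ge>n. x i = 0}" by auto
  ultimately show ?thesis unfolding eopen_iff_trace by blast
qed

lemma eopen_cube: "eopen n (cube n c e)"
proof -
  have "open {s::real. \<bar>s - c i\<bar> < e}" for i
    by (intro open_Collect_less continuous_intros)
  then show ?thesis
    using eopen_Collect[of "{..<n}" "\<lambda>i. {s. \<bar>s - c i\<bar> < e}" n] by (simp add: cube_def Ball_def)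
qed

lemma eopen_subset: "eopen n W \<Longrightarrow> x \<in> W \<Longrightarrow> i \<ge> n \<Longrightarrow> x i = 0"
  using openin_subset topspace_Euclidean_space by fastforce

lemma eopen_cube_subset:
  assumes "eopen n W" "x \<in> W"
  obtains e where "e > 0" "cube n x e \<subseteq> W"
proof -
  obtain T where T: "open T" "W = T \<inter> {x. \<forall>i\<ge>n. x i = 0}"
    using assms(1) eopen_iff_trace by blast
  have "openin (product_topology (\<lambda>i. euclidean) UNIV) T" using T(1)
    by (simp only: euclidean_product_topology open_openin)
  then obtain B where B: "\<And>i. open (B i)" "x \<in> Pi UNIV B" "Pi UNIV B \<subseteq> T"
    using assms(2) T(2) unfolding openin_product_topology_alt by (force simp: PiE_def)
  have "\<exists>e>0. ball (x i) e \<subseteq> B i" for i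
    using B(1)[of i] B(2) by (auto simp: open_contains_ball Pi_iff)
  then obtain e where e: "\<And>i. e i > 0" "\<And>i. ball (x i) (e i) \<subseteq> B i" by metis
  define d where "d = Min (insert 1 (e ` {..<n}))"
  have d: "d > 0" "\<And>i. i < n \<Longrightarrow> d \<le> e i" unfolding d_def using e(1) by auto
  have "cube n x d \<subseteq> W"
  proof
    fix y assume y: "y \<in> cube n x d"
    have "y i \<in> B i" for i
    proof (cases "i < n")
      case True
      then have "dist (x i) (y i) < e i" using y d(2)[of i] by (auto simp: cube_def dist_real_def abs_minus_commute)
      then show ?thesis using e(2)[of i] by auto
    next
      case False
      then have "y i = x i" using y eopen_subset[OF assms, of i] by (auto simp: cube_def)
      then show ?thesis using B(2) by (auto simp: Pi_iff)
    qed
    then show "y \<in> W" using y B(3) T(2) by (auto simp: cube_def)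
  qed
  then show ?thesis using that d(1) by blast
qed

lemma eopenI:
  assumes "\<And>x. x \<in> W \<Longrightarrow> \<exists>e>0. cube n x e \<subseteq> W" "\<And>x i. x \<in> W \<Longrightarrow> i \<ge> n \<Longrightarrow> x i = 0"
  shows "eopen n W"
proof (subst openin_subopen, intro ballI)
  fix x assume x: "x \<in> W"
  then obtain e where e: "e > 0" "cube n x e \<subseteq> W" using assms(1) by blast
  moreover have "x \<in> cube n x e" using assms(2)[OF x] e(1) by (auto simp: cube_def)
  ultimately show "\<exists>T. eopen n T \<and> x \<in> T \<and> T \<subseteq> W" using eopen_cube by blast
qed

lemma center_in_cube: "(\<And>i. i \<ge> n \<Longrightarrow> c i = 0) \<Longrightarrow> e > 0 \<Longrightarrow> c \<in> cube n c e"
  by (auto simp: cube_def)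

lemma tendsto_function_iff:
  fixes y :: "'b \<Rightarrow> nat \<Rightarrow> real"
  shows "(y \<longlongrightarrow> x) F \<longleftrightarrow> (\<forall>i. ((\<lambda>t. y t i) \<longlongrightarrow> x i) F)"
  using limitin_componentwise[of "\<lambda>_. euclidean" UNIV y x F]
  by (simp add: euclidean_product_topology)

lemma eventually_in_eopen:
  assumes "eopen n W" "x \<in> W" "\<And>i. i < n \<Longrightarrow> ((\<lambda>t. y t i) \<longlongrightarrow> x i) F"
    "\<forall>\<^sub>F t in F. \<forall>i\<ge>n. y t i = 0"
  shows "\<forall>\<^sub>F t in F. y t \<in> W"
proof -
  obtain e where e: "e > 0" "cube n x e \<subseteq> W" using eopen_cube_subset[OF assms(1,2)] by blast
  have "\<forall>\<^sub>F t in F. \<forall>i\<in>{..<n}. \<bar>y t i - x i\<bar> < e"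
    unfolding eventually_ball_finite_distrib[OF finite_lessThan]
    using assms(3) e(1) by (auto simp: tendsto_iff dist_real_def)
  then show ?thesis using assms(4)
    by eventually_elim (use e(2) in \<open>auto simp: cube_def\<close>)
qed

lemma eventually_update_in_eopen:
  assumes "eopen n W" "x \<in> W" "i < n"
  shows "\<forall>\<^sub>F t in nhds (x i). x(i := t) \<in> W"
proof (rule eventually_in_eopen[OF assms(1,2)])
  show "((\<lambda>t. (x(i := t)) j) \<longlongrightarrow> x j) (nhds (x i))" for j
    by (cases "j = i") (auto simp: filterlim_ident)
qed (use assms(3) eopen_subset[OF assms(1,2)] in auto)

lemma eopen_Collect_less:
  fixes f g :: "(nat \<Rightarrow> real) \<Rightarrow> real"
  assumes "eopen n W" "continuous_on W f" "continuous_on W g"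
  shows "eopen n {x \<in> W. f x < g x}"
proof -
  have "continuous_on W (\<lambda>x. f x - g x)" using assms by (intro continuous_intros)
  then obtain T where T: "open T" "T \<inter> W = (\<lambda>x. f x - g x) -` {..<0} \<inter> W"
    using continuous_on_open_invariant[THEN iffD1, of W "\<lambda>x. f x - g x"] open_lessThan by metis
  obtain S where "open S" "W = S \<inter> {x. \<forall>i\<ge>n. x i = 0}" using assms(1) unfolding eopen_iff_trace by blast
  moreover have "{x \<in> W. f x < g x} = T \<inter> W" using T(2) by auto
  ultimately show ?thesis using T(1) unfolding eopen_iff_trace by (intro exI[of _ "T \<inter> S"]) auto
qed

lemma continuous_on_cubeI:
  fixes h :: "(nat \<Rightarrow> real) \<Rightarrow> real"
  assumes V: "eopen n V"
    and "\<And>y e. y \<in> V \<Longrightarrow> e > 0 \<Longrightarrow> \<exists>d>0. \<forall>z \<in> cube n y d \<inter> V. \<bar>h z - h y\<bar> < e"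
  shows "continuous_on V h"
  unfolding continuous_on_def
proof (intro ballI tendstoI)
  fix y and e :: real assume y: "y \<in> V" and e: "e > 0"
  then obtain d where d: "d > 0" "\<forall>z \<in> cube n y d \<inter> V. \<bar>h z - h y\<bar> < e" using assms(2) by blast
  have V': "\<forall>\<^sub>F z in at y within V. z \<in> V" by (simp add: eventually_at_topological exI[of _ UNIV])
  have "\<forall>\<^sub>F z in at y within V. z \<in> cube n y d"
  proof (rule eventually_in_eopen[OF eopen_cube center_in_cube])
    show "((\<lambda>z. z i) \<longlongrightarrow> y i) (at y within V)" for i
      using continuous_on_coordinate[of V i] y unfolding continuous_on_def by blast
    show "\<forall>\<^sub>F z in at y within V. \<forall>i\<ge>n. z i = 0"
      using V' by eventually_elim (use eopen_subset[OF V] in blast)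
  qed (use eopen_subset[OF V y] d in auto)
  then show "\<forall>\<^sub>F z in at y within V. dist (h z) (h y) < e"
    using V' by eventually_elim (use d in \<open>auto simp: dist_real_def\<close>)
qed

section \<open>Functions of class Ck\<close>

lemma partial_deriv_eqI:
  "((\<lambda>t. f (x(i := t))) has_field_derivative D) (at (x i)) \<Longrightarrow> partial_deriv i f x = D"
  unfolding partial_deriv_def by (rule DERIV_imp_deriv)

lemma partial_cong:
  assumes "eopen n W" "x \<in> W" "i < n" "\<And>y. y \<in> W \<Longrightarrow> f y = g y"
  shows "partial_deriv i f x = partial_deriv i g x"
    and "(\<lambda>t. f (x(i := t))) field_differentiable at (x i) \<longleftrightarrow>
         (\<lambda>t. g (x(i := t))) field_differentiable at (x i)"
proof -
  have ev: "\<forall>\<^sub>F t in nhds (x i). f (x(i := t)) = g (x(i := t))"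
    using eventually_update_in_eopen[OF assms(1-3)] by eventually_elim (use assms(4) in auto)
  show "partial_deriv i f x = partial_deriv i g x"
    unfolding partial_deriv_def by (rule deriv_cong_ev[OF ev refl])
  show "(\<lambda>t. f (x(i := t))) field_differentiable at (x i) \<longleftrightarrow>
         (\<lambda>t. g (x(i := t))) field_differentiable at (x i)"
    unfolding field_differentiable_def using DERIV_cong_ev[OF refl ev refl] by blast
qed

lemma Ck_cong:
  assumes "eopen n W" "\<And>y. y \<in> W \<Longrightarrow> f y = g y" "Ck_on k n W f"
  shows "Ck_on k n W g"
  using assms(2,3)
proof (induction k arbitrary: f g)
  case 0
  then show ?case using continuous_on_cong[of W W f g] by simp
next
  case (Suc k)
  have "Ck_on k n W (partial_deriv i g)" if i: "i < n" for i
  proof (rule Suc.IH)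
    show "partial_deriv i f y = partial_deriv i g y" if "y \<in> W" for y
      by (rule partial_cong(1)[OF assms(1) that i Suc.prems(1)])
    show "Ck_on k n W (partial_deriv i f)" using Suc.prems(2) i by simp
  qed
  moreover have "continuous_on W g"
    using Suc.prems continuous_on_cong[of W W f g] by simp
  moreover have "(\<lambda>t. g (x(i := t))) field_differentiable at (x i)" if "i < n" "x \<in> W" for i x
    using Suc.prems(2) that partial_cong(2)[OF assms(1) that(2,1), of f g] Suc.prems(1) by simp
  ultimately show ?case by simp
qed

lemma Ck_subset: "Ck_on k n W f \<Longrightarrow> V \<subseteq> W \<Longrightarrow> Ck_on k n V f"
  by (induction k arbitrary: f) (auto intro: continuous_on_subset)

lemma Ck_continuous: "Ck_on k n W f \<Longrightarrow> continuous_on W f"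
  by (cases k) auto

lemma Ck_of_Suc: "Ck_on (Suc k) n W f \<Longrightarrow> Ck_on k n W f"
  by (induction k arbitrary: f) auto

lemma Ck_has_partial:
  assumes "Ck_on (Suc k) n W f" "x \<in> W" "i < n"
  shows "((\<lambda>t. f (x(i := t))) has_field_derivative partial_deriv i f x) (at (x i))"
  using assms unfolding partial_deriv_def by (simp add: DERIV_deriv_iff_field_differentiable)

text \<open>The introduction rule for all the closure properties: candidates for the partial derivatives are given
  explicitly and have to be correct on W only.\<close>

lemma Ck_SucI:
  assumes "eopen n W" "continuous_on W f"
    "\<And>i x. i < n \<Longrightarrow> x \<in> W \<Longrightarrow> ((\<lambda>t. f (x(i := t))) has_field_derivative D i x) (at (x i))"
    "\<And>i. i < n \<Longrightarrow> Ck_on k n W (D i)"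
  shows "Ck_on (Suc k) n W f"
proof -
  have "Ck_on k n W (partial_deriv i f)" if "i < n" for i
    by (rule Ck_cong[OF assms(1) _ assms(4)[OF that]]) (use partial_deriv_eqI assms(3) that in metis)
  then show ?thesis using assms(2,3) by (auto simp: field_differentiable_def)
qed


lemma Ck_local:
  assumes "eopen n W" "\<And>x. x \<in> W \<Longrightarrow> \<exists>V. eopen n V \<and> x \<in> V \<and> V \<subseteq> W \<and> Ck_on k n V f"
  shows "Ck_on k n W f"
  using assms(2)
proof (induction k arbitrary: f)
  case 0
  then obtain V where V: "\<And>x. x \<in> W \<Longrightarrow> eopen n (V x) \<and> x \<in> V x \<and> V x \<subseteq> W \<and> continuous_on (V x) f"
    by simp metis
  have V': "\<exists>T. open T \<and> V x = T \<inter> W" if "x \<in> W" for x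
  proof -
    have "eopen n (V x)" using V[OF that] by simp
    then obtain T where "open T" "V x = T \<inter> {x. \<forall>i\<ge>n. x i = 0}"
      unfolding eopen_iff_trace by blast
    then show ?thesis using V[OF that] eopen_subset[OF assms(1)] by blast
  qed
  show ?case unfolding Ck_on.simps continuous_on_eq_continuous_within
  proof
    fix x assume x: "x \<in> W"
    then obtain T where T: "open T" "V x = T \<inter> W"
      using V' by blast
    have "at x within W = at x within V x"
      by (rule at_within_nhd[of x T]) (use T V[OF x] in auto)
    then show "continuous (at x within W) f"
      using V[OF x] unfolding continuous_on_eq_continuous_within by auto
  qed
next
  case (Suc k)
  have "continuous_on W f"
  proof -
    have "Ck_on 0 n W f" if "\<And>x. x \<in> W \<Longrightarrow> \<exists>V. eopen n V \<and> x \<in> V \<and> V \<subseteq> W \<and> Ck_on k n V f"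
      using Suc.IH[OF that] Ck_continuous by simp
    then show ?thesis using Suc.prems Ck_of_Suc by (metis Ck_on.simps(1))
  qed
  moreover have "Ck_on k n W (partial_deriv i f)" if "i < n" for i
    by (rule Suc.IH) (use Suc.prems that in \<open>fastforce\<close>)
  moreover have "(\<lambda>t. f (x(i := t))) field_differentiable at (x i)" if "i < n" "x \<in> W" for i x
    using Suc.prems[OF that(2)] that(1) by auto
  ultimately show ?case by simp
qed

lemma Ck_const: "Ck_on k n W (\<lambda>x. c)"
proof (induction k arbitrary: c)
  case (Suc k)
  have "partial_deriv i (\<lambda>x. c) = (\<lambda>x. 0)" for i by (auto simp: partial_deriv_def)
  then show ?case using Suc by simp
qed simp

lemma has_field_derivative_update:
  "((\<lambda>t. (x(i := t)) j) has_field_derivative (if j = i then 1 else 0)) (at s)"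
  by (cases "j = i") (auto intro!: derivative_eq_intros)

lemma Ck_proj: "eopen n W \<Longrightarrow> Ck_on k n W (\<lambda>x. x j)"
proof (cases k)
  case (Suc k')
  assume W: "eopen n W"
  show ?thesis unfolding Suc
    by (rule Ck_SucI[OF W _ has_field_derivative_update Ck_const])
      (rule continuous_on_coordinate)
qed (auto intro!: continuous_on_coordinate)

lemma Ck_add: "eopen n W \<Longrightarrow> Ck_on k n W f \<Longrightarrow> Ck_on k n W g \<Longrightarrow> Ck_on k n W (\<lambda>x. f x + g x)"
proof (induction k arbitrary: f g)
  case (Suc k)
  show ?case
  proof (rule Ck_SucI[where D = "\<lambda>i x. partial_deriv i f x + partial_deriv i g x", OF Suc.prems(1)])
    show "((\<lambda>t. f (x(i := t)) + g (x(i := t))) has_field_derivative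
      partial_deriv i f x + partial_deriv i g x) (at (x i))" if "i < n" "x \<in> W" for i x
      using DERIV_add[OF Ck_has_partial[OF Suc.prems(2) that(2,1)] Ck_has_partial[OF Suc.prems(3) that(2,1)]] .
  qed (use Suc in \<open>auto intro!: continuous_intros\<close>)
qed (auto intro!: continuous_intros)

lemma Ck_mult: "eopen n W \<Longrightarrow> Ck_on k n W f \<Longrightarrow> Ck_on k n W g \<Longrightarrow> Ck_on k n W (\<lambda>x. f x * g x)"
proof (induction k arbitrary: f g)
  case (Suc k)
  show ?case
  proof (rule Ck_SucI[where D = "\<lambda>i x. partial_deriv i f x * g x + partial_deriv i g x * f x", OF Suc.prems(1)])
    show "continuous_on W (\<lambda>x. f x * g x)"
      using Suc.prems by (auto intro!: continuous_intros)
    show "((\<lambda>t. f (x(i := t)) * g (x(i := t))) has_field_derivative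
      partial_deriv i f x * g x + partial_deriv i g x * f x) (at (x i))" if "i < n" "x \<in> W" for i x
      by (rule DERIV_cong[OF DERIV_mult[OF Ck_has_partial[OF Suc.prems(2) that(2,1)]
            Ck_has_partial[OF Suc.prems(3) that(2,1)]]]) simp
    show "Ck_on k n W (\<lambda>x. partial_deriv i f x * g x + partial_deriv i g x * f x)" if "i < n" for i
      using Suc.prems that Ck_of_Suc by (intro Ck_add Suc.IH) auto
  qed
qed (auto intro!: continuous_intros)

lemma Ck_sum: "eopen n W \<Longrightarrow> (\<And>j. j \<in> J \<Longrightarrow> Ck_on k n W (f j)) \<Longrightarrow> Ck_on k n W (\<lambda>x. \<Sum>j\<in>J. f j x)"
  by (induction J rule: infinite_finite_induct) (auto intro: Ck_const Ck_add)

lemma DERIV_inverse_product: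
  fixes h :: "real \<Rightarrow> real"
  assumes "(h has_field_derivative d) (at s)" "h s = c" "c \<noteq> 0"
  shows "((\<lambda>t. inverse (h t)) has_field_derivative (-1) * (d * (inverse c * inverse c))) (at s)"
  by (rule DERIV_cong[OF DERIV_inverse'[OF assms(1)]]) (use assms(2,3) in auto)

lemma Ck_inverse:
  assumes "eopen n W" "Ck_on k n W f" "\<And>x. x \<in> W \<Longrightarrow> f x \<noteq> 0"
  shows "Ck_on k n W (\<lambda>x. inverse (f x))"
  using assms(2)
proof (induction k)
  case 0
  then show ?case using assms(3) by (auto intro!: continuous_intros)
next
  case (Suc k)
  show ?case
  proof (rule Ck_SucI[where D = "\<lambda>i x. (-1) * (partial_deriv i f x * (inverse (f x) * inverse (f x)))", OF assms(1)])
    show "continuous_on W (\<lambda>x. inverse (f x))" using Suc.prems assms(3) by (auto intro!: continuous_intros)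
    show "((\<lambda>t. inverse (f (x(i := t)))) has_field_derivative
       (-1) * (partial_deriv i f x * (inverse (f x) * inverse (f x)))) (at (x i))" if "i < n" "x \<in> W" for i x
      by (rule DERIV_inverse_product[OF Ck_has_partial[OF Suc.prems that(2,1)]])
        (use assms(3)[OF that(2)] in simp_all)
    show "Ck_on k n W (\<lambda>x. (-1) * (partial_deriv i f x * (inverse (f x) * inverse (f x))))" if "i < n" for i
    proof -
      have I: "Ck_on k n W (\<lambda>x. inverse (f x))" by (rule Suc.IH[OF Ck_of_Suc[OF Suc.prems]])
      have "Ck_on k n W (partial_deriv i f)" using Suc.prems that by simp
      then show ?thesis
        by (rule Ck_mult[OF assms(1) Ck_const Ck_mult[OF assms(1) _ Ck_mult[OF assms(1) I I]]])
    qed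
  qed
qed

section \<open>The chain rule\<close>

text \<open>Walk from x to y by changing one coordinate after the other, in increasing order. The slope is the
  difference quotient of f along the i-th leg of this path. On a leg of length 0 the value is the partial
  derivative at x, which makes the slope tend to it as y tends to x.\<close>

definition slope :: "nat \<Rightarrow> ((nat \<Rightarrow> real) \<Rightarrow> real) \<Rightarrow> (nat \<Rightarrow> real) \<Rightarrow> (nat \<Rightarrow> real) \<Rightarrow> real" where
  "slope i f x y = (if y i = x i then partial_deriv i f x else
     (f (\<lambda>j. if j < Suc i then y j else x j) - f (\<lambda>j. if j < i then y j else x j)) / (y i - x i))"

lemma slope_sum:
  assumes "\<And>i. i \<ge> n \<Longrightarrow> x i = 0" "\<And>i. i \<ge> n \<Longrightarrow> y i = 0"
  shows "f y - f x = (\<Sum>i<n. (y i - x i) * slope i f x y)"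
proof -
  let ?z = "\<lambda>i j. if j < i then y j else x j"
  have "(y i - x i) * slope i f x y = f (?z (Suc i)) - f (?z i)" for i
  proof (cases "y i = x i")
    case True
    then have "?z (Suc i) = ?z i" by (auto simp: less_Suc_eq)
    then show ?thesis using True by simp
  qed (simp add: slope_def)
  then have "(\<Sum>i<n. (y i - x i) * slope i f x y) = f (?z n) - f (?z 0)"
    using sum_lessThan_telescope[of "\<lambda>i. f (?z i)" n] by simp
  moreover have "?z n = y" "?z 0 = x" using assms by (auto simp: not_less)
  ultimately show ?thesis by simp
qed

lemma mean_value_real:
  fixes f :: "real \<Rightarrow> real"
  assumes "a \<noteq> b" "\<And>t. min a b \<le> t \<Longrightarrow> t \<le> max a b \<Longrightarrow> (f has_field_derivative f' t) (at t)"
  shows "\<exists>t. min a b \<le> t \<and> t \<le> max a b \<and> f b - f a = (b - a) * f' t"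
proof (cases "a < b")
  case True
  then show ?thesis using MVT2[of a b f f'] assms by (metis less_imp_le max_absorb2 min_absorb1)
next
  case False
  then have "b < a" using assms(1) by simp
  then obtain t where "b < t" "t < a" "f a - f b = (a - b) * f' t"
    using MVT2[of b a f f'] assms(2) by auto
  then show ?thesis by (intro exI[of _ t]) (auto simp: algebra_simps)
qed

text \<open>By the mean value theorem, the slope is the i-th partial derivative at a point of the i-th leg, and this
  partial derivative is continuous.\<close>

lemma slope_tendsto:
  assumes W: "eopen n W" and f: "Ck_on (Suc 0) n W f" and x: "x \<in> W" and i: "i < n"
    and y: "\<And>j. j < n \<Longrightarrow> ((\<lambda>t. y t j) \<longlongrightarrow> x j) F" "\<forall>\<^sub>F t in F. \<forall>j\<ge>n. y t j = 0"
  shows "((\<lambda>t. slope i f x (y t)) \<longlongrightarrow> partial_deriv i f x) F"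
proof (rule tendstoI)
  fix e :: real assume e: "e > 0"
  have "continuous_on W (partial_deriv i f)" using f i by simp
  then have "eopen n {u \<in> W. \<bar>partial_deriv i f u - partial_deriv i f x\<bar> < e}"
    by (intro eopen_Collect_less[OF W] continuous_intros)
  moreover have "x \<in> {u \<in> W. \<bar>partial_deriv i f u - partial_deriv i f x\<bar> < e}" using x e by auto
  ultimately obtain d where d: "d > 0" "cube n x d \<subseteq> {u \<in> W. \<bar>partial_deriv i f u - partial_deriv i f x\<bar> < e}"
    by (rule eopen_cube_subset)
  have "\<forall>\<^sub>F t in F. y t \<in> cube n x d"
    by (rule eventually_in_eopen[OF eopen_cube center_in_cube y]) (use d eopen_subset[OF W x] in auto)
  then show "\<forall>\<^sub>F t in F. dist (slope i f x (y t)) (partial_deriv i f x) < e"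
  proof eventually_elim
    case (elim t)
    let ?y = "y t"
    let ?z = "\<lambda>j. if j < i then ?y j else x j"
    have z: "?z(i := s) \<in> cube n x d" if "min (x i) (?y i) \<le> s" "s \<le> max (x i) (?y i)" for s
      unfolding cube_def mem_Collect_eq
    proof (intro conjI allI impI)
      fix j assume "j < n"
      then have "\<bar>?y j - x j\<bar> < d" using elim by (auto simp: cube_def)
      moreover have "\<bar>s - x i\<bar> \<le> \<bar>?y i - x i\<bar>" using that by linarith
      ultimately show "\<bar>(?z(i := s)) j - x j\<bar> < d" using d(1) by (cases "j = i") auto
    qed (use elim i eopen_subset[OF W x] in \<open>auto simp: cube_def\<close>)
    have zz: "(\<lambda>j. if j < Suc i then ?y j else x j) = ?z(i := ?y i)" "?z = ?z(i := x i)"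
      by (auto simp: less_Suc_eq)
    show ?case
    proof (cases "?y i = x i")
      case True
      then show ?thesis using e by (simp add: slope_def)
    next
      case False
      have "\<exists>s. min (x i) (?y i) \<le> s \<and> s \<le> max (x i) (?y i) \<and>
        f (?z(i := ?y i)) - f (?z(i := x i)) = (?y i - x i) * partial_deriv i f (?z(i := s))"
      proof (rule mean_value_real)
        fix s assume s: "min (x i) (?y i) \<le> s" "s \<le> max (x i) (?y i)"
        have "((\<lambda>t. f ((?z(i := s))(i := t))) has_field_derivative partial_deriv i f (?z(i := s))) (at ((?z(i := s)) i))"
          by (rule Ck_has_partial[OF f _ i]) (use z[OF s] d(2) in blast)
        then show "((\<lambda>t. f (?z(i := t))) has_field_derivative partial_deriv i f (?z(i := s))) (at s)" by simp
      qed (use False in auto)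
      then obtain s where s: "min (x i) (?y i) \<le> s" "s \<le> max (x i) (?y i)"
        "f (?z(i := ?y i)) - f (?z(i := x i)) = (?y i - x i) * partial_deriv i f (?z(i := s))" by blast
      have "slope i f x ?y = partial_deriv i f (?z(i := s))"
        unfolding slope_def zz(1) using s(3) False by (subst zz(2)) simp
      moreover have "\<bar>partial_deriv i f (?z(i := s)) - partial_deriv i f x\<bar> < e"
        using z[OF s(1,2)] d(2) by blast
      ultimately show ?thesis by (simp add: dist_real_def)
    qed
  qed
qed

lemma Ck_chain_curve:
  assumes W: "eopen n W" and f: "Ck_on (Suc k) n W f" and x: "g t0 \<in> W"
    and g: "\<And>j. j < n \<Longrightarrow> ((\<lambda>t. g t j) has_field_derivative g' j) (at t0)"
      "\<forall>\<^sub>F t in at t0. \<forall>j\<ge>n. g t j = 0"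
  shows "((\<lambda>t. f (g t)) has_field_derivative (\<Sum>j<n. g' j * partial_deriv j f (g t0))) (at t0)"
proof -
  have f1: "Ck_on (Suc 0) n W f" using f by (induction k) (blast intro: Ck_of_Suc)+
  have gt: "((\<lambda>t. g t j) \<longlongrightarrow> g t0 j) (at t0)" if "j < n" for j
    using DERIV_isCont[OF g(1)[OF that]] isCont_def by blast
  have "((\<lambda>t. \<Sum>j<n. (g t j - g t0 j) / (t - t0) * slope j f (g t0) (g t)) \<longlongrightarrow>
     (\<Sum>j<n. g' j * partial_deriv j f (g t0))) (at t0)"
    by (intro tendsto_sum tendsto_mult slope_tendsto[OF W f1 x] gt g(2))
      (use g(1) in \<open>auto simp: has_field_derivative_iff\<close>)
  moreover have "\<forall>\<^sub>F t in at t0. (\<Sum>j<n. (g t j - g t0 j) / (t - t0) * slope j f (g t0) (g t)) = (f (g t) - f (g t0)) / (t - t0)"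
    using g(2)
  proof eventually_elim
    case (elim t)
    have "f (g t) - f (g t0) = (\<Sum>j<n. (g t j - g t0 j) * slope j f (g t0) (g t))"
      by (rule slope_sum) (use elim eopen_subset[OF W x] in auto)
    then show ?case by (simp add: sum_divide_distrib)
  qed
  ultimately show ?thesis unfolding has_field_derivative_iff by (rule Lim_transform_eventually)
qed

lemma continuous_on_eopen_maps:
  fixes g :: "(nat \<Rightarrow> real) \<Rightarrow> nat \<Rightarrow> real"
  assumes "\<And>x i. x \<in> V \<Longrightarrow> i \<ge> n \<Longrightarrow> g x i = 0" "\<And>i. i < n \<Longrightarrow> continuous_on V (\<lambda>x. g x i)"
  shows "continuous_on V g"
proof (rule continuous_on_coordinatewise_then_product)
  fix i show "continuous_on V (\<lambda>x. g x i)"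
    using assms continuous_on_cong[of V V "\<lambda>x. g x i" "\<lambda>x. 0"] by (cases "i < n") auto
qed

text \<open>By the chain rule, the partial derivatives of the composition are sums of products of functions of lower
  order, one factor being again a composition with g; hence the induction on k is uniform in f.\<close>

lemma Ck_compose:
  assumes W: "eopen n W" and V: "eopen m V"
    and f: "Ck_on k n W f" and g: "\<And>j. j < n \<Longrightarrow> Ck_on k m V (\<lambda>x. g x j)" and gW: "g ` V \<subseteq> W"
  shows "Ck_on k m V (\<lambda>x. f (g x))"
  using f g
proof (induction k arbitrary: f)
  case (0 f)
  have "continuous_on V g"
    by (rule continuous_on_eopen_maps[of _ n]) (use 0 eopen_subset[OF W] gW in auto)
  then show ?case using continuous_on_compose2[of W f V g] 0 gW by simp
next
  case (Suc k)
  have g': "Ck_on k m V (\<lambda>x. g x j)" if "j < n" for j using Suc.prems(2)[OF that] Ck_of_Suc by blast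
  show ?case
  proof (rule Ck_SucI[where D = "\<lambda>i x. \<Sum>j<n. partial_deriv i (\<lambda>x. g x j) x * partial_deriv j f (g x)", OF V])
    show "continuous_on V (\<lambda>x. f (g x))"
      using Suc.IH[OF Ck_of_Suc[OF Suc.prems(1)] g'] Ck_continuous by blast
  next
    fix i x assume i: "i < m" and x: "x \<in> V"
    have "\<forall>\<^sub>F t in at (x i). x(i := t) \<in> V"
      using eventually_update_in_eopen[OF V x i] by (simp add: eventually_nhds_conv_at)
    then have "\<forall>\<^sub>F t in at (x i). \<forall>j\<ge>n. g (x(i := t)) j = 0"
      by eventually_elim (use gW eopen_subset[OF W] in blast)
    then show "((\<lambda>t. f (g (x(i := t)))) has_field_derivative (\<Sum>j<n. partial_deriv i (\<lambda>x. g x j) x * partial_deriv j f (g x))) (at (x i))"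
      using Ck_chain_curve[OF W Suc.prems(1), of "\<lambda>t. g (x(i := t))" "x i" "\<lambda>j. partial_deriv i (\<lambda>x. g x j) x"]
        Ck_has_partial[OF Suc.prems(2) x i] x gW by (simp add: image_subset_iff)
  next
    fix i assume i: "i < m"
    show "Ck_on k m V (\<lambda>x. \<Sum>j<n. partial_deriv i (\<lambda>x. g x j) x * partial_deriv j f (g x))"
    proof (rule Ck_sum[OF V], rule Ck_mult[OF V])
      fix j assume j: "j \<in> {..<n}"
      show "Ck_on k m V (partial_deriv i (\<lambda>x. g x j))" using Suc.prems(2)[of j] i j by simp
      have "Ck_on k n W (partial_deriv j f)" using Suc.prems(1) j by simp
      then show "Ck_on k m V (\<lambda>x. partial_deriv j f (g x))" by (rule Suc.IH[OF _ g'])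
    qed
  qed
qed

subsection \<open>Smooth functions\<close>

lemma Cinf_cong: "eopen n W \<Longrightarrow> (\<And>y. y \<in> W \<Longrightarrow> f y = g y) \<Longrightarrow> Cinf_on n W f \<Longrightarrow> Cinf_on n W g"
  unfolding Cinf_on_def using Ck_cong by blast

lemma Cinf_subset: "Cinf_on n W f \<Longrightarrow> V \<subseteq> W \<Longrightarrow> Cinf_on n V f"
  unfolding Cinf_on_def using Ck_subset by blast

lemma Cinf_local:
  assumes "eopen n W" "\<And>x. x \<in> W \<Longrightarrow> \<exists>V. eopen n V \<and> x \<in> V \<and> V \<subseteq> W \<and> Cinf_on n V f"
  shows "Cinf_on n W f"
  unfolding Cinf_on_def
proof
  fix k show "Ck_on k n W f"
  proof (rule Ck_local[OF assms(1)])
    fix x assume "x \<in> W"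
    from assms(2)[OF this] show "\<exists>V. eopen n V \<and> x \<in> V \<and> V \<subseteq> W \<and> Ck_on k n V f"
      unfolding Cinf_on_def by fast
  qed
qed

lemma Cinf_const: "Cinf_on n W (\<lambda>x. c)"
  unfolding Cinf_on_def using Ck_const by blast

lemma Cinf_proj: "eopen n W \<Longrightarrow> Cinf_on n W (\<lambda>x. x j)"
  unfolding Cinf_on_def using Ck_proj by blast

lemma Cinf_add: "eopen n W \<Longrightarrow> Cinf_on n W f \<Longrightarrow> Cinf_on n W g \<Longrightarrow> Cinf_on n W (\<lambda>x. f x + g x)"
  unfolding Cinf_on_def using Ck_add by blast

lemma Cinf_mult: "eopen n W \<Longrightarrow> Cinf_on n W f \<Longrightarrow> Cinf_on n W g \<Longrightarrow> Cinf_on n W (\<lambda>x. f x * g x)"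
  unfolding Cinf_on_def using Ck_mult by blast

lemma Cinf_compose:
  assumes "eopen n W" "eopen m V" "Cinf_on n W f" "\<And>j. j < n \<Longrightarrow> Cinf_on m V (\<lambda>x. g x j)" "g ` V \<subseteq> W"
  shows "Cinf_on m V (\<lambda>x. f (g x))"
  unfolding Cinf_on_def
proof
  fix k show "Ck_on k m V (\<lambda>x. f (g x))"
    by (rule Ck_compose[OF assms(1,2) _ _ assms(5)]) (use assms(3,4) in \<open>unfold Cinf_on_def, blast+\<close>)
qed

lemma Cinf_continuous: "Cinf_on n W f \<Longrightarrow> continuous_on W f"
  unfolding Cinf_on_def using Ck_continuous by blast

lemma Cinf_partial: "Cinf_on n W f \<Longrightarrow> i < n \<Longrightarrow> Cinf_on n W (partial_deriv i f)"
  unfolding Cinf_on_def by (metis Ck_on.simps(2))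

lemma Cinf_has_partial:
  assumes "Cinf_on n W f" "x \<in> W" "i < n"
  shows "((\<lambda>t. f (x(i := t))) has_field_derivative partial_deriv i f x) (at (x i))"
  using Ck_has_partial[OF _ assms(2,3), of 0] assms(1) unfolding Cinf_on_def by blast

section \<open>Hadamard's lemma\<close>

definition segment_point :: "(nat \<Rightarrow> real) \<Rightarrow> real \<Rightarrow> (nat \<Rightarrow> real) \<Rightarrow> nat \<Rightarrow> real" where
  "segment_point a t x = (\<lambda>j. a j + t * (x j - a j))"

lemma segment_point_in_cube:
  assumes "\<And>i. i \<ge> n \<Longrightarrow> a i = 0" "x \<in> cube n a e" "0 \<le> t" "t \<le> 1"
  shows "segment_point a t x \<in> cube n a e"
  unfolding cube_def mem_Collect_eq
proof (intro conjI allI impI)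
  fix i assume i: "i < n"
  have "\<bar>t * (x i - a i)\<bar> \<le> 1 * \<bar>x i - a i\<bar>" unfolding abs_mult using assms(3,4) by (intro mult_right_mono) auto
  also have "\<dots> < e" using assms(2) i by (simp add: cube_def)
  finally show "\<bar>segment_point a t x i - a i\<bar> < e" by (simp add: segment_point_def)
qed (use assms in \<open>auto simp: cube_def segment_point_def\<close>)

lemma continuous_on_segment_integrand:
  assumes a: "\<And>i. i \<ge> n \<Longrightarrow> a i = 0" and u: "continuous_on (cube n a e) u"
  shows "continuous_on (cube n a e \<times> cbox 0 1) (\<lambda>(x, t). t ^ p * u (segment_point a t x))"
proof -
  let ?S = "cube n a e \<times> cbox (0::real) 1"
  have "continuous_on ?S (\<lambda>z. segment_point a (snd z) (fst z) j)" for j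
    unfolding segment_point_def
    by (intro continuous_intros continuous_on_compose2[OF continuous_on_coordinate[of UNIV] continuous_on_fst]) auto
  then have "continuous_on ?S (\<lambda>z. segment_point a (snd z) (fst z))"
    by (rule continuous_on_coordinatewise_then_product)
  then have "continuous_on ?S (\<lambda>z. u (segment_point a (snd z) (fst z)))"
    by (rule continuous_on_compose2[OF u]) (use segment_point_in_cube[OF a] in auto)
  then show ?thesis unfolding split_beta by (intro continuous_intros)
qed

lemma continuous_on_segment_integrand_at:
  assumes a: "\<And>i. i \<ge> n \<Longrightarrow> a i = 0" and u: "continuous_on (cube n a e) u" and x: "x \<in> cube n a e"
  shows "continuous_on (cbox 0 1) (\<lambda>t. t ^ p * u (segment_point a t x))"
proof -
  have "continuous_on (cbox 0 1) (\<lambda>t::real. (x, t))" by (intro continuous_intros)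
  from continuous_on_compose2[OF continuous_on_segment_integrand[OF a u, of p] this] show ?thesis
    using x by auto
qed

text \<open>Differentiation under the integral sign replaces u by a partial derivative of u and raises the power of t
  by one. The power is carried along to close the induction.\<close>

lemma Ck_segment_integral:
  assumes a: "\<And>i. i \<ge> n \<Longrightarrow> a i = 0" and u: "Cinf_on n (cube n a e) u"
  shows "Ck_on k n (cube n a e) (\<lambda>x. integral (cbox 0 1) (\<lambda>t. t ^ p * u (segment_point a t x)))"
  using u
proof (induction k arbitrary: u p)
  case 0
  show ?case unfolding Ck_on.simps
    by (rule integral_continuous_on_param[OF continuous_on_segment_integrand[OF a Cinf_continuous[OF 0]]])
next
  case (Suc k)
  note u = Suc.prems
  show ?case
  proof (rule Ck_SucI[where D = "\<lambda>i x. integral (cbox 0 1) (\<lambda>t. t ^ (Suc p) * partial_deriv i u (segment_point a t x))",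
        OF eopen_cube])
    show "continuous_on (cube n a e) (\<lambda>x. integral (cbox 0 1) (\<lambda>t. t ^ p * u (segment_point a t x)))"
      by (rule integral_continuous_on_param[OF continuous_on_segment_integrand[OF a Cinf_continuous[OF u]]])
    show "Ck_on k n (cube n a e) (\<lambda>x. integral (cbox 0 1) (\<lambda>t. t ^ (Suc p) * partial_deriv i u (segment_point a t x)))"
      if "i < n" for i by (rule Suc.IH[OF Cinf_partial[OF u that]])
  next
    fix i x assume i: "i < n" and x: "x \<in> cube n a e"
    let ?U = "{a i - e<..<a i + e}"
    have xs: "x(i := s) \<in> cube n a e" if "s \<in> ?U" for s
      using x that i by (auto simp: cube_def abs_less_iff)
    have "((\<lambda>s. integral (cbox 0 1) (\<lambda>t. t ^ p * u (segment_point a t (x(i := s))))) has_field_derivative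
      integral (cbox 0 1) (\<lambda>t. t ^ (Suc p) * partial_deriv i u (segment_point a t (x(i := x i))))) (at (x i) within ?U)"
    proof (rule leibniz_rule_field_derivative)
      fix s t :: real assume s: "s \<in> ?U" and t: "t \<in> cbox 0 1"
      define y where "y = segment_point a t (x(i := s))"
      have y: "y \<in> cube n a e" unfolding y_def using segment_point_in_cube[OF a xs[OF s]] t by auto
      have yi: "y i = a i + t * (s - a i)" by (simp add: y_def segment_point_def)
      have upd: "segment_point a t (x(i := r)) = y(i := a i + t * (r - a i))" for r
        by (auto simp: y_def segment_point_def)
      have "((\<lambda>r. u (y(i := r))) has_field_derivative partial_deriv i u y) (at (a i + t * (s - a i)))"
        using Cinf_has_partial[OF u y i] unfolding yi .
      moreover have "((\<lambda>r. a i + t * (r - a i)) has_field_derivative t) (at s)"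
        by (auto intro!: derivative_eq_intros)
      ultimately have "((\<lambda>r. u (y(i := a i + t * (r - a i)))) has_field_derivative partial_deriv i u y * t) (at s)"
        by (rule DERIV_chain2)
      then have "((\<lambda>r. u (segment_point a t (x(i := r)))) has_field_derivative partial_deriv i u y * t) (at s)"
        unfolding upd .
      then have "((\<lambda>r. t ^ p * u (segment_point a t (x(i := r)))) has_field_derivative t ^ p * (partial_deriv i u y * t)) (at s)"
        by (rule DERIV_cmult)
      then have "((\<lambda>r. t ^ p * u (segment_point a t (x(i := r)))) has_field_derivative t ^ Suc p * partial_deriv i u y) (at s)"
        by (rule DERIV_cong) simp
      then show "((\<lambda>r. t ^ p * u (segment_point a t (x(i := r)))) has_field_derivative
          t ^ Suc p * partial_deriv i u (segment_point a t (x(i := s)))) (at s within ?U)"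
        unfolding y_def by (rule has_field_derivative_at_within)
    next
      fix s assume "s \<in> ?U"
      then show "(\<lambda>t. t ^ p * u (segment_point a t (x(i := s)))) integrable_on cbox 0 1"
        by (intro integrable_continuous continuous_on_segment_integrand_at[OF a Cinf_continuous[OF u]] xs)
    next
      have "continuous_on (?U \<times> cbox (0::real) 1) (\<lambda>z. (x(i := fst z)) j)" for j
        by (cases "j = i") (auto intro!: continuous_intros)
      then have cont: "continuous_on (?U \<times> cbox (0::real) 1) (\<lambda>z. (x(i := fst z), snd z))"
        by (intro continuous_on_Pair continuous_on_coordinatewise_then_product continuous_on_snd continuous_on_id)
      have img: "(\<lambda>z. (x(i := fst z), snd z)) ` (?U \<times> cbox 0 1) \<subseteq> cube n a e \<times> cbox 0 1"
        using xs by (auto simp del: fun_upd_apply)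
      have "continuous_on (cube n a e) (partial_deriv i u)" by (rule Cinf_continuous[OF Cinf_partial[OF u i]])
      from continuous_on_compose2[OF continuous_on_segment_integrand[OF a this, of "Suc p"] cont img]
      show "continuous_on (?U \<times> cbox 0 1) (\<lambda>(s, t). t ^ Suc p * partial_deriv i u (segment_point a t (x(i := s))))"
        by (simp add: case_prod_unfold)
    qed (use x i in \<open>auto simp: cube_def abs_less_iff\<close>)
    moreover have "at (x i) within ?U = at (x i)"
      by (rule at_within_open) (use x i in \<open>auto simp: cube_def abs_less_iff\<close>)
    ultimately show "((\<lambda>s. integral (cbox 0 1) (\<lambda>t. t ^ p * u (segment_point a t (x(i := s))))) has_field_derivative
      integral (cbox 0 1) (\<lambda>t. t ^ (Suc p) * partial_deriv i u (segment_point a t x))) (at (x i))" by simp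
  qed
qed

text \<open>The fundamental theorem of calculus along the segment from a to x, with \<open>g i x\<close> the average of the i-th
  partial derivative over this segment.\<close>

lemma Hadamard:
  assumes W: "eopen n W" and f: "Cinf_on n W f" and aW: "a \<in> W"
  obtains e g where "e > 0" "cube n a e \<subseteq> W"
    "\<And>i. i < n \<Longrightarrow> Cinf_on n (cube n a e) (g i)" "\<And>i. i < n \<Longrightarrow> g i a = partial_deriv i f a"
    "\<And>x. x \<in> cube n a e \<Longrightarrow> f x = f a + (\<Sum>i<n. (x i - a i) * g i x)"
proof -
  obtain e where e: "e > 0" "cube n a e \<subseteq> W" using eopen_cube_subset[OF W aW] by blast
  have a: "a i = 0" if "i \<ge> n" for i using eopen_subset[OF W aW that] .
  let ?Q = "cube n a e"
  have fQ: "Cinf_on n ?Q f" using Cinf_subset[OF f e(2)] .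
  define g where "g i x = integral (cbox 0 1) (\<lambda>t. t ^ 0 * partial_deriv i f (segment_point a t x))" for i x
  have "f x = f a + (\<Sum>i<n. (x i - a i) * g i x)" if x: "x \<in> ?Q" for x
  proof -
    have A: "((\<lambda>t. \<Sum>i<n. (x i - a i) * (t ^ 0 * partial_deriv i f (segment_point a t x))) has_integral
       (f (segment_point a 1 x) - f (segment_point a 0 x))) {0..1}"
    proof (rule fundamental_theorem_of_calculus)
      fix t :: real assume t: "t \<in> {0..1}"
      have "((\<lambda>t. f (segment_point a t x)) has_field_derivative
         (\<Sum>i<n. (x i - a i) * partial_deriv i f (segment_point a t x))) (at t)"
      proof (rule Ck_chain_curve[OF eopen_cube])
        show "Ck_on (Suc 0) n ?Q f" using fQ unfolding Cinf_on_def by blast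
        show "segment_point a t x \<in> ?Q" using segment_point_in_cube[OF a x] t by auto
        show "((\<lambda>t. segment_point a t x j) has_field_derivative x j - a j) (at t)" for j
          unfolding segment_point_def by (auto intro!: derivative_eq_intros)
        show "\<forall>\<^sub>F t in at t. \<forall>j\<ge>n. segment_point a t x j = 0"
          using x a by (auto simp: segment_point_def cube_def)
      qed
      then show "((\<lambda>t. f (segment_point a t x)) has_vector_derivative
         (\<Sum>i<n. (x i - a i) * (t ^ 0 * partial_deriv i f (segment_point a t x)))) (at t within {0..1})"
        by (simp add: has_real_derivative_iff_has_vector_derivative has_vector_derivative_at_within)
    qed simp
    have ends: "segment_point a 1 x = x" "segment_point a 0 x = a" by (auto simp: segment_point_def)
    have B: "((\<lambda>t. \<Sum>i<n. (x i - a i) * (t ^ 0 * partial_deriv i f (segment_point a t x))) has_integral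
       (\<Sum>i<n. (x i - a i) * g i x)) {0..1}"
    proof (intro has_integral_sum has_integral_mult_right finite_lessThan)
      fix i assume "i \<in> {..<n}"
      then have "continuous_on ?Q (partial_deriv i f)" using Cinf_continuous[OF Cinf_partial[OF fQ]] by simp
      from continuous_on_segment_integrand_at[OF a this x, of 0]
      have "(\<lambda>t. t ^ 0 * partial_deriv i f (segment_point a t x)) integrable_on cbox 0 1"
        by (rule integrable_continuous)
      then show "((\<lambda>t. t ^ 0 * partial_deriv i f (segment_point a t x)) has_integral g i x) {0..1}"
        unfolding g_def by (simp add: has_integral_integral)
    qed
    show ?thesis using has_integral_unique[OF A B] unfolding ends by linarith
  qed
  moreover have "Cinf_on n ?Q (g i)" if "i < n" for i
    unfolding Cinf_on_def g_def using Ck_segment_integral[OF a Cinf_partial[OF fQ that]] by blast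
  moreover have "g i a = partial_deriv i f a" for i
    by (simp add: g_def segment_point_def)
  ultimately show ?thesis using that e by blast
qed

section \<open>Replacing a coordinate by a function\<close>

text \<open>A diffeomorphism from W onto an open set, with smoothness expressed by the components of the map and of
  its inverse.\<close>

definition ediff :: "nat \<Rightarrow> (nat \<Rightarrow> real) set \<Rightarrow> ((nat \<Rightarrow> real) \<Rightarrow> nat \<Rightarrow> real) \<Rightarrow> bool" where
  "ediff n W \<theta> \<longleftrightarrow> eopen n W \<and> eopen n (\<theta> ` W) \<and> inj_on \<theta> W \<and>
     (\<forall>i<n. Cinf_on n W (\<lambda>x. \<theta> x i)) \<and> (\<forall>i<n. Cinf_on n (\<theta> ` W) (\<lambda>y. inv_into W \<theta> y i))"

text \<open>The factor c, later \<open>partial_deriv k f a\<close>, makes the two signs of the derivative a single case.\<close>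

lemma replace_coordinate_strict:
  assumes f: "Cinf_on n (cube n a e) f" and k: "k < n"
    and pos: "\<And>x. x \<in> cube n a e \<Longrightarrow> partial_deriv k f x * c > 0"
    and x: "x(k := s) \<in> cube n a e" "x(k := t) \<in> cube n a e" and st: "s < t"
  shows "f (x(k := s)) * c < f (x(k := t)) * c"
proof -
  have in_cube: "x(k := r) \<in> cube n a e" if r: "s \<le> r" "r \<le> t" for r
    unfolding cube_def mem_Collect_eq
  proof (intro conjI allI impI)
    fix i assume "i < n"
    then have "\<bar>(x(k := s)) i - a i\<bar> < e" "\<bar>(x(k := t)) i - a i\<bar> < e" using x by (auto simp: cube_def)
    then show "\<bar>(x(k := r)) i - a i\<bar> < e" using r by (cases "i = k") auto
  qed (use x k in \<open>auto simp: cube_def\<close>)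
  have "((\<lambda>r. f (x(k := r))) has_field_derivative partial_deriv k f (x(k := r))) (at r)" if "s \<le> r" "r \<le> t" for r
    using Cinf_has_partial[OF f in_cube[OF that] k] by simp
  then obtain r where r: "s < r" "r < t" "f (x(k := t)) - f (x(k := s)) = (t - s) * partial_deriv k f (x(k := r))"
    using MVT2[OF st, of "\<lambda>r. f (x(k := r))" "\<lambda>r. partial_deriv k f (x(k := r))"] by blast
  have "0 < (t - s) * (partial_deriv k f (x(k := r)) * c)"
    using st pos[OF in_cube[of r]] r by simp
  also have "\<dots> = (f (x(k := t)) - f (x(k := s))) * c" unfolding r(3) by simp
  also have "\<dots> = f (x(k := t)) * c - f (x(k := s)) * c" by (rule left_diff_distrib)
  finally show ?thesis by simp
qed

text \<open>Along the k-th coordinate line through x, the function f is strictly monotone, so its values at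
  \<open>x k - d\<close> and \<open>x k + d\<close> lie on different sides of \<open>f x\<close>. They still enclose \<open>y k\<close> if y is close to
  \<open>x(k := f x)\<close>, and the intermediate value theorem applies. The bound by \<open>\<epsilon>\<close> on the solution yields both
  that the image of \<open>x \<mapsto> x(k := f x)\<close> is open and that the inverse is continuous.\<close>

lemma replace_coordinate_solve:
  assumes f: "Cinf_on n (cube n a e) f" and k: "k < n" and a: "\<And>i. i \<ge> n \<Longrightarrow> a i = 0"
    and pos: "\<And>x. x \<in> cube n a e \<Longrightarrow> partial_deriv k f x * c > 0"
    and x: "x \<in> cube n a e" and eps: "\<epsilon> > 0"
  shows "\<exists>d>0. \<forall>y\<in>cube n (x(k := f x)) d. \<exists>t. \<bar>t - x k\<bar> < \<epsilon> \<and> y(k := t) \<in> cube n a e \<and> f (y(k := t)) = y k"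
proof -
  let ?Q = "cube n a e" and ?y = "x(k := f x)"
  define d where "d = min \<epsilon> (e - \<bar>x k - a k\<bar>) / 2"
  have "\<bar>x k - a k\<bar> < e" using x k by (auto simp: cube_def)
  then have d: "d > 0" "d < \<epsilon>" "\<bar>x k - a k\<bar> + d < e" using eps by (auto simp: d_def min_def field_simps)
  define V where "V = {y. (\<forall>i\<ge>n. y i = 0) \<and> (\<forall>i\<in>{..<n}-{k}. y i \<in> {s. \<bar>s - a i\<bar> < e})}"
  have V: "eopen n V" unfolding V_def by (intro eopen_Collect) (auto intro!: open_Collect_less continuous_intros)
  have VQ: "y(k := t) \<in> ?Q \<longleftrightarrow> \<bar>t - a k\<bar> < e" if "y \<in> V" for y t
    using that k by (auto simp: V_def cube_def)
  have yV: "?y \<in> V" using x k by (auto simp: V_def cube_def)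
  have cont: "continuous_on V (\<lambda>y. (f (y(k := t)) - y k) * c)" if "\<bar>t - a k\<bar> < e" for t
  proof -
    have "Cinf_on n V (\<lambda>y. f (y(k := t)))"
    proof (rule Cinf_compose[where f = f and g = "\<lambda>y. y(k := t)", OF eopen_cube V f])
      show "Cinf_on n V (\<lambda>y. (y(k := t)) j)" for j
        by (cases "j = k") (auto intro: Cinf_const Cinf_proj[OF V])
    qed (use VQ that in auto)
    then show ?thesis by (intro continuous_intros Cinf_continuous continuous_on_coordinate)
  qed
  let ?t1 = "x k - d" and ?t2 = "x k + d"
  have t: "\<bar>?t1 - a k\<bar> < e" "\<bar>?t2 - a k\<bar> < e" using d by auto
  have Q1: "x(k := ?t1) \<in> ?Q" "x(k := ?t2) \<in> ?Q" "x(k := x k) \<in> ?Q"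
    using t x k by (auto simp: cube_def)
  have "f (x(k := ?t1)) * c < f (x(k := x k)) * c"
    by (rule replace_coordinate_strict[OF f k pos Q1(1,3)]) (use d in simp_all)
  moreover have "f (x(k := x k)) * c < f (x(k := ?t2)) * c"
    by (rule replace_coordinate_strict[OF f k pos Q1(3,2)]) (use d in simp_all)
  ultimately have mem: "?y \<in> {y \<in> V. (f (y(k := ?t1)) - y k) * c < 0} \<inter> {y \<in> V. 0 < (f (y(k := ?t2)) - y k) * c}"
    using yV by (simp add: left_diff_distrib)
  have op: "eopen n ({y \<in> V. (f (y(k := ?t1)) - y k) * c < 0} \<inter> {y \<in> V. 0 < (f (y(k := ?t2)) - y k) * c})"
    by (rule openin_Int[OF eopen_Collect_less[OF V cont[OF t(1)] continuous_on_const]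
          eopen_Collect_less[OF V continuous_on_const cont[OF t(2)]]])
  obtain \<delta> where \<delta>: "\<delta> > 0" "cube n ?y \<delta> \<subseteq> {y \<in> V. (f (y(k := ?t1)) - y k) * c < 0} \<inter> {y \<in> V. 0 < (f (y(k := ?t2)) - y k) * c}"
    by (rule eopen_cube_subset[OF op mem])
  have "\<exists>t. \<bar>t - x k\<bar> < \<epsilon> \<and> y(k := t) \<in> ?Q \<and> f (y(k := t)) = y k" if "y \<in> cube n ?y \<delta>" for y
  proof -
    have yV: "y \<in> V" and y1: "(f (y(k := ?t1)) - y k) * c < 0" and y2: "0 < (f (y(k := ?t2)) - y k) * c"
      using subsetD[OF \<delta>(2) that] by simp_all
    have yQ: "y(k := t) \<in> ?Q" if "?t1 \<le> t" "t \<le> ?t2" for t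
      using VQ[OF yV] that d(3) by auto
    have "isCont (\<lambda>t. (f (y(k := t)) - y k) * c) t" if "?t1 \<le> t" "t \<le> ?t2" for t
    proof -
      have "isCont (\<lambda>t. f (y(k := t))) t"
        using DERIV_isCont[OF Cinf_has_partial[OF f yQ[OF that] k]] by simp
      then show ?thesis by (rule continuous_mult_right[OF continuous_diff[OF _ continuous_const]])
    qed
    then have "\<exists>t\<ge>?t1. t \<le> ?t2 \<and> (f (y(k := t)) - y k) * c = 0"
      using IVT[of "\<lambda>t. (f (y(k := t)) - y k) * c" ?t1 0 ?t2] y1 y2 d(1) by auto
    then obtain t where t: "?t1 \<le> t" "t \<le> ?t2" "(f (y(k := t)) - y k) * c = 0" by blast
    moreover have "c \<noteq> 0" using y1 by auto
    moreover have "\<bar>t - x k\<bar> < \<epsilon>" using t(1,2) d(2) by linarith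
    ultimately show ?thesis using yQ[OF t(1,2)] by (intro exI[of _ t]) simp
  qed
  then show ?thesis using \<delta>(1) by blast
qed

text \<open>Write the equation \<open>f (y(k := h y)) = y k\<close> at y and at a nearby point on the i-th coordinate line, and
  subtract. In terms of slopes only the coordinates i and k contribute, so the difference quotient of h is a
  quotient of slopes, which converges since h is continuous.\<close>

lemma implicit_has_derivative:
  assumes W: "eopen n W" and f: "Cinf_on n W f" and Y: "eopen n Y" and k: "k < n" and i: "i < n"
    and h: "continuous_on Y h" "\<And>y. y \<in> Y \<Longrightarrow> y(k := h y) \<in> W \<and> f (y(k := h y)) = y k"
    and nz: "\<And>x. x \<in> W \<Longrightarrow> partial_deriv k f x \<noteq> 0" and y: "y \<in> Y"
  shows "((\<lambda>t. h (y(i := t))) has_field_derivative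
    (if i = k then 1 else - partial_deriv i f (y(k := h y))) * inverse (partial_deriv k f (y(k := h y)))) (at (y i))"
proof -
  let ?x = "y(k := h y)" and ?X = "\<lambda>t. (y(i := t))(k := h (y(i := t)))"
  let ?S = "\<lambda>j t. slope j f ?x (?X t)" and ?F = "at (y i)"
  have f1: "Ck_on (Suc 0) n W f" using f unfolding Cinf_on_def by blast
  have x: "?x \<in> W" using h y by blast
  have evY: "\<forall>\<^sub>F t in ?F. y(i := t) \<in> Y"
    using eventually_update_in_eopen[OF Y y i] by (simp add: eventually_nhds_conv_at)
  have "((\<lambda>t. y(i := t)) \<longlongrightarrow> y) ?F"
    unfolding tendsto_function_iff
  proof
    fix j show "((\<lambda>t. (y(i := t)) j) \<longlongrightarrow> y j) ?F" by (cases "j = i") (auto simp: tendsto_ident_at)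
  qed
  then have lh: "((\<lambda>t. h (y(i := t))) \<longlongrightarrow> h y) ?F"
    using continuous_on_tendsto_compose[OF h(1) _ y evY] by blast
  have X0: "\<forall>\<^sub>F t in ?F. \<forall>j\<ge>n. ?X t j = 0"
    using evY
  proof eventually_elim
    case (elim t)
    show ?case using eopen_subset[OF Y elim] k by auto
  qed
  have Xj: "((\<lambda>t. ?X t j) \<longlongrightarrow> ?x j) ?F" for j
    using lh by (cases "j = i"; cases "j = k") (auto simp: tendsto_ident_at)
  have S: "((\<lambda>t. ?S j t) \<longlongrightarrow> partial_deriv j f ?x) ?F" if "j < n" for j
    by (rule slope_tendsto[OF W f1 x that Xj X0])
  have nzx: "partial_deriv k f ?x \<noteq> 0" using nz[OF x] .
  have "((\<lambda>t. (if i = k then 1 else - ?S i t) * inverse (?S k t)) \<longlongrightarrow>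
     (if i = k then 1 else - partial_deriv i f ?x) * inverse (partial_deriv k f ?x)) ?F"
    using S[OF k] S[OF i] nzx by (auto intro!: tendsto_intros)
  moreover have "\<forall>\<^sub>F t in ?F. (if i = k then 1 else - ?S i t) * inverse (?S k t) = (h (y(i := t)) - h y) / (t - y i)"
    using evY X0 tendsto_imp_eventually_ne[OF S[OF k] nzx] eventually_at_ball'[OF zero_less_one, of "y i" UNIV]
  proof eventually_elim
    case (elim t)
    have "f (?X t) - f ?x = (\<Sum>j<n. (?X t j - ?x j) * ?S j t)"
      by (rule slope_sum) (use elim(2) eopen_subset[OF W x] in auto)
    also have "\<dots> = (\<Sum>j<n. (if j = k then (h (y(i := t)) - h y) * ?S k t else 0) +
        (if j = i then (if i = k then 0 else (t - y i) * ?S i t) else 0))"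
      by (rule sum.cong) auto
    also have "\<dots> = (h (y(i := t)) - h y) * ?S k t + (if i = k then 0 else (t - y i) * ?S i t)"
      using k i by (simp add: sum.distrib)
    finally have eq: "(y(i := t)) k - y k = (h (y(i := t)) - h y) * ?S k t + (if i = k then 0 else (t - y i) * ?S i t)"
      using h(2)[OF elim(1)] h(2)[OF y] by simp
    show ?case
    proof (cases "i = k")
      case True
      then show ?thesis using eq elim(3,4) by (simp add: field_simps)
    next
      case False
      then have "(h (y(i := t)) - h y) * ?S k t = (t - y i) * (- ?S i t)" using eq by simp
      then show ?thesis using False elim(3,4) by (simp add: field_simps)
    qed
  qed
  ultimately have "((\<lambda>t. (h (y(i := t)) - h y) / (t - y i)) \<longlongrightarrow>
     (if i = k then 1 else - partial_deriv i f ?x) * inverse (partial_deriv k f ?x)) ?F"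
    by (rule Lim_transform_eventually)
  then show ?thesis unfolding has_field_derivative_iff by simp
qed

text \<open>The derivatives of h are rational in the derivatives of f at \<open>y(k := h y)\<close>. So h gains one order of
  differentiability at each step.\<close>

lemma implicit_Ck:
  assumes W: "eopen n W" and f: "Cinf_on n W f" and Y: "eopen n Y" and k: "k < n"
    and h: "continuous_on Y h" "\<And>y. y \<in> Y \<Longrightarrow> y(k := h y) \<in> W \<and> f (y(k := h y)) = y k"
    and nz: "\<And>x. x \<in> W \<Longrightarrow> partial_deriv k f x \<noteq> 0"
  shows "Ck_on m n Y h"
proof (induction m)
  case 0
  then show ?case using h(1) by simp
next
  case (Suc m)
  show ?case
  proof (rule Ck_SucI[where D = "\<lambda>i y. (if i = k then 1 else - partial_deriv i f (y(k := h y))) *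
        inverse (partial_deriv k f (y(k := h y)))", OF Y h(1)])
    show "((\<lambda>t. h (y(i := t))) has_field_derivative (if i = k then 1 else - partial_deriv i f (y(k := h y))) *
        inverse (partial_deriv k f (y(k := h y)))) (at (y i))" if "i < n" "y \<in> Y" for i y
      by (rule implicit_has_derivative[OF W f Y k that(1) h nz that(2)])
  next
    fix i assume i: "i < n"
    have comp: "Ck_on m n Y (\<lambda>y. g (y(k := h y)))" if "Cinf_on n W g" for g
    proof (rule Ck_compose[where f = g and g = "\<lambda>y. y(k := h y)", OF W Y])
      show "Ck_on m n W g" using that unfolding Cinf_on_def by blast
      show "Ck_on m n Y (\<lambda>y. (y(k := h y)) j)" for j
        using Suc.IH Ck_proj[OF Y] by (cases "j = k") auto
    qed (use h(2) in auto)
    have "Ck_on m n Y (\<lambda>y. if i = k then 1 else - partial_deriv i f (y(k := h y)))"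
      using Ck_const[of m n Y 1] Ck_mult[OF Y Ck_const[of m n Y "-1"] comp[OF Cinf_partial[OF f i]]]
      by (cases "i = k") auto
    moreover have "Ck_on m n Y (\<lambda>y. inverse (partial_deriv k f (y(k := h y))))"
      by (rule Ck_inverse[OF Y comp[OF Cinf_partial[OF f k]]]) (use h(2) nz in auto)
    ultimately show "Ck_on m n Y (\<lambda>y. (if i = k then 1 else - partial_deriv i f (y(k := h y))) *
        inverse (partial_deriv k f (y(k := h y))))"
      by (rule Ck_mult[OF Y])
  qed
qed

lemma ediff_replace_coordinate:
  assumes W: "eopen n W" and f: "Cinf_on n W f" and aW: "a \<in> W" and k: "k < n"
    and nz: "partial_deriv k f a \<noteq> 0"
  obtains e where "e > 0" "cube n a e \<subseteq> W" "ediff n (cube n a e) (\<lambda>x. x(k := f x))"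
proof -
  let ?c = "partial_deriv k f a"
  let ?\<theta> = "\<lambda>x. x(k := f x)"
  have a: "a i = 0" if "i \<ge> n" for i using eopen_subset[OF W aW that] .
  have "eopen n {x \<in> W. 0 < partial_deriv k f x * ?c}"
    by (intro eopen_Collect_less W continuous_intros Cinf_continuous[OF Cinf_partial[OF f k]])
  moreover have "a \<in> {x \<in> W. 0 < partial_deriv k f x * ?c}" using aW nz by (metis (mono_tags, lifting) mem_Collect_eq not_real_square_gt_zero)
  ultimately obtain e where e: "e > 0" "cube n a e \<subseteq> {x \<in> W. 0 < partial_deriv k f x * ?c}"
    using eopen_cube_subset by metis
  let ?Q = "cube n a e"
  have eW: "?Q \<subseteq> W" and pos: "\<And>x. x \<in> ?Q \<Longrightarrow> partial_deriv k f x * ?c > 0" using e by auto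
  have fQ: "Cinf_on n ?Q f" using Cinf_subset[OF f eW] .
  have inj: "inj_on ?\<theta> ?Q"
  proof (rule inj_onI)
    fix x y assume x: "x \<in> ?Q" and y: "y \<in> ?Q" and eq: "x(k := f x) = y(k := f y)"
    have y': "y = x(k := y k)" using eq by (metis fun_upd_triv fun_upd_upd)
    have ff: "f y = f x" using eq by (metis fun_upd_same)
    have "\<not> x k < y k" using replace_coordinate_strict[OF fQ k pos, of x "x k" "y k"] x y y' ff by auto
    moreover have "\<not> y k < x k" using replace_coordinate_strict[OF fQ k pos, of x "y k" "x k"] x y y' ff by auto
    ultimately show "x = y" using y' by (metis fun_upd_triv linorder_neqE_linordered_idom)
  qed
  define h where "h y = inv_into ?Q ?\<theta> y k" for y
  have inv\<theta>: "inv_into ?Q ?\<theta> y = y(k := h y)" if y: "y \<in> ?\<theta> ` ?Q" for y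
  proof -
    obtain x where x: "y = ?\<theta> x" "x \<in> ?Q" using y by (rule imageE)
    then have "inv_into ?Q ?\<theta> y = x" using inv_into_f_f[OF inj x(2)] by simp
    with x show ?thesis by (simp add: h_def)
  qed
  have h: "y(k := h y) \<in> ?Q \<and> f (y(k := h y)) = y k" if y: "y \<in> ?\<theta> ` ?Q" for y
  proof -
    obtain x where x: "y = ?\<theta> x" "x \<in> ?Q" using y by (rule imageE)
    then have "inv_into ?Q ?\<theta> y = x" using inv_into_f_f[OF inj x(2)] by simp
    then have "y(k := h y) = x" using inv\<theta>[OF y] by simp
    then show ?thesis using x by simp
  qed
  have h_eq: "h y = t" "y \<in> ?\<theta> ` ?Q" if "y(k := t) \<in> ?Q" "f (y(k := t)) = y k" for y t
  proof -
    have *: "?\<theta> (y(k := t)) = y" using that by auto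
    show "y \<in> ?\<theta> ` ?Q" by (rule image_eqI[where f = ?\<theta>, OF *[symmetric] that(1)])
    have "inv_into ?Q ?\<theta> y = y(k := t)" using inv_into_f_f[OF inj that(1)] unfolding * .
    then show "h y = t" by (simp add: h_def)
  qed
  have Y: "eopen n (?\<theta> ` ?Q)"
  proof (rule eopenI)
    fix y assume "y \<in> ?\<theta> ` ?Q"
    then obtain x where x: "x \<in> ?Q" "y = ?\<theta> x" by blast
    show "\<exists>d>0. cube n y d \<subseteq> ?\<theta> ` ?Q"
      using replace_coordinate_solve[OF fQ k a pos x(1) zero_less_one] h_eq(2) unfolding x(2) by blast
  qed (use k in \<open>auto simp: cube_def\<close>)
  have hc: "continuous_on (?\<theta> ` ?Q) h"
  proof (rule continuous_on_cubeI[OF Y])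
    fix y and \<epsilon> :: real assume y: "y \<in> ?\<theta> ` ?Q" and eps: "\<epsilon> > 0"
    then obtain x where x: "x \<in> ?Q" "y = ?\<theta> x" by blast
    have "inv_into ?Q ?\<theta> y = x" using inv_into_f_f[OF inj x(1)] unfolding x(2) .
    then have "h y = x k" by (simp add: h_def)
    moreover obtain d where d: "d > 0"
      "\<forall>z\<in>cube n y d. \<exists>t. \<bar>t - x k\<bar> < \<epsilon> \<and> z(k := t) \<in> ?Q \<and> f (z(k := t)) = z k"
      using replace_coordinate_solve[OF fQ k a pos x(1) eps] unfolding x(2) by blast
    ultimately have "\<bar>h z - h y\<bar> < \<epsilon>" if z: "z \<in> cube n y d" for z
    proof -
      obtain t where "\<bar>t - x k\<bar> < \<epsilon>" "z(k := t) \<in> ?Q" "f (z(k := t)) = z k" using bspec[OF d(2) z] by blast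
      then show ?thesis using h_eq(1)[of z t] \<open>h y = x k\<close> by simp
    qed
    then show "\<exists>d>0. \<forall>z\<in>cube n y d \<inter> ?\<theta> ` ?Q. \<bar>h z - h y\<bar> < \<epsilon>"
      using d(1) by blast
  qed
  have hinf: "Cinf_on n (?\<theta> ` ?Q) h"
    unfolding Cinf_on_def
  proof
    have nz: "partial_deriv k f x \<noteq> 0" if "x \<in> ?Q" for x using pos[OF that] by auto
    show "Ck_on m n (?\<theta> ` ?Q) h" for m by (rule implicit_Ck[OF eopen_cube fQ Y k hc h nz])
  qed
  have "ediff n ?Q ?\<theta>"
    unfolding ediff_def
  proof (intro conjI allI impI eopen_cube Y inj)
    fix i assume "i < n"
    show "Cinf_on n ?Q (\<lambda>x. (x(k := f x)) i)"
      using fQ Cinf_proj[OF eopen_cube, of n a e i] by (cases "i = k") simp_all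
    have A: "Cinf_on n (?\<theta> ` ?Q) (\<lambda>y. (y(k := h y)) i)"
      using hinf Cinf_proj[OF Y, of i] by (cases "i = k") simp_all
    have B: "(y(k := h y)) i = inv_into ?Q ?\<theta> y i" if "y \<in> ?\<theta> ` ?Q" for y
      by (simp only: inv\<theta>[OF that])
    show "Cinf_on n (?\<theta> ` ?Q) (\<lambda>y. inv_into ?Q ?\<theta> y i)"
      by (rule Cinf_cong[where f = "\<lambda>y. (y(k := h y)) i" and g = "\<lambda>y. inv_into ?Q ?\<theta> y i", OF Y B A])
  qed
  then show ?thesis using that e(1) eW by blast
qed

section \<open>Charts\<close>

lemma is_chart_openD: "is_chart X n V \<phi> \<Longrightarrow> openin X V"
  by (simp add: is_chart_def)

lemma is_chart_homeo:
  assumes "is_chart X n V \<phi>"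
  shows "homeomorphic_map (subtopology X V) (subtopology (Euclidean_space n) (\<phi> ` V)) \<phi>"
    "topspace (subtopology X V) = V" "topspace (subtopology (Euclidean_space n) (\<phi> ` V)) = \<phi> ` V"
  using assms openin_subset unfolding is_chart_def by (fastforce simp: topspace_subtopology)+

lemma is_chart_inj: "is_chart X n V \<phi> \<Longrightarrow> inj_on \<phi> V"
  using is_chart_homeo[of X n V \<phi>] homeomorphic_imp_injective_map by metis

lemma is_chart_image_open:
  assumes "is_chart X n V \<phi>" "openin X U" "U \<subseteq> V"
  shows "eopen n (\<phi> ` U)"
proof -
  have "open_map (subtopology X V) (subtopology (Euclidean_space n) (\<phi> ` V)) \<phi>"
    using is_chart_homeo(1)[OF assms(1)] by (rule homeomorphic_imp_open_map)
  moreover have "openin (subtopology X V) U"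
    using assms(2,3) openin_open_subtopology[OF is_chart_openD[OF assms(1)]] by blast
  ultimately have "openin (subtopology (Euclidean_space n) (\<phi> ` V)) (\<phi> ` U)" unfolding open_map_def by blast
  moreover have "eopen n (\<phi> ` V)" using assms(1) by (simp add: is_chart_def)
  ultimately show ?thesis using openin_open_subtopology by blast
qed

lemma is_chart_vimage_open:
  assumes "is_chart X n V \<phi>" "eopen n W"
  shows "openin X {p \<in> V. \<phi> p \<in> W}"
proof -
  have "continuous_map (subtopology X V) (subtopology (Euclidean_space n) (\<phi> ` V)) \<phi>"
    using is_chart_homeo(1)[OF assms(1)] by (rule homeomorphic_imp_continuous_map)
  moreover have "openin (subtopology (Euclidean_space n) (\<phi> ` V)) (\<phi> ` V \<inter> W)"
    by (rule openin_subtopology_Int2[OF assms(2)])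
  ultimately have "openin (subtopology X V) {p \<in> topspace (subtopology X V). \<phi> p \<in> \<phi> ` V \<inter> W}"
    by (rule openin_continuous_map_preimage)
  moreover have "{p \<in> topspace (subtopology X V). \<phi> p \<in> \<phi> ` V \<inter> W} = {p \<in> V. \<phi> p \<in> W}"
    unfolding is_chart_homeo(2)[OF assms(1)] by auto
  ultimately show ?thesis
    using openin_open_subtopology[OF is_chart_openD[OF assms(1)]] by metis
qed

lemma is_chart_restrict:
  assumes "is_chart X n V \<phi>" "openin X U" "U \<subseteq> V"
  shows "is_chart X n U \<phi>"
  unfolding is_chart_def
proof (intro conjI)
  show "homeomorphic_map (subtopology X U) (subtopology (Euclidean_space n) (\<phi> ` U)) \<phi>"
  proof -
    have "homeomorphic_map (subtopology (subtopology X V) U)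
       (subtopology (subtopology (Euclidean_space n) (\<phi> ` V)) (\<phi> ` U)) \<phi>"
      by (rule homeomorphic_map_subtopologies[OF is_chart_homeo(1)[OF assms(1)]])
        (use is_chart_homeo(2,3)[OF assms(1)] assms(3) in auto)
    then show ?thesis using assms(3) by (simp add: subtopology_subtopology Int_absorb1 image_mono)
  qed
qed (use assms is_chart_image_open in auto)

lemma is_chartI:
  assumes "openin X U" "eopen n W" "\<Phi> ` U = W" "\<And>p. p \<in> U \<Longrightarrow> g (\<Phi> p) = p"
    and "continuous_map (subtopology X U) (Euclidean_space n) \<Phi>"
    and "continuous_map (subtopology (Euclidean_space n) W) X g"
  shows "is_chart X n U \<Phi>"
proof -
  have "homeomorphic_maps (subtopology X U) (subtopology (Euclidean_space n) W) \<Phi> g"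
    unfolding homeomorphic_maps_def continuous_map_in_subtopology
    using assms openin_subset[OF assms(1)] openin_subset[OF assms(2)] by (auto simp: topspace_subtopology)
  then show ?thesis
    unfolding is_chart_def homeomorphic_map_maps using assms(1-3) by auto
qed

lemma continuous_map_into_Euclidean_space:
  assumes "\<And>x i. x \<in> topspace X \<Longrightarrow> i \<ge> n \<Longrightarrow> f x i = 0" "\<And>i. i < n \<Longrightarrow> continuous_map X euclideanreal (\<lambda>x. f x i)"
  shows "continuous_map X (Euclidean_space n) f"
proof -
  have "continuous_map X (Euclidean_space n) (\<lambda>x i. if i < n then f x i else 0)"
    using assms(2) unfolding continuous_map_componentwise_Euclidean_space by blast
  then show ?thesis
    by (rule continuous_map_eq) (use assms(1) in \<open>auto simp: fun_eq_iff\<close>)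
qed

lemma eopen_vimage:
  assumes "eopen n W" "\<And>i. i < k \<Longrightarrow> continuous_on W (\<lambda>x. F x i)" "\<And>x i. x \<in> W \<Longrightarrow> i \<ge> k \<Longrightarrow> F x i = 0"
    "eopen k W'"
  shows "eopen n {x \<in> W. F x \<in> W'}"
proof -
  have F: "continuous_on W F" by (rule continuous_on_eopen_maps[of W k]) (use assms in auto)
  obtain T where T: "open T" "W' = T \<inter> {x. \<forall>i\<ge>k. x i = 0}" using assms(4) unfolding eopen_iff_trace by blast
  obtain S where S: "open S" "W = S \<inter> {x. \<forall>i\<ge>n. x i = 0}" using assms(1) unfolding eopen_iff_trace by blast
  obtain R where R: "open R" "R \<inter> W = F -` T \<inter> W"
    using continuous_on_open_invariant[THEN iffD1, OF F] T(1) by metis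
  have "{x \<in> W. F x \<in> W'} = F -` T \<inter> W" using T(2) assms(3) by auto
  also have "\<dots> = (R \<inter> S) \<inter> {x. \<forall>i\<ge>n. x i = 0}" unfolding R(2)[symmetric] using S(2) by blast
  finally show ?thesis unfolding eopen_iff_trace using R(1) S(1) by blast
qed

section \<open>Coordinate systems\<close>

text \<open>The part of \<open>smooth_manifold\<close> that does not concern the global topology. All the local theory rests on
  it, and it passes to products more easily.\<close>

definition smooth_atlas :: "'a manifold \<Rightarrow> bool" where
  "smooth_atlas M \<longleftrightarrow>
     (\<forall>V \<phi>. (V, \<phi>) \<in> charts M \<longrightarrow> is_chart (mtop M) (mdim M) V \<phi>) \<and>
     (\<forall>m. m \<in> topspace (mtop M) \<longleftrightarrow> (\<exists>V \<phi>. (V, \<phi>) \<in> charts M \<and> m \<in> V)) \<and>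
     (\<forall>V \<phi> W \<psi>. (V, \<phi>) \<in> charts M \<longrightarrow> (W, \<psi>) \<in> charts M \<longrightarrow> (\<forall>i < mdim M.
        Cinf_on (mdim M) (\<phi> ` (V \<inter> W)) (\<lambda>x. \<psi> (inv_into V \<phi> x) i)))"

lemma smooth_manifold_iff_atlas:
  "smooth_manifold M \<longleftrightarrow> Hausdorff_space (mtop M) \<and> second_countable (mtop M) \<and> smooth_atlas M"
proof -
  have "topspace (mtop M) = (\<Union>(V, \<phi>) \<in> charts M. V) \<longleftrightarrow>
     (\<forall>m. m \<in> topspace (mtop M) \<longleftrightarrow> (\<exists>V \<phi>. (V, \<phi>) \<in> charts M \<and> m \<in> V))"
    unfolding set_eq_iff by (simp add: Bex_def split_paired_Ex)
  then show ?thesis unfolding smooth_manifold_def smooth_atlas_def by (simp add: Ball_def split_paired_All)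
qed

lemma smooth_manifold_atlas: "smooth_manifold M \<Longrightarrow> smooth_atlas M"
  by (simp add: smooth_manifold_iff_atlas)

text \<open>The members of the maximal atlas: charts that are compatible with all charts of the given atlas.\<close>

definition coord :: "'a manifold \<Rightarrow> 'a set \<Rightarrow> ('a \<Rightarrow> nat \<Rightarrow> real) \<Rightarrow> bool" where
  "coord M U \<Phi> \<longleftrightarrow> is_chart (mtop M) (mdim M) U \<Phi> \<and>
     (\<forall>V \<phi>. (V, \<phi>) \<in> charts M \<longrightarrow> (\<forall>i < mdim M.
        Cinf_on (mdim M) (\<phi> ` (V \<inter> U)) (\<lambda>x. \<Phi> (inv_into V \<phi> x) i) \<and>
        Cinf_on (mdim M) (\<Phi> ` (V \<inter> U)) (\<lambda>x. \<phi> (inv_into U \<Phi> x) i)))"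

lemma coordD:
  assumes "coord M U \<Phi>"
  shows "is_chart (mtop M) (mdim M) U \<Phi>" "openin (mtop M) U" "inj_on \<Phi> U" "eopen (mdim M) (\<Phi> ` U)"
  using assms is_chart_inj unfolding coord_def is_chart_def by blast+

lemma coord_compat:
  assumes "coord M U \<Phi>" "(V, \<phi>) \<in> charts M" "i < mdim M"
  shows "Cinf_on (mdim M) (\<phi> ` (V \<inter> U)) (\<lambda>x. \<Phi> (inv_into V \<phi> x) i)"
    "Cinf_on (mdim M) (\<Phi> ` (V \<inter> U)) (\<lambda>x. \<phi> (inv_into U \<Phi> x) i)"
  using assms unfolding coord_def by blast+

lemma coord_inv: "coord M U \<Phi> \<Longrightarrow> p \<in> U \<Longrightarrow> inv_into U \<Phi> (\<Phi> p) = p"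
  by (rule inv_into_f_f[OF coordD(3)])

lemma coord_zero: "coord M U \<Phi> \<Longrightarrow> p \<in> U \<Longrightarrow> i \<ge> mdim M \<Longrightarrow> \<Phi> p i = 0"
  by (rule eopen_subset[OF coordD(4) imageI])

lemma coord_image_open: "coord M U \<Phi> \<Longrightarrow> openin (mtop M) A \<Longrightarrow> A \<subseteq> U \<Longrightarrow> eopen (mdim M) (\<Phi> ` A)"
  by (rule is_chart_image_open[OF coordD(1)])

lemma coord_vimage_open: "coord M U \<Phi> \<Longrightarrow> eopen (mdim M) W \<Longrightarrow> openin (mtop M) {p \<in> U. \<Phi> p \<in> W}"
  by (rule is_chart_vimage_open[OF coordD(1)])

lemma chart_is_chart: "smooth_atlas M \<Longrightarrow> (V, \<phi>) \<in> charts M \<Longrightarrow> is_chart (mtop M) (mdim M) V \<phi>"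
  unfolding smooth_atlas_def by blast

lemma chart_coord: "smooth_atlas M \<Longrightarrow> (V, \<phi>) \<in> charts M \<Longrightarrow> coord M V \<phi>"
  unfolding coord_def
proof (intro conjI allI impI)
  fix W \<psi> i assume *: "smooth_atlas M" "(V, \<phi>) \<in> charts M" "(W, \<psi>) \<in> charts M" "i < mdim M"
  show "Cinf_on (mdim M) (\<psi> ` (W \<inter> V)) (\<lambda>x. \<phi> (inv_into W \<psi> x) i)"
    using * unfolding smooth_atlas_def by blast
  have "W \<inter> V = V \<inter> W" by blast
  then show "Cinf_on (mdim M) (\<phi> ` (W \<inter> V)) (\<lambda>x. \<psi> (inv_into V \<phi> x) i)"
    using * unfolding smooth_atlas_def by simp
qed (use chart_is_chart in blast)

lemma ex_chart:
  assumes "smooth_atlas M" "m \<in> topspace (mtop M)"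
  obtains V \<phi> where "(V, \<phi>) \<in> charts M" "m \<in> V"
  using assms unfolding smooth_atlas_def by blast

text \<open>The inverse of a chart and the inverse of its restriction are different total functions, but agree where
  it matters.\<close>

lemma Cinf_inv_into_cong:
  assumes "eopen n (\<Phi> ` A)" "inj_on \<Phi> U" "A \<subseteq> U" "A \<subseteq> U'" "U' \<subseteq> U"
  shows "Cinf_on n (\<Phi> ` A) (\<lambda>x. g (inv_into U' \<Phi> x)) \<longleftrightarrow> Cinf_on n (\<Phi> ` A) (\<lambda>x. g (inv_into U \<Phi> x))"
proof -
  have "g (inv_into U' \<Phi> x) = g (inv_into U \<Phi> x)" if "x \<in> \<Phi> ` A" for x
  proof -
    from that obtain p where p: "p \<in> A" "x = \<Phi> p" by blast
    have "inj_on \<Phi> U'" using inj_on_subset assms(2,5) by blast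
    moreover have "p \<in> U" "p \<in> U'" using p(1) assms(3,4) by auto
    ultimately have "inv_into U' \<Phi> x = p" "inv_into U \<Phi> x = p"
      unfolding p(2) using inv_into_f_f assms(2) by metis+
    then show ?thesis by simp
  qed
  then show ?thesis
    using Cinf_cong[OF assms(1), of "\<lambda>x. g (inv_into U' \<Phi> x)" "\<lambda>x. g (inv_into U \<Phi> x)"]
      Cinf_cong[OF assms(1), of "\<lambda>x. g (inv_into U \<Phi> x)" "\<lambda>x. g (inv_into U' \<Phi> x)"] by auto
qed

lemma coord_restrict:
  assumes M: "smooth_atlas M" and "coord M U \<Phi>" "openin (mtop M) U'" "U' \<subseteq> U"
  shows "coord M U' \<Phi>"
proof -
  note c = assms(2) and U' = assms(3,4)
  have "is_chart (mtop M) (mdim M) U' \<Phi>" using is_chart_restrict[OF coordD(1)[OF c] U'] .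
  moreover have "Cinf_on (mdim M) (\<phi> ` (V \<inter> U')) (\<lambda>x. \<Phi> (inv_into V \<phi> x) i)"
    if V: "(V, \<phi>) \<in> charts M" and i: "i < mdim M" for V \<phi> i
    by (rule Cinf_subset[OF coord_compat(1)[OF c V i]]) (use U' in auto)
  moreover have "Cinf_on (mdim M) (\<Phi> ` (V \<inter> U')) (\<lambda>x. \<phi> (inv_into U' \<Phi> x) i)"
    if V: "(V, \<phi>) \<in> charts M" and i: "i < mdim M" for V \<phi> i
  proof -
    have "Cinf_on (mdim M) (\<Phi> ` (V \<inter> U')) (\<lambda>x. \<phi> (inv_into U \<Phi> x) i)"
      by (rule Cinf_subset[OF coord_compat(2)[OF c V i]]) (use U' in auto)
    moreover have "eopen (mdim M) (\<Phi> ` (V \<inter> U'))"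
      by (rule coord_image_open[OF c]) (use U' is_chart_openD[OF chart_is_chart[OF M V]] in auto)
    ultimately show ?thesis
      using Cinf_inv_into_cong[of "mdim M" \<Phi> "V \<inter> U'" U U' "\<lambda>p. \<phi> p i"] coordD(3)[OF c] U'(2) by auto
  qed
  ultimately show ?thesis unfolding coord_def by blast
qed

section \<open>Smooth functions in coordinates\<close>

lemma Cinf_chart_coord:
  assumes M: "smooth_atlas M" and C: "(C, \<phi>) \<in> charts M" and c: "coord M U \<Phi>"
    and A: "openin (mtop M) A" "A \<subseteq> C" "A \<subseteq> U"
  shows "Cinf_on (mdim M) (\<phi> ` A) (\<lambda>x. f (inv_into C \<phi> x)) \<longleftrightarrow> Cinf_on (mdim M) (\<Phi> ` A) (\<lambda>x. f (inv_into U \<Phi> x))"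
proof
  note cC = chart_coord[OF M C]
  have open1: "eopen (mdim M) (\<phi> ` A)" and open2: "eopen (mdim M) (\<Phi> ` A)"
    using coord_image_open cC c A by blast+
  {
    assume f: "Cinf_on (mdim M) (\<phi> ` A) (\<lambda>x. f (inv_into C \<phi> x))"
    have "Cinf_on (mdim M) (\<Phi> ` A) (\<lambda>x. f (inv_into C \<phi> (\<phi> (inv_into U \<Phi> x))))"
    proof (rule Cinf_compose[OF open1 open2 f])
      show "Cinf_on (mdim M) (\<Phi> ` A) (\<lambda>x. \<phi> (inv_into U \<Phi> x) j)" if "j < mdim M" for j
        by (rule Cinf_subset[OF coord_compat(2)[OF c C that]]) (use A in auto)
    qed (use A coord_inv[OF c] in auto)
    then show "Cinf_on (mdim M) (\<Phi> ` A) (\<lambda>x. f (inv_into U \<Phi> x))"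
      by (rule Cinf_cong[OF open2, rotated]) (use A coord_inv[OF c] coord_inv[OF cC] in \<open>auto simp: subset_iff\<close>)
  }
  {
    assume f: "Cinf_on (mdim M) (\<Phi> ` A) (\<lambda>x. f (inv_into U \<Phi> x))"
    have "Cinf_on (mdim M) (\<phi> ` A) (\<lambda>x. f (inv_into U \<Phi> (\<Phi> (inv_into C \<phi> x))))"
    proof (rule Cinf_compose[OF open2 open1 f])
      show "Cinf_on (mdim M) (\<phi> ` A) (\<lambda>x. \<Phi> (inv_into C \<phi> x) j)" if "j < mdim M" for j
        by (rule Cinf_subset[OF coord_compat(1)[OF c C that]]) (use A in auto)
    qed (use A coord_inv[OF cC] in auto)
    then show "Cinf_on (mdim M) (\<phi> ` A) (\<lambda>x. f (inv_into C \<phi> x))"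
      by (rule Cinf_cong[OF open1, rotated]) (use A coord_inv[OF c] coord_inv[OF cC] in \<open>auto simp: subset_iff\<close>)
  }
qed

lemma smooth_fun_onD: "smooth_fun_on M U f \<Longrightarrow> openin (mtop M) U"
  "smooth_fun_on M U f \<Longrightarrow> (C, \<phi>) \<in> charts M \<Longrightarrow> Cinf_on (mdim M) (\<phi> ` (C \<inter> U)) (\<lambda>x. f (inv_into C \<phi> x))"
  unfolding smooth_fun_on_def by auto

lemma smooth_fun_on_coord:
  assumes M: "smooth_atlas M" and f: "smooth_fun_on M U' f" and c: "coord M U \<Phi>"
  shows "Cinf_on (mdim M) (\<Phi> ` (U \<inter> U')) (\<lambda>x. f (inv_into U \<Phi> x))"
proof (rule Cinf_local)
  show "eopen (mdim M) (\<Phi> ` (U \<inter> U'))"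
    by (rule coord_image_open[OF c]) (use coordD(2)[OF c] smooth_fun_onD(1)[OF f] in auto)
  fix x assume "x \<in> \<Phi> ` (U \<inter> U')"
  then obtain p where p: "p \<in> U" "p \<in> U'" "x = \<Phi> p" by blast
  then have "p \<in> topspace (mtop M)" using openin_subset[OF smooth_fun_onD(1)[OF f]] by blast
  then obtain C \<phi> where C: "(C, \<phi>) \<in> charts M" "p \<in> C" using ex_chart[OF M] by blast
  let ?A = "C \<inter> U \<inter> U'"
  have A: "openin (mtop M) ?A"
    using is_chart_openD[OF chart_is_chart[OF M C(1)]] coordD(2)[OF c] smooth_fun_onD(1)[OF f] by auto
  have "Cinf_on (mdim M) (\<phi> ` ?A) (\<lambda>x. f (inv_into C \<phi> x))"
    by (rule Cinf_subset[OF smooth_fun_onD(2)[OF f C(1)]]) auto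
  then have "Cinf_on (mdim M) (\<Phi> ` ?A) (\<lambda>x. f (inv_into U \<Phi> x))"
    using Cinf_chart_coord[OF M C(1) c A, of f] by blast
  moreover have "eopen (mdim M) (\<Phi> ` ?A)" by (rule coord_image_open[OF c A]) auto
  ultimately show "\<exists>V. eopen (mdim M) V \<and> x \<in> V \<and> V \<subseteq> \<Phi> ` (U \<inter> U') \<and>
      Cinf_on (mdim M) V (\<lambda>x. f (inv_into U \<Phi> x))"
    using p C(2) by (intro exI[of _ "\<Phi> ` ?A"]) auto
qed

lemma smooth_fun_onI_coord:
  assumes M: "smooth_atlas M" and c: "coord M U \<Phi>" and U': "openin (mtop M) U'" "U' \<subseteq> U"
    and f: "Cinf_on (mdim M) (\<Phi> ` U') (\<lambda>x. f (inv_into U \<Phi> x))"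
  shows "smooth_fun_on M U' f"
  unfolding smooth_fun_on_def
proof (intro conjI U' ballI, unfold split_paired_all prod.case)
  fix C \<phi> assume C: "(C, \<phi>) \<in> charts M"
  have A: "openin (mtop M) (C \<inter> U')" using is_chart_openD[OF chart_is_chart[OF M C]] U' by auto
  show "Cinf_on (mdim M) (\<phi> ` (C \<inter> U')) (\<lambda>x. f (inv_into C \<phi> x))"
    by (subst Cinf_chart_coord[OF M C c A]) (use U' in \<open>auto intro: Cinf_subset[OF f]\<close>)
qed

lemma coord_component_smooth: "coord M V \<Psi> \<Longrightarrow> i < mdim M \<Longrightarrow> smooth_fun_on M V (\<lambda>p. \<Psi> p i)"
  unfolding smooth_fun_on_def using coordD(2) coord_compat(1) by auto

lemma smooth_near_coord:
  assumes M: "smooth_atlas M" and c: "coord M U \<Phi>" and m: "m \<in> U"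
  shows "smooth_near M m f \<longleftrightarrow>
    (\<exists>U'. openin (mtop M) U' \<and> m \<in> U' \<and> U' \<subseteq> U \<and> Cinf_on (mdim M) (\<Phi> ` U') (\<lambda>x. f (inv_into U \<Phi> x)))"
proof
  assume "smooth_near M m f"
  then obtain U' where U': "m \<in> U'" "smooth_fun_on M U' f" unfolding smooth_near_def by blast
  show "\<exists>U'. openin (mtop M) U' \<and> m \<in> U' \<and> U' \<subseteq> U \<and> Cinf_on (mdim M) (\<Phi> ` U') (\<lambda>x. f (inv_into U \<Phi> x))"
    by (rule exI[of _ "U \<inter> U'"])
      (use U' m smooth_fun_on_coord[OF M U'(2) c] smooth_fun_onD(1)[OF U'(2)] coordD(2)[OF c] in auto)
next
  assume "\<exists>U'. openin (mtop M) U' \<and> m \<in> U' \<and> U' \<subseteq> U \<and> Cinf_on (mdim M) (\<Phi> ` U') (\<lambda>x. f (inv_into U \<Phi> x))"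
  then show "smooth_near M m f"
    unfolding smooth_near_def using smooth_fun_onI_coord[OF M c] by blast
qed

lemma smooth_near_topspace: "smooth_near M m f \<Longrightarrow> m \<in> topspace (mtop M)"
  unfolding smooth_near_def smooth_fun_on_def using openin_subset by blast

lemma smooth_near_coord_compose:
  assumes M: "smooth_atlas M" and c: "coord M U \<Phi>" and m: "m \<in> U"
    and W: "eopen (mdim M) W" "\<Phi> m \<in> W" and g: "Cinf_on (mdim M) W g"
  shows "smooth_near M m (\<lambda>p. g (\<Phi> p))"
proof -
  let ?U' = "{p \<in> U. \<Phi> p \<in> W}"
  have "Cinf_on (mdim M) (\<Phi> ` ?U') (\<lambda>x. g (\<Phi> (inv_into U \<Phi> x)))"
  proof (rule Cinf_cong[OF coord_image_open[OF c]])
    show "Cinf_on (mdim M) (\<Phi> ` ?U') g" by (rule Cinf_subset[OF g]) auto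
  qed (use coord_inv[OF c] coord_vimage_open[OF c W(1)] in auto)
  then show ?thesis
    unfolding smooth_near_coord[OF M c m]
    using coord_vimage_open[OF c W(1)] m W(2) by (intro exI[of _ ?U']) auto
qed

lemma smooth_near_coord_component:
  assumes "coord M U \<Phi>" "m \<in> U" "i < mdim M"
  shows "smooth_near M m (\<lambda>p. \<Phi> p i)"
  unfolding smooth_near_def using coord_component_smooth[OF assms(1,3)] assms(2) by blast

lemma smooth_near_binop:
  assumes M: "smooth_atlas M"
    and op: "\<And>W u v. eopen (mdim M) W \<Longrightarrow> Cinf_on (mdim M) W u \<Longrightarrow> Cinf_on (mdim M) W v \<Longrightarrow>
       Cinf_on (mdim M) W (\<lambda>x. b (u x) (v x))"
    and f: "smooth_near M m f" and g: "smooth_near M m g"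
  shows "smooth_near M m (\<lambda>p. b (f p) (g p))"
proof -
  obtain C \<phi> where "(C, \<phi>) \<in> charts M" and m: "m \<in> C" using ex_chart[OF M smooth_near_topspace[OF f]] by blast
  then have c: "coord M C \<phi>" using chart_coord[OF M] by blast
  obtain U1 U2 where U: "openin (mtop M) U1" "m \<in> U1" "U1 \<subseteq> C" "Cinf_on (mdim M) (\<phi> ` U1) (\<lambda>x. f (inv_into C \<phi> x))"
    "openin (mtop M) U2" "m \<in> U2" "U2 \<subseteq> C" "Cinf_on (mdim M) (\<phi> ` U2) (\<lambda>x. g (inv_into C \<phi> x))"
    using f g unfolding smooth_near_coord[OF M c m] by blast
  have "eopen (mdim M) (\<phi> ` (U1 \<inter> U2))" by (rule coord_image_open[OF c]) (use U in auto)
  then have "Cinf_on (mdim M) (\<phi> ` (U1 \<inter> U2)) (\<lambda>x. b (f (inv_into C \<phi> x)) (g (inv_into C \<phi> x)))"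
    by (rule op) (auto intro: Cinf_subset[OF U(4)] Cinf_subset[OF U(8)])
  then show ?thesis unfolding smooth_near_coord[OF M c m]
    using U by (intro exI[of _ "U1 \<inter> U2"]) auto
qed

lemma smooth_near_const: "smooth_atlas M \<Longrightarrow> m \<in> topspace (mtop M) \<Longrightarrow> smooth_near M m (\<lambda>p. c)"
  unfolding smooth_near_def smooth_fun_on_def by (auto intro: Cinf_const)

lemma smooth_near_add: "smooth_atlas M \<Longrightarrow> smooth_near M m f \<Longrightarrow> smooth_near M m g \<Longrightarrow> smooth_near M m (\<lambda>p. f p + g p)"
  by (rule smooth_near_binop[where b = "(+)"]) (auto intro: Cinf_add)

lemma smooth_near_mult: "smooth_atlas M \<Longrightarrow> smooth_near M m f \<Longrightarrow> smooth_near M m g \<Longrightarrow> smooth_near M m (\<lambda>p. f p * g p)"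
  by (rule smooth_near_binop[where b = "(*)"]) (auto intro: Cinf_mult)

lemma smooth_near_cong:
  assumes M: "smooth_atlas M" and f: "smooth_near M m f"
    and U: "openin (mtop M) U" "m \<in> U" "\<And>p. p \<in> U \<Longrightarrow> f p = g p"
  shows "smooth_near M m g"
proof -
  obtain C \<phi> where "(C, \<phi>) \<in> charts M" and m: "m \<in> C" using ex_chart[OF M smooth_near_topspace[OF f]] by blast
  then have c: "coord M C \<phi>" using chart_coord[OF M] by blast
  obtain U1 where U1: "openin (mtop M) U1" "m \<in> U1" "U1 \<subseteq> C" "Cinf_on (mdim M) (\<phi> ` U1) (\<lambda>x. f (inv_into C \<phi> x))"
    using f unfolding smooth_near_coord[OF M c m] by blast
  have "Cinf_on (mdim M) (\<phi> ` (U1 \<inter> U)) (\<lambda>x. g (inv_into C \<phi> x))"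
  proof (rule Cinf_cong[OF coord_image_open[OF c]])
    show "Cinf_on (mdim M) (\<phi> ` (U1 \<inter> U)) (\<lambda>x. f (inv_into C \<phi> x))" by (rule Cinf_subset[OF U1(4)]) auto
    fix y assume "y \<in> \<phi> ` (U1 \<inter> U)"
    then show "f (inv_into C \<phi> y) = g (inv_into C \<phi> y)" using U(3) U1(3) coord_inv[OF c] by auto
  qed (use U U1 in auto)
  then show ?thesis unfolding smooth_near_coord[OF M c m]
    using U U1 by (intro exI[of _ "U1 \<inter> U"]) auto
qed

section \<open>Smooth maps in coordinates\<close>

lemma smooth_map_iff:
  "smooth_map M N f \<longleftrightarrow> continuous_map (mtop M) (mtop N) f \<and>
    (\<forall>V \<phi>. (V, \<phi>) \<in> charts M \<longrightarrow> (\<forall>W \<psi>. (W, \<psi>) \<in> charts N \<longrightarrow> (\<forall>i < mdim N.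
        Cinf_on (mdim M) (\<phi> ` (V \<inter> f -` W)) (\<lambda>x. \<psi> (f (inv_into V \<phi> x)) i))))"
  unfolding smooth_map_def by (simp add: Ball_def split_paired_All)

lemma smooth_mapD:
  assumes "smooth_map M N f"
  shows "continuous_map (mtop M) (mtop N) f"
    "(V, \<phi>) \<in> charts M \<Longrightarrow> (W, \<psi>) \<in> charts N \<Longrightarrow> i < mdim N \<Longrightarrow>
        Cinf_on (mdim M) (\<phi> ` (V \<inter> f -` W)) (\<lambda>x. \<psi> (f (inv_into V \<phi> x)) i)"
  using assms unfolding smooth_map_iff by blast+

lemma smooth_fun_on_pullback:
  assumes M: "smooth_atlas M" and N: "smooth_atlas N" and f: "smooth_map M N f" and g: "smooth_fun_on N U g"
  shows "smooth_fun_on M {p \<in> topspace (mtop M). f p \<in> U} (\<lambda>p. g (f p))"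
  unfolding smooth_fun_on_def
proof (intro conjI ballI, unfold split_paired_all prod.case)
  note fc = smooth_mapD(1)[OF f]
  let ?U' = "{p \<in> topspace (mtop M). f p \<in> U}"
  show U': "openin (mtop M) ?U'" using openin_continuous_map_preimage[OF fc smooth_fun_onD(1)[OF g]] .
  fix C \<phi> assume C: "(C, \<phi>) \<in> charts M"
  note c = chart_coord[OF M C]
  show "Cinf_on (mdim M) (\<phi> ` (C \<inter> ?U')) (\<lambda>x. g (f (inv_into C \<phi> x)))"
  proof (rule Cinf_local)
    show "eopen (mdim M) (\<phi> ` (C \<inter> ?U'))" by (rule coord_image_open[OF c]) (use U' coordD(2)[OF c] in auto)
    fix x assume "x \<in> \<phi> ` (C \<inter> ?U')"
    then obtain p where p: "p \<in> C" "p \<in> topspace (mtop M)" "f p \<in> U" "x = \<phi> p" by blast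
    then have "f p \<in> topspace (mtop N)" using openin_subset[OF smooth_fun_onD(1)[OF g]] by blast
    then obtain D \<psi> where D: "(D, \<psi>) \<in> charts N" "f p \<in> D" using ex_chart[OF N] by blast
    note d = chart_coord[OF N D(1)]
    have oD: "openin (mtop N) (D \<inter> U)" using coordD(2)[OF d] smooth_fun_onD(1)[OF g] by auto
    let ?A = "C \<inter> {p \<in> topspace (mtop M). f p \<in> D \<inter> U}"
    have A: "openin (mtop M) ?A"
      using openin_continuous_map_preimage[OF fc oD] coordD(2)[OF c] by (rule openin_Int[rotated])
    have oA: "eopen (mdim M) (\<phi> ` ?A)" by (rule coord_image_open[OF c A]) auto
    have "Cinf_on (mdim M) (\<phi> ` ?A) (\<lambda>x. g (inv_into D \<psi> (\<psi> (f (inv_into C \<phi> x)))))"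
    proof (rule Cinf_compose[OF coord_image_open[OF d oD] oA smooth_fun_onD(2)[OF g D(1)]])
      show "Cinf_on (mdim M) (\<phi> ` ?A) (\<lambda>x. \<psi> (f (inv_into C \<phi> x)) j)" if "j < mdim N" for j
        by (rule Cinf_subset[OF smooth_mapD(2)[OF f C D(1) that]]) auto
    qed (use coord_inv[OF c] in auto)
    then have "Cinf_on (mdim M) (\<phi> ` ?A) (\<lambda>x. g (f (inv_into C \<phi> x)))"
      by (rule Cinf_cong[OF oA, rotated]) (use coord_inv[OF c] coord_inv[OF d] in auto)
    then show "\<exists>V. eopen (mdim M) V \<and> x \<in> V \<and> V \<subseteq> \<phi> ` (C \<inter> ?U') \<and>
        Cinf_on (mdim M) V (\<lambda>x. g (f (inv_into C \<phi> x)))"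
      using oA p D(2) by (intro exI[of _ "\<phi> ` ?A"]) auto
  qed
qed

lemma smooth_near_pullback:
  assumes "smooth_atlas M" "smooth_atlas N" "smooth_map M N f" "m \<in> topspace (mtop M)" "smooth_near N (f m) g"
  shows "smooth_near M m (\<lambda>p. g (f p))"
proof -
  obtain U where U: "f m \<in> U" "smooth_fun_on N U g" using assms(5) unfolding smooth_near_def by blast
  show ?thesis unfolding smooth_near_def
    by (rule exI, rule conjI[OF _ smooth_fun_on_pullback[OF assms(1-3) U(2)]]) (use U(1) assms(4) in simp)
qed

text \<open>The smoothness criterion for maps whose domain is covered by one coordinate system, such as a cube. It yields
  continuity, since coordinate systems are homeomorphisms.\<close>

lemma smooth_map_coordI:
  assumes M: "smooth_atlas M" and N: "smooth_atlas N" and c: "coord M U \<Phi>" and U: "topspace (mtop M) = U"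
    and d: "coord N V \<Psi>" and fUV: "f ` U \<subseteq> V"
    and f: "\<And>i. i < mdim N \<Longrightarrow> Cinf_on (mdim M) (\<Phi> ` U) (\<lambda>x. \<Psi> (f (inv_into U \<Phi> x)) i)"
  shows "smooth_map M N f"
  unfolding smooth_map_iff
proof (intro conjI allI impI)
  let ?F = "\<lambda>x. \<Psi> (f (inv_into U \<Phi> x))"
  show fc: "continuous_map (mtop M) (mtop N) f"
    unfolding continuous_map_def
  proof (intro conjI allI impI)
    show "f \<in> topspace (mtop M) \<rightarrow> topspace (mtop N)"
      using fUV U openin_subset[OF coordD(2)[OF d]] by auto
    fix O' assume O': "openin (mtop N) O'"
    have "eopen (mdim N) (\<Psi> ` (V \<inter> O'))" by (rule coord_image_open[OF d]) (use O' coordD(2)[OF d] in auto)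
    then have "eopen (mdim M) {x \<in> \<Phi> ` U. ?F x \<in> \<Psi> ` (V \<inter> O')}"
      by (rule eopen_vimage[OF coordD(4)[OF c] Cinf_continuous[OF f], rotated 2])
        (use fUV coord_zero[OF d] coord_inv[OF c] in auto)
    then have "openin (mtop M) {p \<in> U. \<Phi> p \<in> {x \<in> \<Phi> ` U. ?F x \<in> \<Psi> ` (V \<inter> O')}}"
      by (rule coord_vimage_open[OF c])
    moreover have "{p \<in> U. \<Phi> p \<in> {x \<in> \<Phi> ` U. ?F x \<in> \<Psi> ` (V \<inter> O')}} = {p \<in> topspace (mtop M). f p \<in> O'}"
    proof -
      have "?F (\<Phi> p) \<in> \<Psi> ` (V \<inter> O') \<longleftrightarrow> f p \<in> O'" if p: "p \<in> U" for p
      proof -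
        have "f p \<in> V" using fUV p by blast
        then show ?thesis unfolding coord_inv[OF c p]
          using inj_on_image_mem_iff[OF coordD(3)[OF d], of "f p" "V \<inter> O'"] by blast
      qed
      then show ?thesis unfolding U by blast
    qed
    ultimately show "openin (mtop M) {p \<in> topspace (mtop M). f p \<in> O'}" by simp
  qed
  fix C \<phi> D \<psi> i assume C: "(C, \<phi>) \<in> charts M" and D: "(D, \<psi>) \<in> charts N" and i: "i < mdim N"
  note cC = chart_coord[OF M C] and cD = chart_coord[OF N D]
  let ?A = "C \<inter> f -` D"
  have CU: "C \<subseteq> U" using openin_subset[OF coordD(2)[OF cC]] U by simp
  have "?A = C \<inter> {p \<in> topspace (mtop M). f p \<in> D}" using CU U by auto
  then have A: "openin (mtop M) ?A"
    using openin_continuous_map_preimage[OF fc coordD(2)[OF cD]] coordD(2)[OF cC] by auto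
  have oA: "eopen (mdim M) (\<Phi> ` ?A)" by (rule coord_image_open[OF c A]) (use CU in auto)
  have "eopen (mdim N) (\<Psi> ` (D \<inter> V))" by (rule coord_image_open[OF d]) (use coordD(2)[OF d] coordD(2)[OF cD] in auto)
  then have "Cinf_on (mdim M) (\<Phi> ` ?A) (\<lambda>x. \<psi> (inv_into V \<Psi> (?F x)) i)"
  proof (rule Cinf_compose[OF _ oA coord_compat(2)[OF d D i]])
    show "Cinf_on (mdim M) (\<Phi> ` ?A) (\<lambda>x. ?F x j)" if "j < mdim N" for j
      by (rule Cinf_subset[OF f[OF that]]) (use CU in auto)
  qed (use CU fUV coord_inv[OF c] in \<open>auto simp: subset_iff\<close>)
  then have "Cinf_on (mdim M) (\<Phi> ` ?A) (\<lambda>x. \<psi> (f (inv_into U \<Phi> x)) i)"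
    by (rule Cinf_cong[OF oA, rotated]) (use CU fUV coord_inv[OF c] coord_inv[OF d] in \<open>auto simp: subset_iff image_subset_iff\<close>)
  then show "Cinf_on (mdim M) (\<phi> ` ?A) (\<lambda>x. \<psi> (f (inv_into C \<phi> x)) i)"
    using Cinf_chart_coord[OF M C c A, of "\<lambda>p. \<psi> (f p) i"] CU by auto
qed

section \<open>Open submanifolds\<close>

lemma submanifold_simps [simp]:
  "mtop (submanifold M U) = subtopology (mtop M) U" "mdim (submanifold M U) = mdim M"
  by (simp_all add: submanifold_def)

lemma charts_submanifold: "(V, \<phi>) \<in> charts (submanifold M U) \<longleftrightarrow> (\<exists>V'. (V', \<phi>) \<in> charts M \<and> V = V' \<inter> U)"
proof
  assume "(V, \<phi>) \<in> charts (submanifold M U)"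
  then show "\<exists>V'. (V', \<phi>) \<in> charts M \<and> V = V' \<inter> U" by (auto simp: submanifold_def)
next
  assume "\<exists>V'. (V', \<phi>) \<in> charts M \<and> V = V' \<inter> U"
  then obtain V' where "(V', \<phi>) \<in> charts M" "V = V' \<inter> U" by blast
  then show "(V, \<phi>) \<in> charts (submanifold M U)"
    by (auto simp: submanifold_def intro!: image_eqI[of _ _ "(V', \<phi>)"])
qed

lemma is_chart_subtopology:
  assumes "is_chart X n A \<phi>" "openin X U" "A \<subseteq> U"
  shows "is_chart (subtopology X U) n A \<phi>"
proof -
  have "subtopology (subtopology X U) A = subtopology X A"
    using assms(3) by (simp add: subtopology_subtopology Int_absorb1)
  moreover have "openin (subtopology X U) A"
    using assms is_chart_openD by (simp add: openin_open_subtopology)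
  ultimately show ?thesis using assms(1) unfolding is_chart_def by simp
qed

lemma coord_submanifold:
  assumes M: "smooth_atlas M" and U: "openin (mtop M) U" and c: "coord M A \<Phi>" and A: "A \<subseteq> U"
  shows "coord (submanifold M U) A \<Phi>"
  unfolding coord_def submanifold_simps
proof (intro conjI allI impI is_chart_subtopology[OF coordD(1)[OF c] U A])
  fix V \<phi> i assume "(V, \<phi>) \<in> charts (submanifold M U)" and i: "i < mdim M"
  then obtain V' where V': "(V', \<phi>) \<in> charts M" "V = V' \<inter> U" unfolding charts_submanifold by blast
  note cV = chart_coord[OF M V'(1)]
  have eq: "V \<inter> A = V' \<inter> A" using V'(2) A by blast
  show "Cinf_on (mdim M) (\<Phi> ` (V \<inter> A)) (\<lambda>x. \<phi> (inv_into A \<Phi> x) i)"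
    unfolding eq using coord_compat(2)[OF c V'(1) i] .
  have "openin (mtop M) (V' \<inter> A)" using coordD(2)[OF c] coordD(2)[OF cV] by auto
  from coord_image_open[OF cV this] have o: "eopen (mdim M) (\<phi> ` (V' \<inter> A))" by simp
  have "Cinf_on (mdim M) (\<phi> ` (V' \<inter> A)) (\<lambda>x. \<Phi> (inv_into V \<phi> x) i)"
    using coord_compat(1)[OF c V'(1) i]
      Cinf_inv_into_cong[OF o coordD(3)[OF cV], of V "\<lambda>p. \<Phi> p i"] V'(2) A by blast
  then show "Cinf_on (mdim M) (\<phi> ` (V \<inter> A)) (\<lambda>x. \<Phi> (inv_into V \<phi> x) i)" unfolding eq .
qed

lemma smooth_atlas_coordI:
  assumes "\<And>m. m \<in> topspace (mtop M) \<longleftrightarrow> (\<exists>V \<phi>. (V, \<phi>) \<in> charts M \<and> m \<in> V)"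
    and "\<And>V \<phi>. (V, \<phi>) \<in> charts M \<Longrightarrow> coord M V \<phi>"
  shows "smooth_atlas M"
  unfolding smooth_atlas_def
proof (intro conjI allI impI assms(1))
  fix V \<phi> assume V: "(V, \<phi>) \<in> charts M"
  show "is_chart (mtop M) (mdim M) V \<phi>" using assms(2)[OF V] coordD(1) by blast
  fix W \<psi> i assume W: "(W, \<psi>) \<in> charts M" and i: "i < mdim M"
  show "Cinf_on (mdim M) (\<phi> ` (V \<inter> W)) (\<lambda>x. \<psi> (inv_into V \<phi> x) i)"
    using coord_compat(1)[OF assms(2)[OF W] V i] .
qed

lemma smooth_atlas_submanifold:
  assumes M: "smooth_atlas M" and U: "openin (mtop M) U"
  shows "smooth_atlas (submanifold M U)"
proof (rule smooth_atlas_coordI)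
  fix m show "m \<in> topspace (mtop (submanifold M U)) \<longleftrightarrow> (\<exists>V \<phi>. (V, \<phi>) \<in> charts (submanifold M U) \<and> m \<in> V)"
    using M unfolding charts_submanifold smooth_atlas_def by (auto simp: topspace_subtopology)
next
  fix V \<phi> assume "(V, \<phi>) \<in> charts (submanifold M U)"
  then obtain V' where V': "(V', \<phi>) \<in> charts M" "V = V' \<inter> U" unfolding charts_submanifold by blast
  note cV = chart_coord[OF M V'(1)]
  have "coord M V \<phi>" by (rule coord_restrict[OF M cV]) (use V'(2) U coordD(2)[OF cV] in auto)
  then show "coord (submanifold M U) V \<phi>" by (rule coord_submanifold[OF M U]) (use V'(2) in auto)
qed

lemma smooth_manifold_submanifold:
  assumes M: "smooth_manifold M" and U: "openin (mtop M) U"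
  shows "smooth_manifold (submanifold M U)"
  using assms smooth_atlas_submanifold[OF _ U]
  by (simp add: smooth_manifold_iff_atlas Hausdorff_space_subtopology second_countable_subtopology)

lemma smooth_fun_on_submanifold:
  assumes M: "smooth_atlas M" and U: "openin (mtop M) U" and U': "U' \<subseteq> U"
  shows "smooth_fun_on (submanifold M U) U' f \<longleftrightarrow> smooth_fun_on M U' f"
proof -
  have op: "openin (mtop (submanifold M U)) U' \<longleftrightarrow> openin (mtop M) U'"
    using openin_open_subtopology[OF U] U' by simp
  have key: "Cinf_on (mdim M) (\<phi> ` (V \<inter> U \<inter> U')) (\<lambda>x. f (inv_into (V \<inter> U) \<phi> x)) \<longleftrightarrow>
      Cinf_on (mdim M) (\<phi> ` (V \<inter> U')) (\<lambda>x. f (inv_into V \<phi> x))"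
    if V: "(V, \<phi>) \<in> charts M" and oU': "openin (mtop M) U'" for V \<phi>
  proof -
    note cV = chart_coord[OF M V]
    have eq: "V \<inter> U \<inter> U' = V \<inter> U'" using U' by blast
    have "eopen (mdim M) (\<phi> ` (V \<inter> U'))" by (rule coord_image_open[OF cV]) (use oU' coordD(2)[OF cV] in auto)
    then show ?thesis unfolding eq
      by (rule Cinf_inv_into_cong[OF _ coordD(3)[OF cV]]) (use U' in auto)
  qed
  show ?thesis
    unfolding smooth_fun_on_def op using key by (auto simp: charts_submanifold submanifold_def)
qed

lemma smooth_fun_on_subset:
  assumes "smooth_fun_on M U f" "openin (mtop M) U'" "U' \<subseteq> U"
  shows "smooth_fun_on M U' f"
  unfolding smooth_fun_on_def
proof (intro conjI ballI assms(2), unfold split_paired_all prod.case)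
  fix C \<phi> assume "(C, \<phi>) \<in> charts M"
  from smooth_fun_onD(2)[OF assms(1) this]
  show "Cinf_on (mdim M) (\<phi> ` (C \<inter> U')) (\<lambda>x. f (inv_into C \<phi> x))"
    by (rule Cinf_subset) (use assms(3) in auto)
qed

lemma smooth_near_submanifold:
  assumes M: "smooth_atlas M" and U: "openin (mtop M) U" and m: "m \<in> U"
  shows "smooth_near (submanifold M U) m f \<longleftrightarrow> smooth_near M m f"
proof
  assume "smooth_near (submanifold M U) m f"
  then obtain U' where U': "m \<in> U'" "smooth_fun_on (submanifold M U) U' f" unfolding smooth_near_def by blast
  have "U' \<subseteq> U" using openin_subset[OF smooth_fun_onD(1)[OF U'(2)]] by (simp add: topspace_subtopology)
  then show "smooth_near M m f"
    using U' smooth_fun_on_submanifold[OF M U] unfolding smooth_near_def by blast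
next
  assume "smooth_near M m f"
  then obtain U' where U': "m \<in> U'" "smooth_fun_on M U' f" unfolding smooth_near_def by blast
  have "smooth_fun_on M (U \<inter> U') f"
    by (rule smooth_fun_on_subset[OF U'(2)]) (use U smooth_fun_onD(1)[OF U'(2)] in auto)
  then have "smooth_fun_on (submanifold M U) (U \<inter> U') f"
    using smooth_fun_on_submanifold[OF M U, of "U \<inter> U'" f] by simp
  then show "smooth_near (submanifold M U) m f" unfolding smooth_near_def using m U'(1) by blast
qed

section \<open>Changing coordinates\<close>

lemma subtopology_Euclidean_space: "eopen n W \<Longrightarrow> subtopology (Euclidean_space n) W = top_of_set W"
proof -
  assume "eopen n W"
  then have "{x. \<forall>i\<ge>n. x i = 0} \<inter> W = W" using eopen_subset[of n W] by blast
  then show ?thesis unfolding Euclidean_space_def euclidean_product_topology subtopology_subtopology by simp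
qed

lemma continuous_map_Cinf:
  assumes "eopen n W" "\<And>i. i < k \<Longrightarrow> continuous_on W (\<lambda>x. F x i)" "\<And>x i. x \<in> W \<Longrightarrow> i \<ge> k \<Longrightarrow> F x i = 0"
  shows "continuous_map (subtopology (Euclidean_space n) W) (Euclidean_space k) F"
  by (rule continuous_map_into_Euclidean_space)
    (use assms in \<open>auto simp: subtopology_Euclidean_space\<close>)

lemma ediffD:
  assumes "ediff n W \<theta>"
  shows "eopen n W" "eopen n (\<theta> ` W)" "inj_on \<theta> W" "\<And>i. i < n \<Longrightarrow> Cinf_on n W (\<lambda>x. \<theta> x i)"
    "\<And>i. i < n \<Longrightarrow> Cinf_on n (\<theta> ` W) (\<lambda>y. inv_into W \<theta> y i)"
  using assms unfolding ediff_def by blast+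

lemma is_chart_ediff:
  assumes "ediff n W \<theta>"
  shows "is_chart (Euclidean_space n) n W \<theta>"
proof (rule is_chartI[where g = "inv_into W \<theta>"])
  note e = ediffD[OF assms]
  show "continuous_map (subtopology (Euclidean_space n) W) (Euclidean_space n) \<theta>"
    by (rule continuous_map_Cinf[OF e(1) Cinf_continuous[OF e(4)]]) (use eopen_subset[OF e(2)] in auto)
  show "continuous_map (subtopology (Euclidean_space n) (\<theta> ` W)) (Euclidean_space n) (inv_into W \<theta>)"
    by (rule continuous_map_Cinf[OF e(2) Cinf_continuous[OF e(5)]])
      (use eopen_subset[OF e(1)] inv_into_into in metis)+
  show "inv_into W \<theta> (\<theta> p) = p" if "p \<in> W" for p using inv_into_f_f[OF e(3) that] .
qed (use ediffD[OF assms] in auto)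

lemma is_chart_compose:
  assumes "is_chart X n A \<Phi>" "is_chart (Euclidean_space n) n (\<Phi> ` A) \<theta>"
  shows "is_chart X n A (\<lambda>p. \<theta> (\<Phi> p))"
proof -
  have "homeomorphic_map (subtopology X A) (subtopology (Euclidean_space n) (\<theta> ` \<Phi> ` A)) (\<theta> \<circ> \<Phi>)"
    by (rule homeomorphic_map_compose) (use assms in \<open>auto simp: is_chart_def\<close>)
  then show ?thesis using assms unfolding is_chart_def by (simp add: image_image o_def)
qed

lemma coord_ediff:
  assumes M: "smooth_atlas M" and c: "coord M U \<Phi>" and W: "W \<subseteq> \<Phi> ` U" and d: "ediff (mdim M) W \<theta>"
  shows "coord M {p \<in> U. \<Phi> p \<in> W} (\<lambda>p. \<theta> (\<Phi> p))"
proof -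
  let ?A = "{p \<in> U. \<Phi> p \<in> W}" and ?n = "mdim M" and ?\<Psi> = "\<lambda>p. \<theta> (\<Phi> p)"
  note e = ediffD[OF d]
  have A: "openin (mtop M) ?A" by (rule coord_vimage_open[OF c e(1)])
  have img: "\<Phi> ` ?A = W" using W by auto
  have cA: "is_chart (mtop M) ?n ?A \<Phi>" by (rule is_chart_restrict[OF coordD(1)[OF c] A]) auto
  have chart: "is_chart (mtop M) ?n ?A ?\<Psi>"
    by (rule is_chart_compose[OF cA]) (use is_chart_ediff[OF d] img in simp)
  moreover have "Cinf_on ?n (\<phi> ` (V \<inter> ?A)) (\<lambda>x. ?\<Psi> (inv_into V \<phi> x) i)"
    if V: "(V, \<phi>) \<in> charts M" and i: "i < ?n" for V \<phi> i
  proof (rule Cinf_compose[where f = "\<lambda>x. \<theta> x i" and g = "\<lambda>x. \<Phi> (inv_into V \<phi> x)", OF e(1) _ e(4)[OF i]])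
    note cV = chart_coord[OF M V]
    show "eopen ?n (\<phi> ` (V \<inter> ?A))" by (rule coord_image_open[OF cV]) (use A coordD(2)[OF cV] in auto)
    show "Cinf_on ?n (\<phi> ` (V \<inter> ?A)) (\<lambda>x. \<Phi> (inv_into V \<phi> x) j)" if "j < ?n" for j
      by (rule Cinf_subset[OF coord_compat(1)[OF c V that]]) auto
    show "(\<lambda>x. \<Phi> (inv_into V \<phi> x)) ` \<phi> ` (V \<inter> ?A) \<subseteq> W" using coord_inv[OF cV] by auto
  qed
  moreover have "Cinf_on ?n (?\<Psi> ` (V \<inter> ?A)) (\<lambda>x. \<phi> (inv_into ?A ?\<Psi> x) i)"
    if V: "(V, \<phi>) \<in> charts M" and i: "i < ?n" for V \<phi> i
  proof -
    note cV = chart_coord[OF M V]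
    have VA: "openin (mtop M) (V \<inter> ?A)" using A coordD(2)[OF cV] by auto
    have o1: "eopen ?n (\<Phi> ` (V \<inter> ?A))" by (rule coord_image_open[OF c VA]) auto
    have o2: "eopen ?n (?\<Psi> ` (V \<inter> ?A))" by (rule is_chart_image_open[OF chart VA]) auto
    have inv\<theta>: "inv_into W \<theta> (\<theta> (\<Phi> p)) = \<Phi> p" if "p \<in> ?A" for p
      using inv_into_f_f[OF e(3)] that by auto
    have invA: "inv_into ?A ?\<Psi> (?\<Psi> p) = p" if "p \<in> ?A" for p
      using inv_into_f_f[OF is_chart_inj[OF chart] that] .
    have "Cinf_on ?n (\<Phi> ` (V \<inter> ?A)) (\<lambda>x. \<phi> (inv_into U \<Phi> x) i)"
      by (rule Cinf_subset[OF coord_compat(2)[OF c V i]]) auto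
    then have "Cinf_on ?n (?\<Psi> ` (V \<inter> ?A)) (\<lambda>x. \<phi> (inv_into U \<Phi> (inv_into W \<theta> x)) i)"
    proof (rule Cinf_compose[where f = "\<lambda>x. \<phi> (inv_into U \<Phi> x) i" and g = "inv_into W \<theta>", OF o1 o2])
      show "Cinf_on ?n (?\<Psi> ` (V \<inter> ?A)) (\<lambda>x. inv_into W \<theta> x j)" if "j < ?n" for j
        by (rule Cinf_subset[OF e(5)[OF that]]) auto
      show "inv_into W \<theta> ` ?\<Psi> ` (V \<inter> ?A) \<subseteq> \<Phi> ` (V \<inter> ?A)" using inv\<theta> by auto
    qed
    moreover have "\<phi> (inv_into U \<Phi> (inv_into W \<theta> y)) i = \<phi> (inv_into ?A ?\<Psi> y) i" if y: "y \<in> ?\<Psi> ` (V \<inter> ?A)" for y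
    proof -
      obtain p where p: "y = ?\<Psi> p" "p \<in> V \<inter> ?A" using y by (rule imageE)
      have "p \<in> ?A" using p(2) by blast
      then show ?thesis unfolding p(1) invA[OF \<open>p \<in> ?A\<close>] inv\<theta>[OF \<open>p \<in> ?A\<close>] using coord_inv[OF c, of p] by simp
    qed
    ultimately show ?thesis
      by (rule Cinf_cong[where f = "\<lambda>y. \<phi> (inv_into U \<Phi> (inv_into W \<theta> y)) i"
            and g = "\<lambda>y. \<phi> (inv_into ?A ?\<Psi> y) i", OF o2, rotated])
  qed
  ultimately show ?thesis unfolding coord_def by blast
qed

text \<open>Coordinates can be shrunk to have a cube as their image. In a cube every value of the first coordinates can
  be combined with every value of the others.\<close>

lemma coord_cube:
  assumes M: "smooth_atlas M" and c: "coord M U \<Phi>" and O': "openin (mtop M) O'" "m \<in> O'" "O' \<subseteq> U"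
  obtains e U' where "e > 0" "openin (mtop M) U'" "m \<in> U'" "U' \<subseteq> O'" "coord M U' \<Phi>" "\<Phi> ` U' = cube (mdim M) (\<Phi> m) e"
proof -
  obtain e where e: "e > 0" "cube (mdim M) (\<Phi> m) e \<subseteq> \<Phi> ` O'"
    using eopen_cube_subset[OF coord_image_open[OF c O'(1,3)]] O'(2) by blast
  let ?U' = "{p \<in> U. \<Phi> p \<in> cube (mdim M) (\<Phi> m) e}"
  have U': "openin (mtop M) ?U'" by (rule coord_vimage_open[OF c eopen_cube])
  have "m \<in> ?U'" using center_in_cube[of "mdim M" "\<Phi> m" e] coord_zero[OF c] e(1) O' by auto
  moreover have "?U' \<subseteq> O'"
  proof
    fix p assume p: "p \<in> ?U'"
    then obtain q where "q \<in> O'" "\<Phi> q = \<Phi> p" using e(2) by (auto simp: image_iff subset_iff)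
    then show "p \<in> O'" using coordD(3)[OF c] p O'(3) by (metis (no_types, lifting) inj_on_eq_iff mem_Collect_eq subsetD)
  qed
  moreover have "\<Phi> ` ?U' = cube (mdim M) (\<Phi> m) e" using e(2) O'(3) by auto
  moreover have "coord M ?U' \<Phi>" by (rule coord_restrict[OF M c U']) auto
  ultimately show ?thesis using that e(1) U' by blast
qed

section \<open>Open subsets of Euclidean space as manifolds\<close>

definition eucl_manifold :: "nat \<Rightarrow> (nat \<Rightarrow> real) set \<Rightarrow> (nat \<Rightarrow> real) manifold" where
  "eucl_manifold n W = \<lparr>mtop = subtopology (Euclidean_space n) W, mdim = n, charts = {(W, \<lambda>x. x)}\<rparr>"

lemma eucl_manifold_simps [simp]:
  "mtop (eucl_manifold n W) = subtopology (Euclidean_space n) W" "mdim (eucl_manifold n W) = n"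
  "charts (eucl_manifold n W) = {(W, \<lambda>x. x)}"
  by (simp_all add: eucl_manifold_def)

lemma topspace_eucl_manifold: "eopen n W \<Longrightarrow> topspace (mtop (eucl_manifold n W)) = W"
  using openin_subset[of "Euclidean_space n" W] by (auto simp: topspace_subtopology)

lemma second_countable_Euclidean_space: "second_countable (Euclidean_space n)"
proof -
  have "second_countable (euclidean :: (nat \<Rightarrow> real) topology)"
  proof -
    obtain B :: "(nat \<Rightarrow> real) set set" where B: "countable B" "topological_basis B"
      using ex_countable_basis by blast
    then show ?thesis unfolding second_countable_def
      by (intro exI[of _ B]) (auto simp: topological_basis_def open_openin[symmetric] intro: topological_basisE[OF B(2)])
  qed
  then show ?thesis unfolding Euclidean_space_def euclidean_product_topology by (rule second_countable_subtopology)
qed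

lemma coord_eucl_manifold:
  assumes W: "eopen n W"
  shows "coord (eucl_manifold n W) W (\<lambda>x. x)"
  unfolding coord_def eucl_manifold_simps
proof (intro conjI allI impI)
  show "is_chart (subtopology (Euclidean_space n) W) n W (\<lambda>x. x)"
    unfolding is_chart_def using W homeomorphic_map_id[of "subtopology (Euclidean_space n) W"]
    by (simp add: openin_open_subtopology subtopology_subtopology id_def)
  fix V \<phi> i assume "(V, \<phi>) \<in> {(W, \<lambda>x::nat \<Rightarrow> real. x)}"
  then have *: "V = W" "\<phi> = (\<lambda>x. x)" by auto
  have "inv_into W (\<lambda>x. x) x = x" if "x \<in> W" for x using that by (metis f_inv_into_f image_ident)
  then have "Cinf_on n W (\<lambda>x. inv_into W (\<lambda>x. x) x i)"
    using Cinf_cong[OF W _ Cinf_proj[OF W, of i], of "\<lambda>x. inv_into W (\<lambda>x. x) x i"] by simp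
  then show "Cinf_on n (\<phi> ` (V \<inter> W)) (\<lambda>x. inv_into V \<phi> x i)" "Cinf_on n ((\<lambda>x. x) ` (V \<inter> W)) (\<lambda>x. \<phi> (inv_into W (\<lambda>x. x) x) i)"
    unfolding * by simp_all
qed

lemma smooth_manifold_eucl_manifold:
  assumes W: "eopen n W"
  shows "smooth_manifold (eucl_manifold n W)"
proof -
  have "smooth_atlas (eucl_manifold n W)"
  proof (rule smooth_atlas_coordI)
    show "m \<in> topspace (mtop (eucl_manifold n W)) \<longleftrightarrow> (\<exists>V \<phi>. (V, \<phi>) \<in> charts (eucl_manifold n W) \<and> m \<in> V)" for m
      unfolding topspace_eucl_manifold[OF W] by simp
  qed (use coord_eucl_manifold[OF W] in auto)
  then show ?thesis
    unfolding smooth_manifold_iff_atlas eucl_manifold_simps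
    using second_countable_subtopology[OF second_countable_Euclidean_space]
      Hausdorff_space_subtopology[OF Hausdorff_Euclidean_space] by blast
qed

section \<open>Products\<close>

definition join :: "nat \<Rightarrow> (nat \<Rightarrow> real) \<Rightarrow> (nat \<Rightarrow> real) \<Rightarrow> nat \<Rightarrow> real" where
  "join a x y = (\<lambda>i. if i < a then x i else y (i - a))"

definition head :: "nat \<Rightarrow> (nat \<Rightarrow> real) \<Rightarrow> nat \<Rightarrow> real" where
  "head a z = (\<lambda>i. if i < a then z i else 0)"

definition tail :: "nat \<Rightarrow> (nat \<Rightarrow> real) \<Rightarrow> nat \<Rightarrow> real" where
  "tail a z = (\<lambda>i. z (i + a))"

lemma head_join: "(\<And>i. i \<ge> a \<Longrightarrow> x i = 0) \<Longrightarrow> head a (join a x y) = x"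
  and tail_join: "tail a (join a x y) = y"
  and join_head_tail: "join a (head a z) (tail a z) = z"
  by (auto simp: head_def tail_def join_def fun_eq_iff)

lemma continuous_on_head: "continuous_on S (\<lambda>z. head a z i)"
  and continuous_on_tail: "continuous_on S (\<lambda>z. tail a z i)"
  unfolding head_def tail_def by (cases "i < a"; simp add: continuous_on_coordinate)+

lemma is_chart_inv_continuous:
  assumes "is_chart X n V \<phi>"
  shows "continuous_map (subtopology (Euclidean_space n) (\<phi> ` V)) X (inv_into V \<phi>)"
proof -
  note c = is_chart_homeo[OF assms]
  obtain g where g: "homeomorphic_maps (subtopology X V) (subtopology (Euclidean_space n) (\<phi> ` V)) \<phi> g"
    using c(1) homeomorphic_map_maps by blast
  then have "continuous_map (subtopology (Euclidean_space n) (\<phi> ` V)) (subtopology X V) g"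
    unfolding homeomorphic_maps_def by blast
  then have "continuous_map (subtopology (Euclidean_space n) (\<phi> ` V)) X g"
    unfolding continuous_map_in_subtopology by blast
  moreover have "g y = inv_into V \<phi> y" if y: "y \<in> topspace (subtopology (Euclidean_space n) (\<phi> ` V))" for y
  proof -
    obtain p where p: "p \<in> V" "y = \<phi> p" using y unfolding c(3) by blast
    have "g (\<phi> p) = p" using g p(1) c(2) unfolding homeomorphic_maps_def by blast
    then show ?thesis using inv_into_f_f[OF is_chart_inj[OF assms] p(1)] p(2) by simp
  qed
  ultimately show ?thesis by (rule continuous_map_eq)
qed

definition join_chart :: "nat \<Rightarrow> ('a \<Rightarrow> nat \<Rightarrow> real) \<Rightarrow> ('b \<Rightarrow> nat \<Rightarrow> real) \<Rightarrow> 'a \<times> 'b \<Rightarrow> nat \<Rightarrow> real" where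
  "join_chart a \<phi> \<psi> = (\<lambda>z. join a (\<phi> (fst z)) (\<psi> (snd z)))"

lemma is_chart_zero: "is_chart X n V \<phi> \<Longrightarrow> p \<in> V \<Longrightarrow> i \<ge> n \<Longrightarrow> \<phi> p i = 0"
  using eopen_subset[of n "\<phi> ` V" "\<phi> p" i] by (simp add: is_chart_def)

lemma is_chart_prod:
  assumes V: "is_chart X a V \<phi>" and W: "is_chart Y b W \<psi>"
  shows "is_chart (prod_topology X Y) (a + b) (V \<times> W) (join_chart a \<phi> \<psi>)"
proof -
  let ?g = "\<lambda>z. (inv_into V \<phi> (head a z), inv_into W \<psi> (tail a z))"
  let ?E = "topspace (Euclidean_space (a + b))"
  let ?Z = "{z \<in> {z \<in> ?E. head a z \<in> \<phi> ` V}. tail a z \<in> \<psi> ` W}"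
  have z0: "z i = 0" if "z \<in> ?E" "i \<ge> a + b" for z i
    using that by (simp add: topspace_Euclidean_space)
  have o1: "eopen a (\<phi> ` V)" and o2: "eopen b (\<psi> ` W)" using V W by (auto simp: is_chart_def)
  have Z1: "eopen (a + b) {z \<in> ?E. head a z \<in> \<phi> ` V}"
    by (rule eopen_vimage[OF openin_topspace continuous_on_head _ o1]) (simp add: head_def)
  have Z: "eopen (a + b) ?Z"
    by (rule eopen_vimage[OF Z1 continuous_on_tail _ o2]) (use z0 in \<open>auto simp: tail_def\<close>)
  have ht: "head a (join_chart a \<phi> \<psi> p) = \<phi> (fst p)" "tail a (join_chart a \<phi> \<psi> p) = \<psi> (snd p)"
    if "p \<in> V \<times> W" for p
    using that is_chart_zero[OF V, of "fst p"] by (auto simp: join_chart_def head_join tail_join mem_Times_iff)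
  have img: "join_chart a \<phi> \<psi> ` (V \<times> W) = ?Z"
  proof (intro equalityI subsetI)
    fix z assume "z \<in> join_chart a \<phi> \<psi> ` (V \<times> W)"
    then obtain p where p: "p \<in> V \<times> W" "z = join_chart a \<phi> \<psi> p" by blast
    have "z \<in> ?E" using p is_chart_zero[OF W, of "snd p"]
      by (auto simp: topspace_Euclidean_space join_chart_def join_def)
    then show "z \<in> ?Z" using p ht[OF p(1)] by auto
  next
    fix z assume z: "z \<in> ?Z"
    then obtain x y where xy: "x \<in> V" "head a z = \<phi> x" "y \<in> W" "tail a z = \<psi> y" by blast
    then have "z = join_chart a \<phi> \<psi> (x, y)" using join_head_tail[of a z] by (simp add: join_chart_def)
    then show "z \<in> join_chart a \<phi> \<psi> ` (V \<times> W)" using xy by blast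
  qed
  show ?thesis
  proof (rule is_chartI[where W = ?Z and g = ?g])
    show "openin (prod_topology X Y) (V \<times> W)"
      using is_chart_openD[OF V] is_chart_openD[OF W] by (simp add: openin_prod_Times_iff)
    show "?g (join_chart a \<phi> \<psi> p) = p" if "p \<in> V \<times> W" for p
      unfolding ht[OF that] using that inv_into_f_f[OF is_chart_inj[OF V]] inv_into_f_f[OF is_chart_inj[OF W]]
      by (auto simp: mem_Times_iff)
    have sub: "subtopology (prod_topology X Y) (V \<times> W) = prod_topology (subtopology X V) (subtopology Y W)"
      by (simp add: subtopology_Times)
    have c1: "continuous_map (subtopology X V) euclideanreal (\<lambda>x. \<phi> x i)"
      if "is_chart X n V \<phi>" for X :: "'z topology" and n V \<phi> i
    proof -
      have "continuous_map (subtopology X V) (Euclidean_space n) \<phi>"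
        using homeomorphic_imp_continuous_map[OF is_chart_homeo(1)[OF that]]
        unfolding continuous_map_in_subtopology by blast
      then have "continuous_map (subtopology X V) euclidean \<phi>"
        unfolding Euclidean_space_def continuous_map_in_subtopology euclidean_product_topology by blast
      from continuous_map_compose[OF this, of euclidean "\<lambda>x. x i"] show ?thesis
        using continuous_on_coordinate[of UNIV i] by (simp add: o_def)
    qed
    show "continuous_map (subtopology (prod_topology X Y) (V \<times> W)) (Euclidean_space (a + b)) (join_chart a \<phi> \<psi>)"
    proof (rule continuous_map_into_Euclidean_space)
      fix p i assume "p \<in> topspace (subtopology (prod_topology X Y) (V \<times> W))" "i \<ge> a + b"
      then show "join_chart a \<phi> \<psi> p i = 0" using is_chart_zero[OF W, of "snd p" "i - a"]
        by (auto simp: join_chart_def join_def)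
    next
      fix i
      have "continuous_map (prod_topology (subtopology X V) (subtopology Y W)) euclideanreal (\<lambda>p. \<phi> (fst p) i)"
        using continuous_map_compose[OF continuous_map_fst c1[OF V], of "subtopology Y W" i] by (simp add: o_def)
      moreover have "continuous_map (prod_topology (subtopology X V) (subtopology Y W)) euclideanreal (\<lambda>p. \<psi> (snd p) (i - a))"
        using continuous_map_compose[OF continuous_map_snd c1[OF W], of "subtopology X V" "i - a"] by (simp add: o_def)
      ultimately show "continuous_map (subtopology (prod_topology X Y) (V \<times> W)) euclideanreal (\<lambda>p. join_chart a \<phi> \<psi> p i)"
        unfolding sub join_chart_def join_def by (cases "i < a") auto
    qed
    have "continuous_map (subtopology (Euclidean_space (a + b)) ?Z) (subtopology (Euclidean_space a) (\<phi> ` V)) (head a)"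
      unfolding continuous_map_in_subtopology
    proof (intro conjI)
      show "continuous_map (subtopology (Euclidean_space (a + b)) ?Z) (Euclidean_space a) (head a)"
        by (rule continuous_map_Cinf[OF Z continuous_on_head]) (simp add: head_def)
    qed (auto simp: topspace_subtopology)
    from continuous_map_compose[OF this is_chart_inv_continuous[OF V]]
    have h: "continuous_map (subtopology (Euclidean_space (a + b)) ?Z) X (\<lambda>z. inv_into V \<phi> (head a z))"
      by (simp add: o_def)
    have "continuous_map (subtopology (Euclidean_space (a + b)) ?Z) (subtopology (Euclidean_space b) (\<psi> ` W)) (tail a)"
      unfolding continuous_map_in_subtopology
    proof (intro conjI)
      show "continuous_map (subtopology (Euclidean_space (a + b)) ?Z) (Euclidean_space b) (tail a)"
        by (rule continuous_map_Cinf[OF Z continuous_on_tail]) (use z0 in \<open>auto simp: tail_def\<close>)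
    qed (auto simp: topspace_subtopology)
    from continuous_map_compose[OF this is_chart_inv_continuous[OF W]]
    have t: "continuous_map (subtopology (Euclidean_space (a + b)) ?Z) Y (\<lambda>z. inv_into W \<psi> (tail a z))"
      by (simp add: o_def)
    show "continuous_map (subtopology (Euclidean_space (a + b)) ?Z) (prod_topology X Y) ?g"
      using h t by (simp add: continuous_map_pairwise o_def)
  qed (use Z img in auto)
qed

lemma charts_prod_manifold:
  "(Z, \<xi>) \<in> charts (prod_manifold M N) \<longleftrightarrow>
     (\<exists>V \<phi> W \<psi>. (V, \<phi>) \<in> charts M \<and> (W, \<psi>) \<in> charts N \<and> Z = V \<times> W \<and> \<xi> = join_chart (mdim M) \<phi> \<psi>)"
proof -
  have eq: "(\<lambda>(x, y) i. if i < mdim M then \<phi> x i else \<psi> y (i - mdim M)) = join_chart (mdim M) \<phi> \<psi>"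
    for \<phi> :: "'a \<Rightarrow> nat \<Rightarrow> real" and \<psi> :: "'b \<Rightarrow> nat \<Rightarrow> real"
    by (auto simp: join_chart_def join_def fun_eq_iff)
  have "charts (prod_manifold M N) =
     (\<lambda>((V, \<phi>), (W, \<psi>)). (V \<times> W, join_chart (mdim M) \<phi> \<psi>)) ` (charts M \<times> charts N)"
    unfolding prod_manifold_def manifold.simps eq ..
  then show ?thesis by (simp add: image_iff Bex_def split_paired_Ex)
qed

lemma prod_manifold_simps [simp]:
  "mtop (prod_manifold M N) = prod_topology (mtop M) (mtop N)" "mdim (prod_manifold M N) = mdim M + mdim N"
  by (simp_all add: prod_manifold_def)

text \<open>Both directions of the compatibility of product charts are instances, with charts of the atlas as
  \<open>\<Phi>\<close>, \<open>\<Psi>\<close> and coordinate systems as \<open>\<Phi>'\<close>, \<open>\<Psi>'\<close> or conversely.\<close>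

lemma prod_transition:
  assumes U: "is_chart X a U \<Phi>" and V: "is_chart Y b V \<Psi>"
    and A: "openin X A" "A \<subseteq> U" and B: "openin Y B" "B \<subseteq> V"
    and f: "\<And>i. i < a \<Longrightarrow> Cinf_on a (\<Phi> ` A) (\<lambda>x. \<Phi>' (inv_into U \<Phi> x) i)"
    and g: "\<And>i. i < b \<Longrightarrow> Cinf_on b (\<Psi> ` B) (\<lambda>x. \<Psi>' (inv_into V \<Psi> x) i)" and i: "i < a + b"
  shows "Cinf_on (a + b) (join_chart a \<Phi> \<Psi> ` (A \<times> B))
    (\<lambda>z. join_chart a \<Phi>' \<Psi>' (inv_into (U \<times> V) (join_chart a \<Phi> \<Psi>) z) i)"
proof -
  let ?J = "join_chart a \<Phi> \<Psi>"
  note c = is_chart_prod[OF U V]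
  have AB: "openin (prod_topology X Y) (A \<times> B)" using A B by (simp add: openin_prod_Times_iff)
  have oZ: "eopen (a + b) (?J ` (A \<times> B))" by (rule is_chart_image_open[OF c AB]) (use A B in auto)
  have oA: "eopen a (\<Phi> ` A)" and oB: "eopen b (\<Psi> ` B)"
    using is_chart_image_open U V A B by blast+
  have inv: "inv_into (U \<times> V) ?J (?J p) = p" if "p \<in> A \<times> B" for p
    by (rule inv_into_f_f[OF is_chart_inj[OF c]]) (use that A B in auto)
  have ht: "head a (?J p) = \<Phi> (fst p)" "tail a (?J p) = \<Psi> (snd p)" if "p \<in> A \<times> B" for p
    using that is_chart_zero[OF U, of "fst p"] A by (auto simp: join_chart_def head_join tail_join mem_Times_iff)
  show ?thesis
  proof (cases "i < a")
    case True
    have "Cinf_on (a + b) (?J ` (A \<times> B)) (\<lambda>z. \<Phi>' (inv_into U \<Phi> (head a z)) i)"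
    proof (rule Cinf_compose[where f = "\<lambda>x. \<Phi>' (inv_into U \<Phi> x) i" and g = "head a", OF oA oZ f[OF True]])
      show "Cinf_on (a + b) (?J ` (A \<times> B)) (\<lambda>z. head a z j)" if "j < a" for j
        using that Cinf_proj[OF oZ, of j] by (simp add: head_def)
      show "head a ` ?J ` (A \<times> B) \<subseteq> \<Phi> ` A" using ht by auto
    qed
    moreover have "\<Phi>' (inv_into U \<Phi> (head a z)) i = join_chart a \<Phi>' \<Psi>' (inv_into (U \<times> V) ?J z) i"
      if "z \<in> ?J ` (A \<times> B)" for z
    proof -
      obtain p where p: "z = ?J p" "p \<in> A \<times> B" using \<open>z \<in> ?J ` (A \<times> B)\<close> by (rule imageE)
      have "inv_into U \<Phi> (\<Phi> (fst p)) = fst p"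
        by (rule inv_into_f_f[OF is_chart_inj[OF U]]) (use p(2) A in auto)
      then show ?thesis unfolding p(1) inv[OF p(2)] ht[OF p(2)] using True by (simp add: join_chart_def join_def)
    qed
    ultimately show ?thesis
      by (rule Cinf_cong[where f = "\<lambda>z. \<Phi>' (inv_into U \<Phi> (head a z)) i" and
            g = "\<lambda>z. join_chart a \<Phi>' \<Psi>' (inv_into (U \<times> V) ?J z) i", OF oZ, rotated])
  next
    case False
    then have ib: "i - a < b" using i by simp
    have "Cinf_on (a + b) (?J ` (A \<times> B)) (\<lambda>z. \<Psi>' (inv_into V \<Psi> (tail a z)) (i - a))"
    proof (rule Cinf_compose[where f = "\<lambda>x. \<Psi>' (inv_into V \<Psi> x) (i - a)" and g = "tail a", OF oB oZ g[OF ib]])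
      show "Cinf_on (a + b) (?J ` (A \<times> B)) (\<lambda>z. tail a z j)" for j
        using Cinf_proj[OF oZ, of "j + a"] by (simp add: tail_def)
      show "tail a ` ?J ` (A \<times> B) \<subseteq> \<Psi> ` B" using ht by auto
    qed
    moreover have "\<Psi>' (inv_into V \<Psi> (tail a z)) (i - a) = join_chart a \<Phi>' \<Psi>' (inv_into (U \<times> V) ?J z) i"
      if "z \<in> ?J ` (A \<times> B)" for z
    proof -
      obtain p where p: "z = ?J p" "p \<in> A \<times> B" using \<open>z \<in> ?J ` (A \<times> B)\<close> by (rule imageE)
      have "inv_into V \<Psi> (\<Psi> (snd p)) = snd p"
        by (rule inv_into_f_f[OF is_chart_inj[OF V]]) (use p(2) B in auto)
      then show ?thesis unfolding p(1) inv[OF p(2)] ht[OF p(2)] using False by (simp add: join_chart_def join_def)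
    qed
    ultimately show ?thesis
      by (rule Cinf_cong[where f = "\<lambda>z. \<Psi>' (inv_into V \<Psi> (tail a z)) (i - a)" and
            g = "\<lambda>z. join_chart a \<Phi>' \<Psi>' (inv_into (U \<times> V) ?J z) i", OF oZ, rotated])
  qed
qed

lemma coord_prod:
  assumes M: "smooth_atlas M" and N: "smooth_atlas N" and c: "coord M U \<Phi>" and d: "coord N V \<Psi>"
  shows "coord (prod_manifold M N) (U \<times> V) (join_chart (mdim M) \<Phi> \<Psi>)"
  unfolding coord_def prod_manifold_simps
proof (intro conjI allI impI is_chart_prod[OF coordD(1)[OF c] coordD(1)[OF d]])
  fix Z \<xi> i assume Z: "(Z, \<xi>) \<in> charts (prod_manifold M N)" and i: "i < mdim M + mdim N"
  obtain V' \<phi> W' \<psi> where C: "(V', \<phi>) \<in> charts M" and D: "(W', \<psi>) \<in> charts N"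
    and eq: "Z = V' \<times> W'" "\<xi> = join_chart (mdim M) \<phi> \<psi>"
    using Z unfolding charts_prod_manifold by blast
  note cC = chart_coord[OF M C] and cD = chart_coord[OF N D]
  have A: "openin (mtop M) (V' \<inter> U)" and B: "openin (mtop N) (W' \<inter> V)"
    using coordD(2) c d cC cD by auto
  have int: "Z \<inter> U \<times> V = (V' \<inter> U) \<times> (W' \<inter> V)" unfolding eq by blast
  show "Cinf_on (mdim M + mdim N) (\<xi> ` (Z \<inter> U \<times> V)) (\<lambda>x. join_chart (mdim M) \<Phi> \<Psi> (inv_into Z \<xi> x) i)"
    unfolding int unfolding eq
    by (rule prod_transition[OF coordD(1)[OF cC] coordD(1)[OF cD] A _ B _ coord_compat(1)[OF c C] coord_compat(1)[OF d D] i]) auto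
  show "Cinf_on (mdim M + mdim N) (join_chart (mdim M) \<Phi> \<Psi> ` (Z \<inter> U \<times> V))
      (\<lambda>x. \<xi> (inv_into (U \<times> V) (join_chart (mdim M) \<Phi> \<Psi>) x) i)"
    unfolding int unfolding eq
    by (rule prod_transition[OF coordD(1)[OF c] coordD(1)[OF d] A _ B _ coord_compat(2)[OF c C] coord_compat(2)[OF d D] i]) auto
qed

lemma smooth_atlas_prod:
  assumes M: "smooth_atlas M" and N: "smooth_atlas N"
  shows "smooth_atlas (prod_manifold M N)"
proof (rule smooth_atlas_coordI)
  fix z
  have "z \<in> topspace (mtop (prod_manifold M N)) \<longleftrightarrow> fst z \<in> topspace (mtop M) \<and> snd z \<in> topspace (mtop N)"
    by (simp add: mem_Times_iff)
  also have "\<dots> \<longleftrightarrow> (\<exists>V \<phi>. (V, \<phi>) \<in> charts M \<and> fst z \<in> V) \<and> (\<exists>W \<psi>. (W, \<psi>) \<in> charts N \<and> snd z \<in> W)"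
    using M N unfolding smooth_atlas_def by simp
  also have "\<dots> \<longleftrightarrow> (\<exists>V \<phi>. (V, \<phi>) \<in> charts (prod_manifold M N) \<and> z \<in> V)"
  proof
    assume "(\<exists>V \<phi>. (V, \<phi>) \<in> charts M \<and> fst z \<in> V) \<and> (\<exists>W \<psi>. (W, \<psi>) \<in> charts N \<and> snd z \<in> W)"
    then obtain V \<phi> W \<psi> where "(V, \<phi>) \<in> charts M" "fst z \<in> V" "(W, \<psi>) \<in> charts N" "snd z \<in> W" by blast
    then have "(V \<times> W, join_chart (mdim M) \<phi> \<psi>) \<in> charts (prod_manifold M N)" "z \<in> V \<times> W"
      unfolding charts_prod_manifold mem_Times_iff by blast+
    then show "\<exists>V \<phi>. (V, \<phi>) \<in> charts (prod_manifold M N) \<and> z \<in> V" by blast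
  next
    assume "\<exists>V \<phi>. (V, \<phi>) \<in> charts (prod_manifold M N) \<and> z \<in> V"
    then show "(\<exists>V \<phi>. (V, \<phi>) \<in> charts M \<and> fst z \<in> V) \<and> (\<exists>W \<psi>. (W, \<psi>) \<in> charts N \<and> snd z \<in> W)"
      unfolding charts_prod_manifold by (auto simp: mem_Times_iff)
  qed
  finally show "z \<in> topspace (mtop (prod_manifold M N)) \<longleftrightarrow> (\<exists>V \<phi>. (V, \<phi>) \<in> charts (prod_manifold M N) \<and> z \<in> V)" .
next
  fix Z \<xi> assume "(Z, \<xi>) \<in> charts (prod_manifold M N)"
  then show "coord (prod_manifold M N) Z \<xi>"
    unfolding charts_prod_manifold using coord_prod[OF M N chart_coord[OF M] chart_coord[OF N]] by blast
qed

section \<open>Transport of coordinates along a diffeomorphism\<close>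

text \<open>The coordinates on the target are \<open>\<Psi> \<circ> g\<close>, so both compatibility conditions are pullbacks of smooth
  functions, of the components of \<open>\<Psi>\<close> along g and of the components of an atlas chart along f.\<close>

lemma coord_transport:
  assumes P: "smooth_atlas P" and M: "smooth_atlas M" and W: "openin (mtop P) W" and V: "openin (mtop M) V"
    and f: "smooth_map (submanifold P W) (submanifold M V) f"
    and g: "smooth_map (submanifold M V) (submanifold P W) g"
    and gf: "\<And>x. x \<in> W \<Longrightarrow> g (f x) = x" and fg: "\<And>y. y \<in> V \<Longrightarrow> f (g y) = y"
    and c: "coord P A \<Psi>" and A: "A \<subseteq> W" and dim: "mdim P = mdim M"
  shows "coord M (f ` A) (\<lambda>q. \<Psi> (g q))"
proof -
  let ?B = "f ` A" and ?\<Phi> = "\<lambda>q. \<Psi> (g q)"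
  have WP: "topspace (subtopology (mtop P) W) = W" and VM: "topspace (subtopology (mtop M) V) = V"
    using openin_subset[OF W] openin_subset[OF V] by (auto simp: topspace_subtopology)
  have fc: "continuous_map (subtopology (mtop P) W) (subtopology (mtop M) V) f"
    and gc: "continuous_map (subtopology (mtop M) V) (subtopology (mtop P) W) g"
    using smooth_mapD(1)[OF f] smooth_mapD(1)[OF g] by simp_all
  have fW: "f x \<in> V" if "x \<in> W" for x
    using fc that WP VM unfolding continuous_map_def by (auto simp: Pi_iff)
  have gV: "g y \<in> W" if "y \<in> V" for y
    using gc that WP VM unfolding continuous_map_def by (auto simp: Pi_iff)
  have B_eq: "?B = {q \<in> V. g q \<in> A}"
  proof (intro equalityI subsetI)
    fix q assume "q \<in> ?B"
    then show "q \<in> {q \<in> V. g q \<in> A}" using A fW gf by auto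
  next
    fix q assume q: "q \<in> {q \<in> V. g q \<in> A}"
    then have "q = f (g q)" using fg by simp
    then show "q \<in> ?B" using q by blast
  qed
  have oA: "openin (mtop P) A" using coordD(2)[OF c] .
  have "openin (subtopology (mtop P) W) A" using oA A openin_open_subtopology[OF W] by blast
  from openin_continuous_map_preimage[OF gc this]
  have B: "openin (mtop M) ?B" unfolding VM B_eq using openin_open_subtopology[OF V] by blast
  have BV: "?B \<subseteq> V" using B_eq by blast
  have img: "?\<Phi> ` ?B = \<Psi> ` A" using A gf by (force simp: image_iff)
  have invB: "inv_into A \<Psi> (?\<Phi> q) = g q" if "q \<in> ?B" for q
    using coord_inv[OF c, of "g q"] that B_eq by blast
  have chart: "is_chart (mtop M) (mdim M) ?B ?\<Phi>"
  proof (rule is_chartI[where W = "\<Psi> ` A" and g = "\<lambda>x. f (inv_into A \<Psi> x)", OF B _ img])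
    show "eopen (mdim M) (\<Psi> ` A)" using coordD(4)[OF c] dim by simp
    show "f (inv_into A \<Psi> (?\<Phi> p)) = p" if "p \<in> ?B" for p
      unfolding invB[OF that] using that B_eq fg by blast
    have "continuous_map (subtopology (mtop M) ?B) (subtopology (mtop P) A) g"
      unfolding continuous_map_in_subtopology
    proof
      have "continuous_map (subtopology (mtop M) V) (mtop P) g"
        using gc unfolding continuous_map_in_subtopology by blast
      then show "continuous_map (subtopology (mtop M) ?B) (mtop P) g"
        using continuous_map_from_subtopology_mono[OF _ BV] by blast
      show "g \<in> topspace (subtopology (mtop M) ?B) \<rightarrow> A" using B_eq by (auto simp: topspace_subtopology)
    qed
    moreover have "continuous_map (subtopology (mtop P) A) (Euclidean_space (mdim M)) \<Psi>"
      using homeomorphic_imp_continuous_map[OF is_chart_homeo(1)[OF coordD(1)[OF c]]]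
      unfolding continuous_map_in_subtopology dim by blast
    ultimately show "continuous_map (subtopology (mtop M) ?B) (Euclidean_space (mdim M)) ?\<Phi>"
      using continuous_map_compose[of _ _ g _ \<Psi>] by (simp add: o_def)
    have "continuous_map (subtopology (Euclidean_space (mdim M)) (\<Psi> ` A)) (subtopology (mtop P) W) (inv_into A \<Psi>)"
      unfolding continuous_map_in_subtopology
      using is_chart_inv_continuous[OF coordD(1)[OF c]] dim A inv_into_into[of _ \<Psi> A]
      by (auto simp: topspace_subtopology)
    moreover have "continuous_map (subtopology (mtop P) W) (mtop M) f"
      using fc unfolding continuous_map_in_subtopology by blast
    ultimately show "continuous_map (subtopology (Euclidean_space (mdim M)) (\<Psi> ` A)) (mtop M) (\<lambda>x. f (inv_into A \<Psi> x))"
      using continuous_map_compose[of _ _ "inv_into A \<Psi>" _ f] by (simp add: o_def)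
  qed
  note PW = smooth_atlas_submanifold[OF P W] and MV = smooth_atlas_submanifold[OF M V]
  show ?thesis
    unfolding coord_def
  proof (intro conjI allI impI chart)
    fix C \<phi> i assume C: "(C, \<phi>) \<in> charts M" and i: "i < mdim M"
    note cC = chart_coord[OF M C]
    have "smooth_fun_on (submanifold P W) A (\<lambda>p. \<Psi> p i)"
      using coord_component_smooth[OF coord_submanifold[OF P W c A]] i dim by simp
    from smooth_fun_on_pullback[OF MV PW g this]
    have "smooth_fun_on (submanifold M V) ?B (\<lambda>q. \<Psi> (g q) i)"
      unfolding B_eq by (simp only: submanifold_simps VM)
    then have "smooth_fun_on M ?B (\<lambda>q. \<Psi> (g q) i)"
      using smooth_fun_on_submanifold[OF M V BV] by blast
    from smooth_fun_onD(2)[OF this C]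
    show "Cinf_on (mdim M) (\<phi> ` (C \<inter> ?B)) (\<lambda>x. \<Psi> (g (inv_into C \<phi> x)) i)" .
    have oCV: "openin (mtop M) (C \<inter> V)" using coordD(2)[OF cC] V by auto
    have "smooth_fun_on M (C \<inter> V) (\<lambda>q. \<phi> q i)"
      by (rule smooth_fun_on_subset[OF coord_component_smooth[OF cC i] oCV]) auto
    then have "smooth_fun_on (submanifold M V) (C \<inter> V) (\<lambda>q. \<phi> q i)"
      using smooth_fun_on_submanifold[OF M V, of "C \<inter> V"] by simp
    from smooth_fun_on_pullback[OF PW MV f this]
    have "smooth_fun_on (submanifold P W) {p \<in> W. f p \<in> C \<inter> V} (\<lambda>p. \<phi> (f p) i)"
      by (simp only: submanifold_simps WP)
    then have "smooth_fun_on P {p \<in> W. f p \<in> C \<inter> V} (\<lambda>p. \<phi> (f p) i)"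
      using smooth_fun_on_submanifold[OF P W, of "{p \<in> W. f p \<in> C \<inter> V}"] by blast
    from smooth_fun_on_coord[OF P this c]
    have *: "Cinf_on (mdim M) (\<Psi> ` (A \<inter> {p \<in> W. f p \<in> C \<inter> V})) (\<lambda>x. \<phi> (f (inv_into A \<Psi> x)) i)"
      unfolding dim .
    have img2: "?\<Phi> ` (C \<inter> ?B) = \<Psi> ` (A \<inter> {p \<in> W. f p \<in> C \<inter> V})"
    proof (intro equalityI subsetI)
      fix x assume "x \<in> ?\<Phi> ` (C \<inter> ?B)"
      then obtain q where q: "x = ?\<Phi> q" "q \<in> C" "q \<in> V" "g q \<in> A" using B_eq by blast
      then have "g q \<in> A \<inter> {p \<in> W. f p \<in> C \<inter> V}" using fg gV by simp
      then show "x \<in> \<Psi> ` (A \<inter> {p \<in> W. f p \<in> C \<inter> V})" using q(1) by blast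
    next
      fix x assume "x \<in> \<Psi> ` (A \<inter> {p \<in> W. f p \<in> C \<inter> V})"
      then obtain p where p: "x = \<Psi> p" "p \<in> A" "p \<in> W" "f p \<in> C" by blast
      then have "x = ?\<Phi> (f p)" "f p \<in> C \<inter> ?B" using gf by auto
      then show "x \<in> ?\<Phi> ` (C \<inter> ?B)" by blast
    qed
    have o: "eopen (mdim M) (?\<Phi> ` (C \<inter> ?B))"
      by (rule is_chart_image_open[OF chart]) (use coordD(2)[OF cC] B in auto)
    have "\<phi> (f (inv_into A \<Psi> x)) i = \<phi> (inv_into ?B ?\<Phi> x) i" if x: "x \<in> ?\<Phi> ` (C \<inter> ?B)" for x
    proof -
      obtain q where q: "x = ?\<Phi> q" "q \<in> C \<inter> ?B" using x by (rule imageE)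
      have qB: "q \<in> ?B" using q(2) by blast
      have "f (g q) = q" using qB B_eq fg by blast
      then show ?thesis unfolding q(1) invB[OF qB] inv_into_f_f[OF is_chart_inj[OF chart] qB] by simp
    qed
    from Cinf_cong[where f = "\<lambda>x. \<phi> (f (inv_into A \<Psi> x)) i" and g = "\<lambda>x. \<phi> (inv_into ?B ?\<Phi> x) i", OF o this *[folded img2]]
    show "Cinf_on (mdim M) (?\<Phi> ` (C \<inter> ?B)) (\<lambda>x. \<phi> (inv_into ?B ?\<Phi> x) i)" .
  qed
qed

section \<open>Tangent vectors in coordinates\<close>

definition coord_partial :: "'a set \<Rightarrow> ('a \<Rightarrow> nat \<Rightarrow> real) \<Rightarrow> nat \<Rightarrow> ('a \<Rightarrow> real) \<Rightarrow> 'a \<Rightarrow> real" where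
  "coord_partial U \<Phi> i f m = partial_deriv i (\<lambda>x. f (inv_into U \<Phi> x)) (\<Phi> m)"

text \<open>As a derivation, a tangent vector has to vanish on the functions that are not smooth near m.\<close>

definition coord_vector :: "'a manifold \<Rightarrow> 'a set \<Rightarrow> ('a \<Rightarrow> nat \<Rightarrow> real) \<Rightarrow> 'a \<Rightarrow> (nat \<Rightarrow> real) \<Rightarrow> 'a tangent" where
  "coord_vector M U \<Phi> m c =
     (\<lambda>f. if smooth_near M m f then \<Sum>i<mdim M. c i * coord_partial U \<Phi> i f m else 0)"

lemma tangentD:
  assumes "v \<in> tangent_space M m"
  shows "\<not> smooth_near M m f \<Longrightarrow> v f = 0"
    "smooth_near M m f \<Longrightarrow> smooth_near M m g \<Longrightarrow> v (\<lambda>x. f x + g x) = v f + v g"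
    "smooth_near M m f \<Longrightarrow> smooth_near M m g \<Longrightarrow> v (\<lambda>x. f x * g x) = v f * g m + f m * v g"
    "smooth_near M m f \<Longrightarrow> v (\<lambda>x. c * f x) = c * v f"
  using assms unfolding tangent_space_def by blast+

lemma tangent_const:
  assumes v: "v \<in> tangent_space M m" and M: "smooth_atlas M"
  shows "v (\<lambda>x. c) = 0"
proof (cases "m \<in> topspace (mtop M)")
  case True
  note s = smooth_near_const[OF M True]
  have "v (\<lambda>x. 1 * 1) = v (\<lambda>x. 1) * 1 + 1 * v (\<lambda>x. 1)" by (rule tangentD(3)[OF v s s])
  then have "v (\<lambda>x. 1) = 0" by simp
  moreover have "v (\<lambda>x. c * 1) = c * v (\<lambda>x. 1)" by (rule tangentD(4)[OF v s])
  ultimately show ?thesis by simp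
next
  case False
  then have "\<not> smooth_near M m (\<lambda>x. c)" using smooth_near_topspace[of M m] by auto
  then show ?thesis by (rule tangentD(1)[OF v])
qed

text \<open>The reason why derivations are local: the indicator \<open>\<rho>\<close> of the complement of U is smooth near m,
  because it vanishes there, and \<open>f - g = \<rho> * (f - g)\<close> is a product of two functions that vanish at m.\<close>

lemma tangent_cong:
  assumes v: "v \<in> tangent_space M m" and M: "smooth_atlas M" and f: "smooth_near M m f"
    and U: "openin (mtop M) U" "m \<in> U" "\<And>p. p \<in> U \<Longrightarrow> f p = g p"
  shows "v f = v g"
proof -
  have m: "m \<in> topspace (mtop M)" using smooth_near_topspace[OF f] .
  have g: "smooth_near M m g" by (rule smooth_near_cong[OF M f U])
  define h where "h = (\<lambda>x. f x + (-1) * g x)"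
  define \<rho> where "\<rho> = (\<lambda>x. if x \<in> U then 0 else 1 :: real)"
  have g': "smooth_near M m (\<lambda>x. (-1) * g x)" by (rule smooth_near_mult[OF M smooth_near_const[OF M m] g])
  have h: "smooth_near M m h" unfolding h_def by (rule smooth_near_add[OF M f g'])
  have \<rho>: "smooth_near M m \<rho>"
    by (rule smooth_near_cong[OF M smooth_near_const[OF M m, of 0] U(1,2)]) (simp add: \<rho>_def)
  have "(\<lambda>x. \<rho> x * h x) = h" using U(3) by (auto simp: \<rho>_def h_def fun_eq_iff)
  then have "v h = v \<rho> * h m + \<rho> m * v h" using tangentD(3)[OF v \<rho> h] by simp
  moreover have "h m = 0" "\<rho> m = 0" using U by (auto simp: h_def \<rho>_def)
  ultimately have "v h = 0" by simp
  moreover have "v h = v f + (-1) * v g"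
    unfolding h_def using tangentD(2)[OF v f g'] tangentD(4)[OF v g, of "-1"] by simp
  ultimately show ?thesis by simp
qed

lemma tangent_sum:
  assumes v: "v \<in> tangent_space M m" and M: "smooth_atlas M" and m: "m \<in> topspace (mtop M)"
    and f: "\<And>i. i < (k::nat) \<Longrightarrow> smooth_near M m (f i)"
  shows "v (\<lambda>x. \<Sum>i<k. f i x) = (\<Sum>i<k. v (f i)) \<and> smooth_near M m (\<lambda>x. \<Sum>i<k. f i x)"
  using f
proof (induction k)
  case 0
  then show ?case using tangent_const[OF v M, of 0] smooth_near_const[OF M m, of 0] by simp
next
  case (Suc k)
  then show ?case
    using tangentD(2)[OF v, of "\<lambda>x. \<Sum>i<k. f i x" "f k"] smooth_near_add[OF M, of m "\<lambda>x. \<Sum>i<k. f i x" "f k"] by simp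
qed

text \<open>Apply v to the expansion of f by Hadamard's lemma. As \<open>\<Phi> p i - \<Phi> m i\<close> vanishes at m, the product rule
  leaves only \<open>g i (\<Phi> m)\<close>, a partial derivative of f, as the factor of \<open>v (\<lambda>p. \<Phi> p i)\<close>.\<close>

lemma tangent_expand:
  assumes v: "v \<in> tangent_space M m" and M: "smooth_atlas M" and c: "coord M U \<Phi>" and m: "m \<in> U"
    and f: "smooth_near M m f"
  shows "v f = (\<Sum>i<mdim M. v (\<lambda>p. \<Phi> p i) * coord_partial U \<Phi> i f m)"
proof -
  let ?n = "mdim M" and ?F = "\<lambda>x. f (inv_into U \<Phi> x)"
  have mt: "m \<in> topspace (mtop M)" using smooth_near_topspace[OF f] .
  obtain U' where U': "openin (mtop M) U'" "m \<in> U'" "U' \<subseteq> U" "Cinf_on ?n (\<Phi> ` U') ?F"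
    using f unfolding smooth_near_coord[OF M c m] by blast
  have "\<Phi> m \<in> \<Phi> ` U'" using U'(2) by blast
  obtain e g where e: "e > 0" "cube ?n (\<Phi> m) e \<subseteq> \<Phi> ` U'"
    and g: "\<And>i. i < ?n \<Longrightarrow> Cinf_on ?n (cube ?n (\<Phi> m) e) (g i)"
      "\<And>i. i < ?n \<Longrightarrow> g i (\<Phi> m) = partial_deriv i ?F (\<Phi> m)"
      "\<And>x. x \<in> cube ?n (\<Phi> m) e \<Longrightarrow> ?F x = ?F (\<Phi> m) + (\<Sum>i<?n. (x i - \<Phi> m i) * g i x)"
    by (rule Hadamard[OF coord_image_open[OF c U'(1,3)] U'(4) \<open>\<Phi> m \<in> \<Phi> ` U'\<close>]) (rule that)
  let ?D = "{p \<in> U. \<Phi> p \<in> cube ?n (\<Phi> m) e}"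
  have mQ: "\<Phi> m \<in> cube ?n (\<Phi> m) e" by (rule center_in_cube[OF coord_zero[OF c m] e(1)])
  have D: "openin (mtop M) ?D" "m \<in> ?D" using coord_vimage_open[OF c eopen_cube] m mQ by auto
  have s1: "smooth_near M m (\<lambda>p. \<Phi> p i + (- \<Phi> m i))" if "i < ?n" for i
    by (rule smooth_near_add[OF M smooth_near_coord_component[OF c m that] smooth_near_const[OF M mt]])
  have s2: "smooth_near M m (\<lambda>p. g i (\<Phi> p))" if "i < ?n" for i
    by (rule smooth_near_coord_compose[OF M c m eopen_cube mQ g(1)[OF that]])
  have s3: "smooth_near M m (\<lambda>p. (\<Phi> p i + (- \<Phi> m i)) * g i (\<Phi> p))" if "i < ?n" for i
    by (rule smooth_near_mult[OF M s1[OF that] s2[OF that]])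
  let ?S = "\<lambda>p. \<Sum>i<?n. (\<Phi> p i + (- \<Phi> m i)) * g i (\<Phi> p)"
  have S: "v ?S = (\<Sum>i<?n. v (\<lambda>p. (\<Phi> p i + (- \<Phi> m i)) * g i (\<Phi> p)))" "smooth_near M m ?S"
    using tangent_sum[OF v M mt, of ?n "\<lambda>i p. (\<Phi> p i + (- \<Phi> m i)) * g i (\<Phi> p)"] s3 by blast+
  have "v f = v (\<lambda>p. f m + ?S p)"
  proof (rule tangent_cong[OF v M f D])
    fix p assume p: "p \<in> ?D"
    then have "?F (\<Phi> p) = ?F (\<Phi> m) + (\<Sum>i<?n. (\<Phi> p i - \<Phi> m i) * g i (\<Phi> p))" using g(3) by blast
    then show "f p = f m + ?S p" using p coord_inv[OF c] m by simp
  qed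
  also have "\<dots> = v (\<lambda>p. f m) + v ?S" by (rule tangentD(2)[OF v smooth_near_const[OF M mt] S(2)])
  also have "\<dots> = (\<Sum>i<?n. v (\<lambda>p. (\<Phi> p i + (- \<Phi> m i)) * g i (\<Phi> p)))"
    unfolding tangent_const[OF v M] S(1) by simp
  also have "\<dots> = (\<Sum>i<?n. v (\<lambda>p. \<Phi> p i) * coord_partial U \<Phi> i f m)"
  proof (rule sum.cong[OF refl])
    fix i assume "i \<in> {..<?n}"
    then have i: "i < ?n" by simp
    have "v (\<lambda>p. (\<Phi> p i + (- \<Phi> m i)) * g i (\<Phi> p)) = v (\<lambda>p. \<Phi> p i + (- \<Phi> m i)) * g i (\<Phi> m)"
      using tangentD(3)[OF v s1[OF i] s2[OF i]] by simp
    also have "v (\<lambda>p. \<Phi> p i + (- \<Phi> m i)) = v (\<lambda>p. \<Phi> p i)"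
      using tangentD(2)[OF v smooth_near_coord_component[OF c m i] smooth_near_const[OF M mt, of "- \<Phi> m i"]]
        tangent_const[OF v M, of "- \<Phi> m i"] by simp
    finally show "v (\<lambda>p. (\<Phi> p i + (- \<Phi> m i)) * g i (\<Phi> p)) = v (\<lambda>p. \<Phi> p i) * coord_partial U \<Phi> i f m"
      using g(2)[OF i] by (simp add: coord_partial_def)
  qed
  finally show ?thesis .
qed

lemma tangent_eqI:
  assumes v: "v \<in> tangent_space M m" and w: "w \<in> tangent_space M m" and M: "smooth_atlas M" and c: "coord M U \<Phi>" and m: "m \<in> U"
    and eq: "\<And>i. i < mdim M \<Longrightarrow> v (\<lambda>p. \<Phi> p i) = w (\<lambda>p. \<Phi> p i)"
  shows "v = w"
proof
  fix f show "v f = w f"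
  proof (cases "smooth_near M m f")
    case True
    show ?thesis unfolding tangent_expand[OF v M c m True] tangent_expand[OF w M c m True]
      by (rule sum.cong) (use eq in auto)
  qed (use tangentD(1)[OF v] tangentD(1)[OF w] in simp)
qed

lemma common_coord_nbhd:
  assumes M: "smooth_atlas M" and c: "coord M U \<Phi>" and m: "m \<in> U" and f: "smooth_near M m f" and g: "smooth_near M m g"
  obtains W where "eopen (mdim M) W" "\<Phi> m \<in> W" "W \<subseteq> \<Phi> ` U"
    "Cinf_on (mdim M) W (\<lambda>x. f (inv_into U \<Phi> x))" "Cinf_on (mdim M) W (\<lambda>x. g (inv_into U \<Phi> x))"
proof -
  obtain U1 U2 where U: "openin (mtop M) U1" "m \<in> U1" "U1 \<subseteq> U" "Cinf_on (mdim M) (\<Phi> ` U1) (\<lambda>x. f (inv_into U \<Phi> x))"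
    "openin (mtop M) U2" "m \<in> U2" "U2 \<subseteq> U" "Cinf_on (mdim M) (\<Phi> ` U2) (\<lambda>x. g (inv_into U \<Phi> x))"
    using f g unfolding smooth_near_coord[OF M c m] by blast
  have "eopen (mdim M) (\<Phi> ` (U1 \<inter> U2))" by (rule coord_image_open[OF c]) (use U in auto)
  then show ?thesis
    by (rule that) (use U in \<open>auto intro: Cinf_subset[OF U(4)] Cinf_subset[OF U(8)]\<close>)
qed

lemma coord_partial_rules:
  assumes M: "smooth_atlas M" and c: "coord M U \<Phi>" and m: "m \<in> U" and i: "i < mdim M"
    and f: "smooth_near M m f" and g: "smooth_near M m g"
  shows "coord_partial U \<Phi> i (\<lambda>p. f p + g p) m = coord_partial U \<Phi> i f m + coord_partial U \<Phi> i g m"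
    "coord_partial U \<Phi> i (\<lambda>p. f p * g p) m = coord_partial U \<Phi> i f m * g m + f m * coord_partial U \<Phi> i g m"
proof -
  obtain W where W: "\<Phi> m \<in> W" "Cinf_on (mdim M) W (\<lambda>x. f (inv_into U \<Phi> x))" "Cinf_on (mdim M) W (\<lambda>x. g (inv_into U \<Phi> x))"
    using common_coord_nbhd[OF M c m f g] by metis
  have F: "((\<lambda>t. f (inv_into U \<Phi> ((\<Phi> m)(i := t)))) has_field_derivative coord_partial U \<Phi> i f m) (at (\<Phi> m i))"
    unfolding coord_partial_def by (rule Cinf_has_partial[OF W(2,1) i])
  have G: "((\<lambda>t. g (inv_into U \<Phi> ((\<Phi> m)(i := t)))) has_field_derivative coord_partial U \<Phi> i g m) (at (\<Phi> m i))"
    unfolding coord_partial_def by (rule Cinf_has_partial[OF W(3,1) i])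
  have inv: "inv_into U \<Phi> ((\<Phi> m)(i := \<Phi> m i)) = m" using coord_inv[OF c m] by simp
  show "coord_partial U \<Phi> i (\<lambda>p. f p + g p) m = coord_partial U \<Phi> i f m + coord_partial U \<Phi> i g m"
    unfolding coord_partial_def[of U \<Phi> i "\<lambda>p. f p + g p"] by (rule partial_deriv_eqI[OF DERIV_add[OF F G]])
  show "coord_partial U \<Phi> i (\<lambda>p. f p * g p) m = coord_partial U \<Phi> i f m * g m + f m * coord_partial U \<Phi> i g m"
    unfolding coord_partial_def[of U \<Phi> i "\<lambda>p. f p * g p"]
    by (rule partial_deriv_eqI[OF DERIV_cong[OF DERIV_mult[OF F G]]]) (use inv in simp)
qed

lemma coord_partial_component:
  assumes c: "coord M U \<Phi>" and m: "m \<in> U" and i: "i < mdim M"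
  shows "coord_partial U \<Phi> i (\<lambda>p. \<Phi> p j) m = (if j = i then 1 else 0)"
proof -
  have "coord_partial U \<Phi> i (\<lambda>p. \<Phi> p j) m = partial_deriv i (\<lambda>x. x j) (\<Phi> m)"
    unfolding coord_partial_def
    by (rule partial_cong(1)[OF coordD(4)[OF c] _ i]) (use m coord_inv[OF c] in auto)
  then show ?thesis using partial_deriv_eqI[OF has_field_derivative_update] by simp
qed

lemma coord_partial_const: "coord_partial U \<Phi> i (\<lambda>p. c) m = 0"
  unfolding coord_partial_def partial_deriv_def by simp

lemma coord_vector_tangent:
  assumes M: "smooth_atlas M" and c: "coord M U \<Phi>" and m: "m \<in> U"
  shows "coord_vector M U \<Phi> m a \<in> tangent_space M m"
proof -
  have mt: "m \<in> topspace (mtop M)" using openin_subset[OF coordD(2)[OF c]] m by blast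
  note rules = coord_partial_rules[OF M c m]
  let ?v = "coord_vector M U \<Phi> m a"
  have add: "?v (\<lambda>x. f x + g x) = ?v f + ?v g" if "smooth_near M m f" "smooth_near M m g" for f g
    using that smooth_near_add[OF M that] rules(1)[OF _ that]
    by (simp add: coord_vector_def distrib_left sum.distrib)
  have mult: "?v (\<lambda>x. f x * g x) = ?v f * g m + f m * ?v g" if "smooth_near M m f" "smooth_near M m g" for f g
    using that smooth_near_mult[OF M that] rules(2)[OF _ that]
    by (simp add: coord_vector_def distrib_left sum.distrib sum_distrib_left sum_distrib_right mult_ac)
  have scale: "?v (\<lambda>x. b * f x) = b * ?v f" if f: "smooth_near M m f" for b f
    using mult[OF smooth_near_const[OF M mt, of b] f]
    by (simp add: coord_vector_def coord_partial_const)
  have "?v f = 0" if "\<not> smooth_near M m f" for f using that by (simp add: coord_vector_def)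
  then show ?thesis unfolding tangent_space_def using add mult scale by blast
qed

lemma coord_vector_component:
  assumes c: "coord M U \<Phi>" and m: "m \<in> U" and j: "j < mdim M"
  shows "coord_vector M U \<Phi> m a (\<lambda>p. \<Phi> p j) = a j"
proof -
  have "(\<Sum>i<mdim M. a i * coord_partial U \<Phi> i (\<lambda>p. \<Phi> p j) m) = (\<Sum>i<mdim M. if i = j then a i else 0)"
    by (rule sum.cong[OF refl]) (use coord_partial_component[OF c m] in auto)
  then have "coord_vector M U \<Phi> m a (\<lambda>p. \<Phi> p j) = (\<Sum>i<mdim M. if i = j then a i else 0)"
    unfolding coord_vector_def using smooth_near_coord_component[OF c m j] by simp
  then show ?thesis using j by simp
qed

lemma tangent_lincomb:
  assumes "v \<in> tangent_space M m" "w \<in> tangent_space M m"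
  shows "(\<lambda>f. a * v f + b * w f) \<in> tangent_space M m"
  unfolding tangent_space_def
proof (intro CollectI conjI allI impI)
  fix f g c assume f: "smooth_near M m f"
  show "a * v (\<lambda>x. c * f x) + b * w (\<lambda>x. c * f x) = c * (a * v f + b * w f)"
    unfolding tangentD(4)[OF assms(1) f] tangentD(4)[OF assms(2) f] by (simp add: algebra_simps)
  assume g: "smooth_near M m g"
  show "a * v (\<lambda>x. f x + g x) + b * w (\<lambda>x. f x + g x) = a * v f + b * w f + (a * v g + b * w g)"
    unfolding tangentD(2)[OF assms(1) f g] tangentD(2)[OF assms(2) f g] by (simp add: algebra_simps)
  show "a * v (\<lambda>x. f x * g x) + b * w (\<lambda>x. f x * g x) = (a * v f + b * w f) * g m + f m * (a * v g + b * w g)"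
    unfolding tangentD(3)[OF assms(1) f g] tangentD(3)[OF assms(2) f g] by (simp add: algebra_simps)
qed (use tangentD(1)[OF assms(1)] tangentD(1)[OF assms(2)] in simp)

lemma tangent_zero: "(\<lambda>f. 0) \<in> tangent_space M m"
  by (simp add: tangent_space_def)

lemma tangent_space_submanifold:
  assumes "smooth_atlas M" "openin (mtop M) U" "m \<in> U"
  shows "tangent_space (submanifold M U) m = tangent_space M m"
  unfolding tangent_space_def smooth_near_submanifold[OF assms] ..

lemma tangent_map_tangent:
  assumes M: "smooth_atlas M" and N: "smooth_atlas N" and f: "smooth_map M N f" and m: "m \<in> topspace (mtop M)"
    and v: "v \<in> tangent_space M m"
  shows "tangent_map N f m v \<in> tangent_space N (f m)"
  unfolding tangent_space_def
proof (intro CollectI conjI allI impI)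
  note pb = smooth_near_pullback[OF M N f m]
  have fm: "f m \<in> topspace (mtop N)" using smooth_mapD(1)[OF f] m by (auto simp: continuous_map_def Pi_iff)
  fix g h c assume g: "smooth_near N (f m) g"
  show "tangent_map N f m v (\<lambda>x. c * g x) = c * tangent_map N f m v g"
    using g smooth_near_mult[OF N smooth_near_const[OF N fm] g] tangentD(4)[OF v pb[OF g]]
    by (simp add: tangent_map_def)
  assume h: "smooth_near N (f m) h"
  show "tangent_map N f m v (\<lambda>x. g x + h x) = tangent_map N f m v g + tangent_map N f m v h"
    using g h smooth_near_add[OF N g h] tangentD(2)[OF v pb[OF g] pb[OF h]] by (simp add: tangent_map_def)
  show "tangent_map N f m v (\<lambda>x. g x * h x) = tangent_map N f m v g * h (f m) + g (f m) * tangent_map N f m v h"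
    using g h smooth_near_mult[OF N g h] tangentD(3)[OF v pb[OF g] pb[OF h]] by (simp add: tangent_map_def)
qed (simp add: tangent_map_def)

lemma tangent_map_component:
  assumes "coord N V \<psi>" "f m \<in> V" "i < mdim N"
  shows "tangent_map N f m v (\<lambda>q. \<psi> q i) = v (\<lambda>p. \<psi> (f p) i)"
  using smooth_near_coord_component[OF assms] by (simp add: tangent_map_def)

text \<open>A derivation is determined by its values on coordinates. So a vector is in the kernel iff it kills the
  coordinates of f.\<close>

lemma tangent_ker_coord:
  assumes M: "smooth_atlas M" and N: "smooth_atlas N" and f: "smooth_map M N f" and m: "m \<in> topspace (mtop M)"
    and d: "coord N V \<psi>" and V: "f m \<in> V"
  shows "tangent_ker M N f m = {v \<in> tangent_space M m. \<forall>i<mdim N. v (\<lambda>p. \<psi> (f p) i) = 0}"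
proof -
  have "tangent_map N f m v = (\<lambda>g. 0) \<longleftrightarrow> (\<forall>i<mdim N. v (\<lambda>p. \<psi> (f p) i) = 0)" if v: "v \<in> tangent_space M m" for v
  proof
    assume "tangent_map N f m v = (\<lambda>g. 0)"
    then show "\<forall>i<mdim N. v (\<lambda>p. \<psi> (f p) i) = 0" using tangent_map_component[where f = f and m = m and v = v, OF d V] by simp
  next
    assume "\<forall>i<mdim N. v (\<lambda>p. \<psi> (f p) i) = 0"
    then show "tangent_map N f m v = (\<lambda>g. 0)"
      by (intro tangent_eqI[OF tangent_map_tangent[OF M N f m v] tangent_zero N d V])
        (simp add: tangent_map_component[where f = f and m = m, OF d V])
  qed
  then show ?thesis unfolding tangent_ker_def by blast
qed

section \<open>Covectors and the sharp map\<close>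

lemma cotangentD:
  assumes "\<alpha> \<in> cotangent_space M m"
  shows "v \<notin> tangent_space M m \<Longrightarrow> \<alpha> v = 0"
    "v \<in> tangent_space M m \<Longrightarrow> w \<in> tangent_space M m \<Longrightarrow> \<alpha> (\<lambda>f. v f + w f) = \<alpha> v + \<alpha> w"
    "v \<in> tangent_space M m \<Longrightarrow> \<alpha> (\<lambda>f. c * v f) = c * \<alpha> v"
  using assms unfolding cotangent_space_def by blast+

lemma tangent_scale: "v \<in> tangent_space M m \<Longrightarrow> (\<lambda>f. c * v f) \<in> tangent_space M m"
  using tangent_lincomb[of v M m v c 0] by simp

lemma tangent_plus: "v \<in> tangent_space M m \<Longrightarrow> w \<in> tangent_space M m \<Longrightarrow> (\<lambda>f. v f + w f) \<in> tangent_space M m"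
  using tangent_lincomb[of v M m w 1 1] by simp

lemma cotangent_sum:
  assumes a: "\<alpha> \<in> cotangent_space M m" and w: "\<And>i. i < (k::nat) \<Longrightarrow> w i \<in> tangent_space M m"
  shows "\<alpha> (\<lambda>f. \<Sum>i<k. c i * w i f) = (\<Sum>i<k. c i * \<alpha> (w i)) \<and> (\<lambda>f. \<Sum>i<k. c i * w i f) \<in> tangent_space M m"
  using w
proof (induction k)
  case 0
  then show ?case using tangent_zero cotangentD(3)[OF a tangent_zero, of 0] by simp
next
  case (Suc k)
  have wk: "(\<lambda>f. c k * w k f) \<in> tangent_space M m" by (rule tangent_scale) (simp add: Suc.prems)
  have IH: "\<alpha> (\<lambda>f. \<Sum>i<k. c i * w i f) = (\<Sum>i<k. c i * \<alpha> (w i))" "(\<lambda>f. \<Sum>i<k. c i * w i f) \<in> tangent_space M m"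
    using Suc by auto
  show ?case
    using cotangentD(2)[OF a IH(2) wk] tangent_plus[OF IH(2) wk] cotangentD(3)[OF a, of "w k" "c k"] Suc.prems IH(1) by simp
qed

abbreviation coord_basis :: "'a manifold \<Rightarrow> 'a set \<Rightarrow> ('a \<Rightarrow> nat \<Rightarrow> real) \<Rightarrow> 'a \<Rightarrow> nat \<Rightarrow> 'a tangent" where
  "coord_basis M U \<Phi> m i \<equiv> coord_vector M U \<Phi> m (\<lambda>j. if j = i then 1 else 0)"

lemma coord_vector_basis:
  "coord_vector M U \<Phi> m c = (\<lambda>f. \<Sum>i<mdim M. c i * coord_basis M U \<Phi> m i f)"
proof
  fix f
  have "(\<Sum>j<mdim M. (if j = i then 1 else 0) * coord_partial U \<Phi> j f m) = coord_partial U \<Phi> i f m" if "i < mdim M" for i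
    using that by (simp add: if_distrib[of "\<lambda>x. x * _"] cong: if_cong)
  then show "coord_vector M U \<Phi> m c f = (\<Sum>i<mdim M. c i * coord_basis M U \<Phi> m i f)"
    by (simp add: coord_vector_def)
qed

lemma covector_coord_vector:
  assumes "smooth_atlas M" "coord M U \<Phi>" "m \<in> U" "\<alpha> \<in> cotangent_space M m"
  shows "\<alpha> (coord_vector M U \<Phi> m c) = (\<Sum>i<mdim M. c i * \<alpha> (coord_basis M U \<Phi> m i))"
  unfolding coord_vector_basis[of M U \<Phi> m c]
  using cotangent_sum[OF assms(4), of "mdim M" "coord_basis M U \<Phi> m" c] coord_vector_tangent[OF assms(1-3)] by blast

lemma tangent_eq_coord_vector:
  assumes "smooth_atlas M" "coord M U \<Phi>" "m \<in> U" "v \<in> tangent_space M m"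
  shows "v = coord_vector M U \<Phi> m (\<lambda>i. v (\<lambda>p. \<Phi> p i))"
  by (rule tangent_eqI[OF assms(4) coord_vector_tangent[OF assms(1-3)] assms(1-3)])
    (simp add: coord_vector_component[OF assms(2,3)])

lemma differential_cotangent: "differential M f m \<in> cotangent_space M m"
  unfolding cotangent_space_def differential_def using tangent_plus[of _ M m] tangent_scale[of _ M m] by auto

lemma cotangent_lincomb:
  assumes "\<alpha> \<in> cotangent_space M m" "\<beta> \<in> cotangent_space M m"
  shows "(\<lambda>v. c * \<alpha> v + \<beta> v) \<in> cotangent_space M m"
  unfolding cotangent_space_def
proof (intro CollectI conjI allI impI ballI)
  fix v assume v: "v \<notin> tangent_space M m"
  show "c * \<alpha> v + \<beta> v = 0" using cotangentD(1)[OF assms(1) v] cotangentD(1)[OF assms(2) v] by simp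
next
  fix v w assume v: "v \<in> tangent_space M m" and w: "w \<in> tangent_space M m"
  show "c * \<alpha> (\<lambda>f. v f + w f) + \<beta> (\<lambda>f. v f + w f) = c * \<alpha> v + \<beta> v + (c * \<alpha> w + \<beta> w)"
    unfolding cotangentD(2)[OF assms(1) v w] cotangentD(2)[OF assms(2) v w] by (simp add: algebra_simps)
next
  fix d v assume v: "v \<in> tangent_space M m"
  show "c * \<alpha> (\<lambda>f. d * v f) + \<beta> (\<lambda>f. d * v f) = d * (c * \<alpha> v + \<beta> v)"
    unfolding cotangentD(3)[OF assms(1) v] cotangentD(3)[OF assms(2) v] by (simp add: algebra_simps)
qed

lemma poisson_linear:
  assumes P: "poisson_manifold M \<Xi>" and m: "m \<in> topspace (mtop M)"
    and "\<alpha> \<in> cotangent_space M m" "\<beta> \<in> cotangent_space M m" "\<gamma> \<in> cotangent_space M m"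
  shows "\<Xi> m (\<lambda>v. c * \<alpha> v + \<beta> v) \<gamma> = c * \<Xi> m \<alpha> \<gamma> + \<Xi> m \<beta> \<gamma>"
  using assms unfolding poisson_manifold_def by blast

text \<open>Linearity in the first argument is assumed for \<open>c * \<alpha> + \<beta>\<close> only. The empty sum is the instance
  \<open>c = -1\<close>, \<open>\<alpha> = \<beta> = \<gamma>\<close>.\<close>

lemma poisson_sum:
  assumes P: "poisson_manifold M \<Xi>" and m: "m \<in> topspace (mtop M)" and g: "\<gamma> \<in> cotangent_space M m"
    and a: "\<And>i. i < (k::nat) \<Longrightarrow> \<alpha> i \<in> cotangent_space M m"
  shows "\<Xi> m (\<lambda>v. \<Sum>i<k. c i * \<alpha> i v) \<gamma> = (\<Sum>i<k. c i * \<Xi> m (\<alpha> i) \<gamma>) \<and> (\<lambda>v. \<Sum>i<k. c i * \<alpha> i v) \<in> cotangent_space M m"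
  using a
proof (induction k)
  case 0
  have "\<Xi> m (\<lambda>v. (-1) * \<gamma> v + \<gamma> v) \<gamma> = 0" using poisson_linear[OF P m g g g, of "-1"] by simp
  then show ?case using cotangent_lincomb[OF g g, of "-1"] by simp
next
  case (Suc k)
  have ak: "\<alpha> k \<in> cotangent_space M m" using Suc.prems by simp
  have IH: "\<Xi> m (\<lambda>v. \<Sum>i<k. c i * \<alpha> i v) \<gamma> = (\<Sum>i<k. c i * \<Xi> m (\<alpha> i) \<gamma>)" "(\<lambda>v. \<Sum>i<k. c i * \<alpha> i v) \<in> cotangent_space M m"
    using Suc by auto
  show ?case
    using poisson_linear[OF P m ak IH(2) g, of "c k"] cotangent_lincomb[OF ak IH(2), of "c k"] IH(1)
    by (simp add: add.commute)
qed

text \<open>In coordinates the vector is \<open>\<Sum>i. \<Xi>(dx\<^sub>i, \<beta>) \<partial>\<^sub>i\<close>: every covector is a combination of the \<open>dx\<^sub>i\<close>, which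
  gives existence, and the \<open>dx\<^sub>i\<close> separate vectors, which gives uniqueness.\<close>

lemma sharp_tangent:
  assumes P: "poisson_manifold M \<Xi>" and m: "m \<in> topspace (mtop M)" and b: "\<beta> \<in> cotangent_space M m"
  shows "sharp M \<Xi> m \<beta> \<in> tangent_space M m"
proof -
  have M: "smooth_atlas M" using P smooth_manifold_atlas unfolding poisson_manifold_def by blast
  obtain U \<Phi> where C: "(U, \<Phi>) \<in> charts M" and mU: "m \<in> U" using ex_chart[OF M m] .
  note c = chart_coord[OF M C]
  let ?d = "\<lambda>i. differential M (\<lambda>p. \<Phi> p i) m" and ?e = "coord_basis M U \<Phi> m"
  let ?v = "coord_vector M U \<Phi> m (\<lambda>i. \<Xi> m (?d i) \<beta>)"
  have expand: "\<alpha> = (\<lambda>v. \<Sum>i<mdim M. \<alpha> (?e i) * ?d i v)" if a: "\<alpha> \<in> cotangent_space M m" for \<alpha>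
  proof
    fix v show "\<alpha> v = (\<Sum>i<mdim M. \<alpha> (?e i) * ?d i v)"
    proof (cases "v \<in> tangent_space M m")
      case True
      have "\<alpha> v = \<alpha> (coord_vector M U \<Phi> m (\<lambda>i. v (\<lambda>p. \<Phi> p i)))"
        using tangent_eq_coord_vector[OF M c mU True] by simp
      also have "\<dots> = (\<Sum>i<mdim M. v (\<lambda>p. \<Phi> p i) * \<alpha> (?e i))" by (rule covector_coord_vector[OF M c mU a])
      finally show ?thesis using True by (simp add: differential_def mult.commute)
    qed (use cotangentD(1)[OF a] in \<open>simp add: differential_def\<close>)
  qed
  have v: "\<alpha> ?v = \<Xi> m \<alpha> \<beta>" if a: "\<alpha> \<in> cotangent_space M m" for \<alpha>
  proof -
    have "\<Xi> m \<alpha> \<beta> = \<Xi> m (\<lambda>v. \<Sum>i<mdim M. \<alpha> (?e i) * ?d i v) \<beta>" using expand[OF a] by simp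
    also have "\<dots> = (\<Sum>i<mdim M. \<alpha> (?e i) * \<Xi> m (?d i) \<beta>)"
      by (rule conjunct1[OF poisson_sum[OF P m b differential_cotangent]])
    also have "\<dots> = (\<Sum>i<mdim M. \<Xi> m (?d i) \<beta> * \<alpha> (?e i))" by (simp add: mult.commute)
    also have "\<dots> = \<alpha> ?v" by (rule covector_coord_vector[OF M c mU a, symmetric])
    finally show ?thesis by simp
  qed
  have vT: "?v \<in> tangent_space M m" by (rule coord_vector_tangent[OF M c mU])
  have "\<exists>!v. v \<in> tangent_space M m \<and> (\<forall>\<alpha> \<in> cotangent_space M m. \<alpha> v = \<Xi> m \<alpha> \<beta>)"
  proof (rule ex1I[of _ ?v])
    show "?v \<in> tangent_space M m \<and> (\<forall>\<alpha> \<in> cotangent_space M m. \<alpha> ?v = \<Xi> m \<alpha> \<beta>)" using vT v by blast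
    fix w assume w: "w \<in> tangent_space M m \<and> (\<forall>\<alpha> \<in> cotangent_space M m. \<alpha> w = \<Xi> m \<alpha> \<beta>)"
    show "w = ?v"
    proof (rule tangent_eqI[OF _ vT M c mU])
      fix i
      have "?d i w = ?d i ?v" using w v[OF differential_cotangent] differential_cotangent by metis
      then show "w (\<lambda>p. \<Phi> p i) = ?v (\<lambda>p. \<Phi> p i)" using w vT by (simp add: differential_def)
    qed (use w in blast)
  qed
  from theI'[OF this] show ?thesis unfolding sharp_def by blast
qed

section \<open>Completing functions to a coordinate system\<close>

lemma ediff_permute:
  assumes W: "eopen n W" and inv: "\<And>i. \<pi> (\<rho> i) = i" "\<And>i. \<rho> (\<pi> i) = i"
    and le: "\<And>i. i \<ge> n \<Longrightarrow> \<pi> i \<ge> n" "\<And>i. i \<ge> n \<Longrightarrow> \<rho> i \<ge> n"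
  shows "ediff n W (\<lambda>x i. x (\<pi> i))"
proof -
  let ?\<theta> = "\<lambda>(x :: nat \<Rightarrow> real) i. x (\<pi> i)" and ?\<eta> = "\<lambda>(x :: nat \<Rightarrow> real) i. x (\<rho> i)"
  have inv': "?\<theta> (?\<eta> x) = x" "?\<eta> (?\<theta> x) = x" for x by (simp_all add: inv)
  have img: "?\<theta> ` W = {y \<in> topspace (Euclidean_space n). ?\<eta> y \<in> W}"
  proof (intro equalityI subsetI)
    fix y assume "y \<in> ?\<theta> ` W"
    then obtain x where x: "y = ?\<theta> x" "x \<in> W" by (rule imageE)
    have "y \<in> topspace (Euclidean_space n)"
      using eopen_subset[OF W x(2)] le x(1) by (simp add: topspace_Euclidean_space)
    moreover have "?\<eta> y \<in> W" unfolding x(1) inv' by (rule x(2))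
    ultimately show "y \<in> {y \<in> topspace (Euclidean_space n). ?\<eta> y \<in> W}" by blast
  next
    fix y assume "y \<in> {y \<in> topspace (Euclidean_space n). ?\<eta> y \<in> W}"
    then have "?\<eta> y \<in> W" by blast
    then have "?\<theta> (?\<eta> y) \<in> ?\<theta> ` W" by (rule imageI)
    then show "y \<in> ?\<theta> ` W" unfolding inv' .
  qed
  have o: "eopen n (?\<theta> ` W)"
    unfolding img
    by (rule eopen_vimage[OF openin_topspace continuous_on_coordinate _ W])
      (use le in \<open>simp add: topspace_Euclidean_space\<close>)
  have inj: "inj_on ?\<theta> W" by (rule inj_on_inverseI[of _ ?\<eta>]) (rule inv')
  have invW: "y (\<rho> j) = inv_into W ?\<theta> y j" if y: "y \<in> ?\<theta> ` W" for y j
  proof -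
    obtain x where x: "y = ?\<theta> x" "x \<in> W" using y by (rule imageE)
    have "inv_into W ?\<theta> y = x" unfolding x(1) by (rule inv_into_f_f[OF inj x(2)])
    then show ?thesis by (simp add: x(1) inv)
  qed
  show ?thesis
    unfolding ediff_def
  proof (intro conjI allI impI W o inj Cinf_proj[OF W])
    fix j show "Cinf_on n (?\<theta> ` W) (\<lambda>y. inv_into W ?\<theta> y j)"
      by (rule Cinf_cong[where f = "\<lambda>y. y (\<rho> j)" and g = "\<lambda>y. inv_into W ?\<theta> y j", OF o invW Cinf_proj[OF o]])
  qed
qed

text \<open>Let \<open>f 0\<close>, ..., \<open>f (k - 1)\<close> be the first k coordinates already. If \<open>f k\<close> had vanishing derivative along all
  the others, its differential would be a combination of the first k differentials. So it has nonzero
  derivative along some coordinate i with \<open>k \<le> i\<close>, which it can replace after a swap of i and k.\<close>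

lemma complete_to_coordinates:
  assumes M: "smooth_atlas M" and m: "m \<in> topspace (mtop M)"
    and "\<And>j. j < k \<Longrightarrow> smooth_near M m (f j)"
    and "\<And>c. (\<And>v. v \<in> tangent_space M m \<Longrightarrow> (\<Sum>j<k. c j * v (f j)) = 0) \<Longrightarrow> \<forall>j<k. c j = 0"
  shows "k \<le> mdim M \<and> (\<exists>U \<Phi>. coord M U \<Phi> \<and> m \<in> U \<and> (\<forall>p\<in>U. \<forall>j<k. \<Phi> p j = f j p))"
  using assms(3,4)
proof (induction k)
  case 0
  obtain U \<Phi> where "(U, \<Phi>) \<in> charts M" "m \<in> U" using ex_chart[OF M m] .
  then show ?case using chart_coord[OF M] by auto
next
  case (Suc k)
  let ?n = "mdim M"
  have indep: "\<forall>j<k. c j = 0" if c: "\<And>v. v \<in> tangent_space M m \<Longrightarrow> (\<Sum>j<k. c j * v (f j)) = 0" for c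
  proof -
    have "(\<Sum>j<Suc k. (c(k := 0)) j * v (f j)) = 0" if "v \<in> tangent_space M m" for v
      using c[OF that] by simp
    from Suc.prems(2)[OF this] show ?thesis by (metis fun_upd_other less_Suc_eq less_irrefl)
  qed
  from Suc.IH[OF Suc.prems(1) indep] obtain U \<Phi> where kn: "k \<le> ?n" and c: "coord M U \<Phi>" and mU: "m \<in> U"
    and \<Phi>: "\<And>p j. p \<in> U \<Longrightarrow> j < k \<Longrightarrow> \<Phi> p j = f j p" by (metis less_SucI)
  have fk: "smooth_near M m (f k)" using Suc.prems(1) by simp
  have "\<exists>i. k \<le> i \<and> i < ?n \<and> coord_partial U \<Phi> i (f k) m \<noteq> 0"
  proof (rule ccontr)
    assume "\<not> ?thesis"
    then have z: "coord_partial U \<Phi> i (f k) m = 0" if "k \<le> i" "i < ?n" for i using that by blast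
    let ?c = "\<lambda>j. if j < k then coord_partial U \<Phi> j (f k) m else -1"
    have "(\<Sum>j<Suc k. ?c j * v (f j)) = 0" if v: "v \<in> tangent_space M m" for v
    proof -
      have "v (f k) = (\<Sum>i<?n. v (\<lambda>p. \<Phi> p i) * coord_partial U \<Phi> i (f k) m)"
        by (rule tangent_expand[OF v M c mU fk])
      also have "\<dots> = (\<Sum>i<k. v (\<lambda>p. \<Phi> p i) * coord_partial U \<Phi> i (f k) m)"
        by (rule sum.mono_neutral_right) (use kn z in auto)
      also have "\<dots> = (\<Sum>i<k. ?c i * v (f i))"
      proof (rule sum.cong[OF refl])
        fix i assume i: "i \<in> {..<k}"
        have "v (\<lambda>p. \<Phi> p i) = v (f i)"
          by (rule tangent_cong[OF v M smooth_near_coord_component[OF c mU] coordD(2)[OF c] mU])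
            (use i kn \<Phi> in auto)
        then show "v (\<lambda>p. \<Phi> p i) * coord_partial U \<Phi> i (f k) m = ?c i * v (f i)" using i by simp
      qed
      finally show ?thesis by simp
    qed
    from Suc.prems(2)[OF this] have "?c k = 0" by blast
    then show False by simp
  qed
  then obtain i where i: "k \<le> i" "i < ?n" and nz: "coord_partial U \<Phi> i (f k) m \<noteq> 0" by blast
  have k: "k < ?n" using i by simp
  define \<pi> where "\<pi> = (\<lambda>j. if j = k then i else if j = i then k else j)"
  have \<pi>: "\<pi> (\<pi> j) = j" "j \<ge> ?n \<Longrightarrow> \<pi> j \<ge> ?n" for j using i k by (auto simp: \<pi>_def)
  define \<Phi>1 where "\<Phi>1 = (\<lambda>p j. \<Phi> p (\<pi> j))"
  have "{p \<in> U. \<Phi> p \<in> \<Phi> ` U} = U" by blast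
  then have c1: "coord M U \<Phi>1"
    using coord_ediff[OF M c subset_refl ediff_permute[of ?n "\<Phi> ` U" \<pi> \<pi>, OF coordD(4)[OF c] \<pi>(1,1,2,2)]]
    by (simp add: \<Phi>1_def)
  have nz1: "coord_partial U \<Phi>1 k (f k) m \<noteq> 0"
  proof -
    \<comment> \<open>Both partial derivatives are the value on \<open>f k\<close> of the same tangent vector.\<close>
    let ?v = "coord_basis M U \<Phi> m i"
    have v: "?v \<in> tangent_space M m" by (rule coord_vector_tangent[OF M c mU])
    have comp: "?v (\<lambda>p. \<Phi>1 p j) = (if j = k then 1 else 0)" if j: "j < ?n" for j
    proof -
      have "\<pi> j < ?n" using j i k by (auto simp: \<pi>_def)
      then have "?v (\<lambda>p. \<Phi>1 p j) = (if \<pi> j = i then 1 else 0)"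
        unfolding \<Phi>1_def by (rule coord_vector_component[OF c mU])
      moreover have "\<pi> j = i \<longleftrightarrow> j = k" by (auto simp: \<pi>_def)
      ultimately show ?thesis by simp
    qed
    have "?v (f k) = (\<Sum>j<?n. ?v (\<lambda>p. \<Phi>1 p j) * coord_partial U \<Phi>1 j (f k) m)"
      by (rule tangent_expand[OF v M c1 mU fk])
    also have "\<dots> = (\<Sum>j<?n. if j = k then coord_partial U \<Phi>1 j (f k) m else 0)"
      by (rule sum.cong) (use comp in auto)
    also have "\<dots> = coord_partial U \<Phi>1 k (f k) m" using k by simp
    finally have "?v (f k) = coord_partial U \<Phi>1 k (f k) m" .
    moreover have "?v (f k) = (\<Sum>j<?n. ?v (\<lambda>p. \<Phi> p j) * coord_partial U \<Phi> j (f k) m)"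
      by (rule tangent_expand[OF v M c mU fk])
    moreover have "\<dots> = (\<Sum>j<?n. if j = i then coord_partial U \<Phi> j (f k) m else 0)"
      by (rule sum.cong) (use coord_vector_component[OF c mU] in auto)
    moreover have "\<dots> = coord_partial U \<Phi> i (f k) m" using i by simp
    ultimately show ?thesis using nz by simp
  qed
  obtain U' where U': "openin (mtop M) U'" "m \<in> U'" "U' \<subseteq> U" "Cinf_on ?n (\<Phi>1 ` U') (\<lambda>x. f k (inv_into U \<Phi>1 x))"
    using fk unfolding smooth_near_coord[OF M c1 mU] by blast
  have m1: "\<Phi>1 m \<in> \<Phi>1 ` U'" using U'(2) by blast
  obtain e where e: "e > 0" "cube ?n (\<Phi>1 m) e \<subseteq> \<Phi>1 ` U'"
    and d: "ediff ?n (cube ?n (\<Phi>1 m) e) (\<lambda>x. x(k := f k (inv_into U \<Phi>1 x)))"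
    using ediff_replace_coordinate[OF coord_image_open[OF c1 U'(1,3)] U'(4) m1 k] nz1 unfolding coord_partial_def by blast
  let ?U2 = "{p \<in> U. \<Phi>1 p \<in> cube ?n (\<Phi>1 m) e}"
  let ?\<Phi>2 = "\<lambda>p. (\<Phi>1 p)(k := f k (inv_into U \<Phi>1 (\<Phi>1 p)))"
  have "cube ?n (\<Phi>1 m) e \<subseteq> \<Phi>1 ` U" using e(2) U'(3) by blast
  from coord_ediff[OF M c1 this d] have c2: "coord M ?U2 ?\<Phi>2" .
  have "\<Phi>1 m \<in> cube ?n (\<Phi>1 m) e" by (rule center_in_cube[OF coord_zero[OF c1 mU] e(1)])
  then have m2: "m \<in> ?U2" using mU by blast
  have f2: "?\<Phi>2 p j = f j p" if p: "p \<in> ?U2" and j: "j < Suc k" for p j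
  proof (cases "j = k")
    case True
    then show ?thesis using coord_inv[OF c1, of p] p by simp
  next
    case False
    then have "?\<Phi>2 p j = \<Phi> p j" using j i by (simp add: \<Phi>1_def \<pi>_def)
    then show ?thesis using \<Phi>[of p j] p j False by simp
  qed
  show ?case
  proof (intro conjI exI ballI allI impI)
    show "Suc k \<le> ?n" using k by simp
    show "coord M ?U2 ?\<Phi>2" by (rule c2)
    show "m \<in> ?U2" by (rule m2)
  qed (rule f2)
qed

section \<open>Restriction of the Poisson structure\<close>

lemma smooth_map_mem: "smooth_map M N f \<Longrightarrow> m \<in> topspace (mtop M) \<Longrightarrow> f m \<in> topspace (mtop N)"
  using smooth_mapD(1)[of M N f] by (auto simp: continuous_map_def Pi_iff)

lemma submanifold_poisson_notions:
  assumes "smooth_atlas M" "openin (mtop M) U" "m \<in> U"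
  shows "cotangent_space (submanifold M U) m = cotangent_space M m"
    "sharp (submanifold M U) \<Xi> m = sharp M \<Xi> m"
    "annihilator (submanifold M U) m = annihilator M m"
    "lagrangian (submanifold M U) \<Xi> m = lagrangian M \<Xi> m"
    "isotropic (submanifold M U) \<Xi> m = isotropic M \<Xi> m"
proof -
  note T = tangent_space_submanifold[OF assms]
  show C: "cotangent_space (submanifold M U) m = cotangent_space M m"
    unfolding cotangent_space_def T ..
  show S: "sharp (submanifold M U) \<Xi> m = sharp M \<Xi> m"
    unfolding sharp_def T C fun_eq_iff by simp
  show A: "annihilator (submanifold M U) m = annihilator M m"
    unfolding annihilator_def C fun_eq_iff by simp
  show "isotropic (submanifold M U) \<Xi> m = isotropic M \<Xi> m"
    unfolding isotropic_def fun_eq_iff S A C by simp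
  then show "lagrangian (submanifold M U) \<Xi> m = lagrangian M \<Xi> m"
    unfolding lagrangian_def coisotropic_def fun_eq_iff S A C by simp
qed

lemma lagrangian_sharp_annihilator: "lagrangian M \<Xi> m V \<Longrightarrow> sharp M \<Xi> m ` annihilator M m V = V"
  unfolding lagrangian_def isotropic_def coisotropic_def by blast

section \<open>Projections and slices\<close>

lemma tangent_im_coordinate_projection:
  assumes M: "smooth_atlas M" and N: "smooth_atlas N" and f: "smooth_map M N f"
    and c: "coord M U \<Phi>" and d: "coord N V \<psi>" and m: "m \<in> U" and fV: "f m \<in> V"
    and eq: "\<And>p i. p \<in> U \<Longrightarrow> i < mdim N \<Longrightarrow> \<psi> (f p) i = \<Phi> p (i + s)" and s: "mdim N + s \<le> mdim M"
  shows "tangent_im M N f m = tangent_space N (f m)"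
  unfolding tangent_im_def
proof (intro equalityI subsetI)
  have mt: "m \<in> topspace (mtop M)" using openin_subset[OF coordD(2)[OF c]] m by blast
  fix w
  show "w \<in> tangent_space N (f m)" if "w \<in> tangent_map N f m ` tangent_space M m"
    using that tangent_map_tangent[OF M N f mt] by blast
  assume w: "w \<in> tangent_space N (f m)"
  let ?v = "coord_vector M U \<Phi> m (\<lambda>k. w (\<lambda>q. \<psi> q (k - s)))"
  have v: "?v \<in> tangent_space M m" by (rule coord_vector_tangent[OF M c m])
  have "w = tangent_map N f m ?v"
  proof (rule tangent_eqI[OF w tangent_map_tangent[OF M N f mt v] N d fV])
    fix i assume i: "i < mdim N"
    then have iM: "i + s < mdim M" using s by simp
    have "?v (\<lambda>p. \<psi> (f p) i) = ?v (\<lambda>p. \<Phi> p (i + s))"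
      by (rule tangent_cong[OF v M smooth_near_coord_component[OF c m iM] coordD(2)[OF c] m, symmetric])
        (use eq i in simp)
    also have "\<dots> = w (\<lambda>q. \<psi> q i)" using coord_vector_component[OF c m iM] by simp
    finally show "w (\<lambda>q. \<psi> q i) = tangent_map N f m ?v (\<lambda>q. \<psi> q i)"
      unfolding tangent_map_component[where f = f and m = m, OF d fV i] by simp
  qed
  then show "w \<in> tangent_map N f m ` tangent_space M m" using v by blast
qed

text \<open>The tangent space of the slice through m on which the first b coordinates are constant.\<close>

definition slice_space :: "'a manifold \<Rightarrow> nat \<Rightarrow> ('a \<Rightarrow> nat \<Rightarrow> real) \<Rightarrow> 'a \<Rightarrow> 'a tangent set" where
  "slice_space M b \<Phi> m = {v \<in> tangent_space M m. \<forall>j<b. v (\<lambda>p. \<Phi> p j) = 0}"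

text \<open>The section is a slice in coordinates: its first b coordinates are constant and the others are the
  coordinates of N. So its tangent map is injective, with the tangent space of the slice as its image.\<close>

lemma tangent_slice:
  assumes M: "smooth_atlas M" and N: "smooth_atlas N" and \<sigma>: "smooth_map N M \<sigma>"
    and c: "coord M U \<Phi>" and d: "coord N V \<phi>" and x: "x \<in> V" and \<sigma>V: "\<sigma> ` V \<subseteq> U"
    and eq: "\<And>y. y \<in> V \<Longrightarrow> \<Phi> (\<sigma> y) = join b l (\<phi> y)" and dim: "mdim M = b + mdim N"
  shows "tangent_im N M \<sigma> x = slice_space M b \<Phi> (\<sigma> x)"
    and "inj_on (tangent_map M \<sigma> x) (tangent_space N x)"
proof -
  have xt: "x \<in> topspace (mtop N)" using openin_subset[OF coordD(2)[OF d]] x by blast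
  have \<sigma>x: "\<sigma> x \<in> U" using \<sigma>V x by blast
  note tm = tangent_map_tangent[OF N M \<sigma> xt]
  have low: "tangent_map M \<sigma> x w (\<lambda>p. \<Phi> p j) = 0" if w: "w \<in> tangent_space N x" and j: "j < b" for w j
  proof -
    have jM: "j < mdim M" using j dim by simp
    have "w (\<lambda>y. \<Phi> (\<sigma> y) j) = w (\<lambda>y. l j)"
      by (rule tangent_cong[OF w N smooth_near_const[OF N xt] coordD(2)[OF d] x, symmetric])
        (use eq j in \<open>simp add: join_def\<close>)
    then show ?thesis unfolding tangent_map_component[where f = \<sigma> and m = x, OF c \<sigma>x jM] tangent_const[OF w N] .
  qed
  have high: "tangent_map M \<sigma> x w (\<lambda>p. \<Phi> p (i + b)) = w (\<lambda>y. \<phi> y i)"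
    if w: "w \<in> tangent_space N x" and i: "i < mdim N" for w i
  proof -
    have iM: "i + b < mdim M" using i dim by simp
    have "w (\<lambda>y. \<Phi> (\<sigma> y) (i + b)) = w (\<lambda>y. \<phi> y i)"
      by (rule tangent_cong[OF w N smooth_near_coord_component[OF d x i] coordD(2)[OF d] x, symmetric])
        (use eq in \<open>simp add: join_def\<close>)
    then show ?thesis unfolding tangent_map_component[where f = \<sigma> and m = x, OF c \<sigma>x iM] .
  qed
  show "tangent_im N M \<sigma> x = slice_space M b \<Phi> (\<sigma> x)"
    unfolding tangent_im_def
  proof (intro equalityI subsetI)
    fix v assume "v \<in> tangent_map M \<sigma> x ` tangent_space N x"
    then show "v \<in> slice_space M b \<Phi> (\<sigma> x)" unfolding slice_space_def using low tm by blast
  next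
    fix v assume "v \<in> slice_space M b \<Phi> (\<sigma> x)"
    then have v: "v \<in> tangent_space M (\<sigma> x)" and v0: "\<And>j. j < b \<Longrightarrow> v (\<lambda>p. \<Phi> p j) = 0"
      unfolding slice_space_def by blast+
    let ?w = "coord_vector N V \<phi> x (\<lambda>i. v (\<lambda>p. \<Phi> p (i + b)))"
    have w: "?w \<in> tangent_space N x" by (rule coord_vector_tangent[OF N d x])
    have "v = tangent_map M \<sigma> x ?w"
    proof (rule tangent_eqI[OF v tm[OF w] M c \<sigma>x])
      fix j assume j: "j < mdim M"
      show "v (\<lambda>p. \<Phi> p j) = tangent_map M \<sigma> x ?w (\<lambda>p. \<Phi> p j)"
      proof (cases "j < b")
        case True
        then show ?thesis using v0 low[OF w] by simp
      next
        case False
        then obtain i where i: "j = i + b" "i < mdim N" using j dim that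
          by (metis add.commute add_less_cancel_left le_Suc_ex not_less)
        show ?thesis unfolding i(1) high[OF w i(2)] coord_vector_component[OF d x i(2)] ..
      qed
    qed
    then show "v \<in> tangent_map M \<sigma> x ` tangent_space N x" using w by blast
  qed
  show "inj_on (tangent_map M \<sigma> x) (tangent_space N x)"
  proof (rule inj_onI)
    fix w w' assume w: "w \<in> tangent_space N x" and w': "w' \<in> tangent_space N x"
      and e: "tangent_map M \<sigma> x w = tangent_map M \<sigma> x w'"
    show "w = w'"
    proof (rule tangent_eqI[OF w w' N d x])
      fix i assume i: "i < mdim N"
      show "w (\<lambda>y. \<phi> y i) = w' (\<lambda>y. \<phi> y i)"
        unfolding high[OF w i, symmetric] high[OF w' i, symmetric] e ..
    qed
  qed
qed

text \<open>A cube is the product of its two projections.\<close>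

lemma join_in_cube:
  assumes "l \<in> cube b c e" "x \<in> cube a (tail b c) e"
  shows "join b l x \<in> cube (b + a) c e"
  unfolding cube_def mem_Collect_eq
proof (intro conjI allI impI)
  fix i assume i: "i < b + a"
  show "\<bar>join b l x i - c i\<bar> < e"
  proof (cases "i < b")
    case False
    then have "i - b < a" using i by simp
    then have "\<bar>x (i - b) - tail b c (i - b)\<bar> < e" using assms(2) by (simp add: cube_def)
    then show ?thesis using False by (simp add: join_def tail_def)
  qed (use assms(1) in \<open>simp add: join_def cube_def\<close>)
qed (use assms(2) in \<open>auto simp: cube_def join_def\<close>)

lemma head_in_cube: "x \<in> cube (b + a) c e \<Longrightarrow> head b x \<in> cube b c e"
  and tail_in_cube: "x \<in> cube (b + a) c e \<Longrightarrow> tail b x \<in> cube a (tail b c) e"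
  by (auto simp: cube_def head_def tail_def)

section \<open>Product coordinates and complete solutions\<close>

text \<open>The coordinates on U are split into the first b ones, the parameters of a family of slices, and the
  others, which are the coordinates of p. The cube makes U diffeomorphic to the product of N with the space
  of parameters, by the map \<open>sol\<close>, whose inverse is \<open>unsol\<close>.\<close>

locale product_coordinates =
  fixes M :: "'a manifold" and U :: "'a set" and \<Phi> :: "'a \<Rightarrow> nat \<Rightarrow> real"
    and N :: "'b manifold" and \<phi> :: "'b \<Rightarrow> nat \<Rightarrow> real" and p :: "'a \<Rightarrow> 'b"
    and b :: nat and c :: "nat \<Rightarrow> real" and e :: real
  assumes M: "smooth_manifold M" and N: "smooth_manifold N"
    and cM: "coord M U \<Phi>" and cN: "coord N (topspace (mtop N)) \<phi>"
    and dim: "mdim M = b + mdim N"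
    and imageM: "\<Phi> ` U = cube (b + mdim N) c e"
    and imageN: "\<phi> ` topspace (mtop N) = cube (mdim N) (tail b c) e"
    and p_mem: "\<And>q. q \<in> U \<Longrightarrow> p q \<in> topspace (mtop N)"
    and p_coord: "\<And>q. q \<in> U \<Longrightarrow> \<phi> (p q) = tail b (\<Phi> q)"
begin

abbreviation "leaves \<equiv> eucl_manifold b (cube b c e)"
abbreviation "MU \<equiv> submanifold M U"
abbreviation "NT \<equiv> topspace (mtop N)"
abbreviation "sol \<equiv> \<lambda>(n, l). inv_into U \<Phi> (join b l (\<phi> n))"

lemma atlas_M: "smooth_atlas M" and atlas_N: "smooth_atlas N" and atlas_leaves: "smooth_atlas leaves"
  using M N smooth_manifold_eucl_manifold[OF eopen_cube] by (auto intro: smooth_manifold_atlas)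

lemma oU: "openin (mtop M) U" using coordD(2)[OF cM] .

lemma atlas_MU: "smooth_atlas MU" by (rule smooth_atlas_submanifold[OF atlas_M oU])

lemma top_MU: "topspace (mtop MU) = U"
  using openin_subset[OF oU] by (auto simp: topspace_subtopology)

lemma top_L: "topspace (mtop leaves) = cube b c e"
  by (rule topspace_eucl_manifold[OF eopen_cube])

lemma c_MU: "coord MU U \<Phi>" by (rule coord_submanifold[OF atlas_M oU cM]) auto

lemma c_L: "coord leaves (cube b c e) (\<lambda>x. x)" by (rule coord_eucl_manifold[OF eopen_cube])

lemma sol_coord:
  assumes "n \<in> NT" "l \<in> cube b c e"
  shows "sol (n, l) \<in> U" "\<Phi> (sol (n, l)) = join b l (\<phi> n)"
proof -
  have "\<phi> n \<in> cube (mdim N) (tail b c) e" using assms(1) imageN by blast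
  then have "join b l (\<phi> n) \<in> \<Phi> ` U" unfolding imageM by (rule join_in_cube[OF assms(2)])
  then show "sol (n, l) \<in> U" "\<Phi> (sol (n, l)) = join b l (\<phi> n)"
    using inv_into_into[of _ \<Phi> U] f_inv_into_f[of _ \<Phi> U] by auto
qed

lemma p_sol: "n \<in> NT \<Longrightarrow> l \<in> cube b c e \<Longrightarrow> p (sol (n, l)) = n"
proof -
  assume n: "n \<in> NT" and l: "l \<in> cube b c e"
  note s = sol_coord[OF n l]
  have "\<phi> (p (sol (n, l))) = \<phi> n" unfolding p_coord[OF s(1)] s(2) tail_join ..
  then show ?thesis using coordD(3)[OF cN] p_mem[OF s(1)] n by (meson inj_onD)
qed

lemma head_coord: "q \<in> U \<Longrightarrow> head b (\<Phi> q) \<in> cube b c e"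
  using imageM head_in_cube by blast

lemma sol_p: "q \<in> U \<Longrightarrow> sol (p q, head b (\<Phi> q)) = q"
  using p_coord coord_inv[OF cM] by (simp add: join_head_tail)

lemma smooth_p: "smooth_map MU N p"
proof (rule smooth_map_coordI[OF atlas_MU atlas_N c_MU top_MU cN])
  show "p ` U \<subseteq> NT" using p_mem by blast
  fix i
  have "x (i + b) = \<phi> (p (inv_into U \<Phi> x)) i" if "x \<in> \<Phi> ` U" for x
    using p_coord[OF inv_into_into[OF that]] f_inv_into_f[OF that] by (simp add: tail_def)
  from Cinf_cong[where f = "\<lambda>x. x (i + b)" and g = "\<lambda>x. \<phi> (p (inv_into U \<Phi> x)) i", OF coordD(4)[OF c_MU] this Cinf_proj[OF coordD(4)[OF c_MU]]]
  show "Cinf_on (mdim MU) (\<Phi> ` U) (\<lambda>x. \<phi> (p (inv_into U \<Phi> x)) i)" .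
qed

lemma smooth_head: "smooth_map MU leaves (\<lambda>q. head b (\<Phi> q))"
proof (rule smooth_map_coordI[OF atlas_MU atlas_leaves c_MU top_MU c_L])
  show "(\<lambda>q. head b (\<Phi> q)) ` U \<subseteq> cube b c e" using head_coord by blast
  fix i assume "i < mdim leaves"
  then have i: "i < b" by simp
  have "x i = head b (\<Phi> (inv_into U \<Phi> x)) i" if "x \<in> \<Phi> ` U" for x
    using f_inv_into_f[OF that] i by (simp add: head_def)
  from Cinf_cong[where f = "\<lambda>x. x i" and g = "\<lambda>x. head b (\<Phi> (inv_into U \<Phi> x)) i", OF coordD(4)[OF c_MU] this Cinf_proj[OF coordD(4)[OF c_MU]]]
  show "Cinf_on (mdim MU) (\<Phi> ` U) (\<lambda>x. head b (\<Phi> (inv_into U \<Phi> x)) i)" .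
qed

lemma fibration_p:
  assumes "cube b c e \<noteq> {}"
  shows "fibration MU N p"
  unfolding fibration_def top_MU
proof (intro conjI ballI smooth_p)
  obtain l where l: "l \<in> cube b c e" using assms by blast
  show "p ` U = NT"
  proof (intro equalityI subsetI)
    fix n assume "n \<in> NT"
    then show "n \<in> p ` U" using p_sol[OF _ l] sol_coord(1)[OF _ l] by (metis imageI)
  qed (use p_mem in blast)
  fix m assume m: "m \<in> U"
  show "tangent_im MU N p m = tangent_space N (p m)"
    by (rule tangent_im_coordinate_projection[OF atlas_MU atlas_N smooth_p c_MU cN m p_mem[OF m], where s = b])
      (use p_coord dim in \<open>auto simp: tail_def\<close>)
qed

lemma fibration_head:
  assumes "cube (mdim N) (tail b c) e \<noteq> {}"
  shows "fibration MU leaves (\<lambda>q. head b (\<Phi> q))"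
  unfolding fibration_def top_MU top_L
proof (intro conjI ballI smooth_head)
  obtain x where x: "x \<in> cube (mdim N) (tail b c) e" using assms by blast
  show "(\<lambda>q. head b (\<Phi> q)) ` U = cube b c e"
  proof (intro equalityI subsetI)
    fix l assume l: "l \<in> cube b c e"
    have "join b l x \<in> \<Phi> ` U" unfolding imageM by (rule join_in_cube[OF l x])
    then obtain q where q: "q \<in> U" "\<Phi> q = join b l x" by (metis imageE)
    have "head b (\<Phi> q) = l" unfolding q(2) by (rule head_join) (use l in \<open>simp add: cube_def\<close>)
    then show "l \<in> (\<lambda>q. head b (\<Phi> q)) ` U" using q(1) by blast
  qed (use head_coord in blast)
  fix m assume m: "m \<in> U"
  show "tangent_im MU leaves (\<lambda>q. head b (\<Phi> q)) m = tangent_space leaves (head b (\<Phi> m))"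
    by (rule tangent_im_coordinate_projection[OF atlas_MU atlas_leaves smooth_head c_MU c_L m head_coord[OF m], where s = 0])
      (use dim in \<open>auto simp: head_def\<close>)
qed

lemma tangent_ker_head:
  assumes m: "m \<in> U"
  shows "tangent_ker MU leaves (\<lambda>q. head b (\<Phi> q)) m = slice_space M b \<Phi> m"
proof -
  have "(\<lambda>q. head b (\<Phi> q) i) = (\<lambda>q. \<Phi> q i)" if "i < b" for i using that by (simp add: head_def)
  then show ?thesis
    using tangent_ker_coord[OF atlas_MU atlas_leaves smooth_head _ c_L head_coord[OF m]] m
    unfolding top_MU slice_space_def tangent_space_submanifold[OF atlas_M oU m] by auto
qed

lemma smooth_slice:
  assumes l: "l \<in> cube b c e"
  shows "smooth_map N MU (\<lambda>n. sol (n, l))"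
proof (rule smooth_map_coordI[OF atlas_N atlas_MU cN refl c_MU])
  show "(\<lambda>n. sol (n, l)) ` NT \<subseteq> U" using sol_coord(1)[OF _ l] by blast
  fix i assume i: "i < mdim MU"
  have o: "eopen (mdim N) (\<phi> ` NT)" using coordD(4)[OF cN] .
  have eq: "join b l x i = \<Phi> (sol (inv_into NT \<phi> x, l)) i" if "x \<in> \<phi> ` NT" for x
    unfolding sol_coord(2)[OF inv_into_into[OF that] l] f_inv_into_f[OF that] ..
  have "Cinf_on (mdim N) (\<phi> ` NT) (\<lambda>x. join b l x i)"
    unfolding join_def by (cases "i < b") (simp_all add: Cinf_const Cinf_proj[OF o])
  from Cinf_cong[where f = "\<lambda>x. join b l x i" and g = "\<lambda>x. \<Phi> (sol (inv_into NT \<phi> x, l)) i", OF o eq this]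
  show "Cinf_on (mdim N) (\<phi> ` NT) (\<lambda>x. \<Phi> (sol (inv_into NT \<phi> x, l)) i)" .
qed

lemma slice_tangent:
  assumes n: "n \<in> NT" and l: "l \<in> cube b c e"
  shows "tangent_im N MU (\<lambda>n. sol (n, l)) n = slice_space M b \<Phi> (sol (n, l))"
    and "inj_on (tangent_map MU (\<lambda>n. sol (n, l)) n) (tangent_space N n)"
proof -
  have sub: "(\<lambda>n. sol (n, l)) ` NT \<subseteq> U" using sol_coord(1)[OF _ l] by blast
  have "mdim MU = b + mdim N" using dim by simp
  note s = tangent_slice[OF atlas_MU atlas_N smooth_slice[OF l] c_MU cN n sub sol_coord(2)[OF _ l] this]
  show "tangent_im N MU (\<lambda>n. sol (n, l)) n = slice_space M b \<Phi> (sol (n, l))"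
    using s(1) unfolding slice_space_def tangent_space_submanifold[OF atlas_M oU sol_coord(1)[OF n l]] .
  show "inj_on (tangent_map MU (\<lambda>n. sol (n, l)) n) (tangent_space N n)" by (rule s(2))
qed

abbreviation "unsol \<equiv> \<lambda>q. (p q, head b (\<Phi> q))"
abbreviation "PT \<equiv> NT \<times> cube b c e"
abbreviation "\<Psi> \<equiv> join_chart (mdim N) \<phi> (\<lambda>x. x)"

text \<open>A local diffeomorphism is to restrict to diffeomorphisms of open submanifolds. The whole spaces, seen as open
  submanifolds of themselves, serve for that; they have the same coordinates, and Q and R stand for both versions.\<close>

lemma smooth_sol:
  assumes Q: "smooth_atlas Q" "coord Q PT \<Psi>" "topspace (mtop Q) = PT" "mdim Q = mdim N + b"
    and R: "smooth_atlas R" "coord R U \<Phi>" "topspace (mtop R) = U" "mdim R = mdim M"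
  shows "smooth_map Q R sol" "smooth_map R Q unsol"
proof -
  have low: "\<Psi> (n, l) i = \<phi> n i" if "i < mdim N" for n l i using that by (simp add: join_chart_def join_def)
  have high: "\<Psi> (n, l) i = l (i - mdim N)" if "\<not> i < mdim N" for n l i using that by (simp add: join_chart_def join_def)
  show "smooth_map Q R sol"
  proof (rule smooth_map_coordI[OF Q(1) R(1) Q(2,3) R(2)])
    show "sol ` PT \<subseteq> U" using sol_coord(1) by auto
    fix i assume "i < mdim R"
    then have i: "i < b + mdim N" using R(4) dim by simp
    have eq: "z (if i < b then i + mdim N else i - b) = \<Phi> (sol (inv_into PT \<Psi> z)) i" if z: "z \<in> \<Psi> ` PT" for z
    proof -
      obtain n l where nl: "z = \<Psi> (n, l)" "n \<in> NT" "l \<in> cube b c e" using z by (auto elim!: imageE)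
      have "inv_into PT \<Psi> z = (n, l)" unfolding nl(1) by (rule coord_inv[OF Q(2)]) (use nl in blast)
      then have "\<Phi> (sol (inv_into PT \<Psi> z)) i = join b l (\<phi> n) i" using sol_coord(2)[OF nl(2,3)] by simp
      also have "\<dots> = z (if i < b then i + mdim N else i - b)"
        unfolding nl(1) using i high low by (auto simp: join_def)
      finally show ?thesis by simp
    qed
    show "Cinf_on (mdim Q) (\<Psi> ` PT) (\<lambda>z. \<Phi> (sol (inv_into PT \<Psi> z)) i)"
      by (rule Cinf_cong[where f = "\<lambda>z. z (if i < b then i + mdim N else i - b)" and
            g = "\<lambda>z. \<Phi> (sol (inv_into PT \<Psi> z)) i", OF coordD(4)[OF Q(2)] eq Cinf_proj[OF coordD(4)[OF Q(2)]]])
  qed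
  show "smooth_map R Q unsol"
  proof (rule smooth_map_coordI[OF R(1) Q(1) R(2,3) Q(2)])
    show "unsol ` U \<subseteq> PT" using p_mem head_coord by blast
    fix i assume "i < mdim Q"
    then have i: "i < mdim N + b" using Q(4) by simp
    have eq: "x (if i < mdim N then i + b else i - mdim N) = \<Psi> (unsol (inv_into U \<Phi> x)) i" if x: "x \<in> \<Phi> ` U" for x
    proof -
      note q = inv_into_into[OF x] and fx = f_inv_into_f[OF x]
      have "\<phi> (p (inv_into U \<Phi> x)) = tail b x" using p_coord[OF q] fx by simp
      then show ?thesis using i fx by (cases "i < mdim N") (auto simp: low high tail_def head_def)
    qed
    show "Cinf_on (mdim R) (\<Phi> ` U) (\<lambda>x. \<Psi> (unsol (inv_into U \<Phi> x)) i)"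
      by (rule Cinf_cong[where f = "\<lambda>x. x (if i < mdim N then i + b else i - mdim N)" and
            g = "\<lambda>x. \<Psi> (unsol (inv_into U \<Phi> x)) i", OF coordD(4)[OF R(2)] eq Cinf_proj[OF coordD(4)[OF R(2)]]])
  qed
qed

lemma local_diffeomorphism_sol: "local_diffeomorphism (prod_manifold N leaves) MU sol"
proof -
  let ?P = "prod_manifold N leaves"
  have Pa: "smooth_atlas ?P" by (rule smooth_atlas_prod[OF atlas_N atlas_leaves])
  have top_P: "topspace (mtop ?P) = PT" unfolding prod_manifold_simps topspace_prod_topology top_L ..
  have cP: "coord ?P PT \<Psi>" by (rule coord_prod[OF atlas_N atlas_leaves cN c_L])
  have oP: "openin (mtop ?P) PT" by (rule coordD(2)[OF cP])
  have oMU: "openin (mtop MU) U" by (rule coordD(2)[OF c_MU])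
  have P': "smooth_atlas (submanifold ?P PT)" "coord (submanifold ?P PT) PT \<Psi>"
    "topspace (mtop (submanifold ?P PT)) = PT"
    using smooth_atlas_submanifold[OF Pa oP] coord_submanifold[OF Pa oP cP subset_refl] openin_subset[OF oP]
    by (auto simp: topspace_subtopology)
  have M': "smooth_atlas (submanifold MU U)" "coord (submanifold MU U) U \<Phi>"
    "topspace (mtop (submanifold MU U)) = U"
    using smooth_atlas_submanifold[OF atlas_MU oMU] coord_submanifold[OF atlas_MU oMU c_MU subset_refl] openin_subset[OF oU]
    by (auto simp: topspace_subtopology)
  have sm: "smooth_map ?P MU sol" by (rule smooth_sol(1)[OF Pa cP top_P _ atlas_MU c_MU top_MU]) simp_all
  have "smooth_map (submanifold ?P PT) (submanifold MU U) sol" "smooth_map (submanifold MU U) (submanifold ?P PT) unsol"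
    by (rule smooth_sol[OF P' _ M']; simp)+
  moreover have "unsol (sol z) = z" if z: "z \<in> PT" for z
  proof -
    obtain n l where nl: "z = (n, l)" "n \<in> NT" "l \<in> cube b c e" using z by blast
    have "head b (join b l (\<phi> n)) = l" by (rule head_join) (use nl(3) in \<open>simp add: cube_def\<close>)
    then show ?thesis using nl p_sol[OF nl(2,3)] sol_coord(2)[OF nl(2,3)] by simp
  qed
  ultimately have "diffeomorphism (submanifold ?P PT) (submanifold MU U) sol"
    unfolding diffeomorphism_def P'(3) M'(3) using sol_p by (intro conjI exI[of _ unsol]) blast+
  then show ?thesis
    unfolding local_diffeomorphism_def top_P using sm oP oMU by blast
qed

text \<open>If X is tangent to the slices, \<open>X = \<sigma>\<^sub>* w\<close> on the image of a slice \<open>\<sigma>\<close>. Then \<open>p\<^sub>* X = w\<close>, as \<open>\<sigma>\<close> is a section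
  of p, which gives the Hamilton--Jacobi equation.\<close>

lemma lagrangian_complete_solution_sol:
  assumes X: "\<And>m. m \<in> U \<Longrightarrow> X m \<in> slice_space M b \<Phi> m"
    and lag: "\<And>m. m \<in> U \<Longrightarrow> lagrangian M \<Xi> m (slice_space M b \<Phi> m)"
  shows "lagrangian_complete_solution MU \<Xi> X N p leaves sol"
proof -
  have HJE: "HJE_solution MU X N p (\<lambda>n. sol (n, l))" if l: "l \<in> cube b c e" for l
    unfolding HJE_solution_def smooth_section_def
  proof (intro conjI ballI smooth_slice[OF l])
    fix n assume n: "n \<in> NT"
    let ?\<sigma> = "\<lambda>n. sol (n, l)"
    show "p (sol (n, l)) = n" by (rule p_sol[OF n l])
    have sU: "sol (n, l) \<in> U" by (rule sol_coord(1)[OF n l])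
    have "X (sol (n, l)) \<in> tangent_im N MU ?\<sigma> n" unfolding slice_tangent(1)[OF n l] by (rule X[OF sU])
    then obtain w where w: "w \<in> tangent_space N n" "X (sol (n, l)) = tangent_map MU ?\<sigma> n w"
      unfolding tangent_im_def by blast
    have "tangent_map N p (sol (n, l)) (tangent_map MU ?\<sigma> n w) = w"
    proof
      fix g
      show "tangent_map N p (sol (n, l)) (tangent_map MU ?\<sigma> n w) g = w g"
      proof (cases "smooth_near N n g")
        case True
        then have "smooth_near MU (sol (n, l)) (\<lambda>q. g (p q))"
          using smooth_near_pullback[OF atlas_MU atlas_N smooth_p, of "sol (n, l)" g] sU unfolding top_MU p_sol[OF n l] by blast
        moreover have "w g = w (\<lambda>n. g (p (sol (n, l))))"
          by (rule tangent_cong[OF w(1) atlas_N True openin_topspace n]) (use p_sol[OF _ l] in simp)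
        ultimately show ?thesis using True p_sol[OF n l] by (simp add: tangent_map_def)
      next
        case False
        then show ?thesis using tangentD(1)[OF w(1) False] p_sol[OF n l] by (simp add: tangent_map_def)
      qed
    qed
    then show "tangent_map MU ?\<sigma> n (tangent_map N p (sol (n, l)) (X (sol (n, l)))) = X (sol (n, l))"
      unfolding w(2) by simp
  qed
  have img: "sol ` topspace (mtop (prod_manifold N leaves)) = topspace (mtop MU)"
    unfolding prod_manifold_simps topspace_prod_topology top_L top_MU
  proof (intro equalityI subsetI)
    fix q assume "q \<in> sol ` PT"
    then show "q \<in> U" using sol_coord(1) by auto
  next
    fix q assume q: "q \<in> U"
    have "unsol q \<in> PT" using p_mem[OF q] head_coord[OF q] by blast
    then have "sol (unsol q) \<in> sol ` PT" by (rule imageI)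
    then show "q \<in> sol ` PT" unfolding sol_p[OF q] .
  qed
  have "complete_solution MU X N p leaves sol"
    unfolding complete_solution_def top_L
    using smooth_manifold_eucl_manifold[OF eopen_cube] dim local_diffeomorphism_sol img HJE by simp
  moreover have "lagrangian MU \<Xi> (sol (n, l)) (tangent_im N MU (\<lambda>n. sol (n, l)) n)"
    if n: "n \<in> NT" and l: "l \<in> cube b c e" for n l
    unfolding slice_tangent(1)[OF n l] submanifold_poisson_notions(4)[OF atlas_M oU sol_coord(1)[OF n l]]
    by (rule lag[OF sol_coord(1)[OF n l]])
  ultimately show ?thesis unfolding lagrangian_complete_solution_def top_L by blast
qed

lemma slice_through:
  assumes m: "m \<in> U"
  shows "\<exists>\<iota>. smooth_map N MU \<iota> \<and> inj_on \<iota> NT \<and> m \<in> \<iota> ` NT \<and>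
    (\<forall>s\<in>NT. \<iota> s \<in> U \<and> inj_on (tangent_map MU \<iota> s) (tangent_space N s) \<and>
       tangent_im N MU \<iota> s = slice_space M b \<Phi> (\<iota> s))"
proof -
  let ?l = "head b (\<Phi> m)"
  let ?\<iota> = "\<lambda>n. sol (n, ?l)"
  note l = head_coord[OF m]
  have "inj_on ?\<iota> NT" by (rule inj_on_inverseI[of _ p]) (rule p_sol[OF _ l])
  moreover have "m \<in> ?\<iota> ` NT" by (rule image_eqI[of _ _ "p m"]) (use sol_p[OF m] p_mem[OF m] in simp_all)
  ultimately show ?thesis
    using smooth_slice[OF l] slice_tangent[OF _ l] sol_coord(1)[OF _ l] by (intro exI[of _ ?\<iota>]) blast
qed

end

section \<open>From complete solutions to integrability\<close>

lemma product_coordinates_eucl: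
  assumes M: "smooth_manifold M" and c: "coord M U \<Phi>" and dim: "mdim M = b + a"
    and img: "\<Phi> ` U = cube (b + a) c e"
  shows "product_coordinates M U \<Phi> (eucl_manifold a (cube a (tail b c) e)) (\<lambda>x. x) (\<lambda>q. tail b (\<Phi> q)) b c e"
proof
  have top: "topspace (mtop (eucl_manifold a (cube a (tail b c) e))) = cube a (tail b c) e"
    by (rule topspace_eucl_manifold[OF eopen_cube])
  show "coord (eucl_manifold a (cube a (tail b c) e)) (topspace (mtop (eucl_manifold a (cube a (tail b c) e)))) (\<lambda>x. x)"
    unfolding top by (rule coord_eucl_manifold[OF eopen_cube])
  show "(\<lambda>x. x) ` topspace (mtop (eucl_manifold a (cube a (tail b c) e))) = cube (mdim (eucl_manifold a (cube a (tail b c) e))) (tail b c) e"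
    unfolding top by simp
  show "tail b (\<Phi> q) \<in> topspace (mtop (eucl_manifold a (cube a (tail b c) e)))" if "q \<in> U" for q
    unfolding top using tail_in_cube[of "\<Phi> q" b a c e] img that by blast
qed (use M c dim img smooth_manifold_eucl_manifold[OF eopen_cube] in simp_all)

text \<open>The fibration is the projection to the first b coordinates. The distribution to be integrated is the
  kernel of its tangent map, as this kernel is Lagrangian, and the slices are the integral manifolds.\<close>

lemma comm_integrable_of_coordinates:
  assumes M: "smooth_manifold M" and c: "coord M U \<Phi>" and dim: "mdim M = b + a"
    and img: "\<Phi> ` U = cube (b + a) c e" and e: "e > 0"
    and X: "\<And>m. m \<in> U \<Longrightarrow> X m \<in> slice_space M b \<Phi> m"
    and lag: "\<And>m. m \<in> U \<Longrightarrow> lagrangian M \<Xi> m (slice_space M b \<Phi> m)"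
  shows "comm_integrable TYPE(nat \<Rightarrow> real) (submanifold M U) \<Xi> X"
proof -
  interpret product_coordinates M U \<Phi> "eucl_manifold a (cube a (tail b c) e)" "\<lambda>x. x" "\<lambda>q. tail b (\<Phi> q)" b c e
    by (rule product_coordinates_eucl[OF M c dim img])
  let ?F = "\<lambda>q. head b (\<Phi> q)" and ?S = "eucl_manifold a (cube a (tail b c) e)"
  have "(\<lambda>i. if i < a then tail b c i else 0) \<in> cube a (tail b c) e" using e by (simp add: cube_def)
  then have fib: "fibration MU leaves ?F" by (intro fibration_head) auto
  note pn = submanifold_poisson_notions[OF atlas_M oU]
  have lagF: "lagrangian MU \<Xi> m (tangent_ker MU leaves ?F m)" if "m \<in> U" for m
    unfolding tangent_ker_head[OF that] pn(4)[OF that] by (rule lag[OF that])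
  have "integrable_distribution MU (\<lambda>m. sharp MU \<Xi> m ` annihilator MU m (tangent_ker MU leaves ?F m))"
    unfolding integrable_distribution_def top_MU
  proof
    fix m assume m: "m \<in> U"
    have D: "sharp MU \<Xi> q ` annihilator MU q (tangent_ker MU leaves ?F q) = slice_space M b \<Phi> q" if q: "q \<in> U" for q
      using lagrangian_sharp_annihilator[OF lagF[OF q]] unfolding tangent_ker_head[OF q] .
    obtain \<iota> where \<iota>: "smooth_map ?S MU \<iota>" "inj_on \<iota> (topspace (mtop ?S))" "m \<in> \<iota> ` topspace (mtop ?S)"
      "\<And>s. s \<in> topspace (mtop ?S) \<Longrightarrow> \<iota> s \<in> U \<and> inj_on (tangent_map MU \<iota> s) (tangent_space ?S s) \<and>
         tangent_im ?S MU \<iota> s = slice_space M b \<Phi> (\<iota> s)"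
      using slice_through[OF m] by blast
    show "\<exists>(S :: (nat \<Rightarrow> real) manifold) \<iota>. smooth_manifold S \<and> smooth_map S MU \<iota> \<and>
       inj_on \<iota> (topspace (mtop S)) \<and> m \<in> \<iota> ` topspace (mtop S) \<and>
       (\<forall>s \<in> topspace (mtop S). inj_on (tangent_map MU \<iota> s) (tangent_space S s) \<and>
          tangent_im S MU \<iota> s = sharp MU \<Xi> (\<iota> s) ` annihilator MU (\<iota> s) (tangent_ker MU leaves ?F (\<iota> s)))"
      by (rule exI[of _ ?S], rule exI[of _ \<iota>])
        (use \<iota> D N in auto)
  qed
  then have "comm_integrable_by MU \<Xi> X leaves ?F"
    unfolding comm_integrable_by_def noncomm_integrable_by_def top_MU
    using smooth_manifold_eucl_manifold[OF eopen_cube] fib lagF X tangent_ker_head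
    by (auto simp: lagrangian_def)
  then show ?thesis unfolding comm_integrable_def by blast
qed

lemma tangent_ker_adapted:
  assumes M: "smooth_atlas M" and L: "smooth_atlas L" and F: "smooth_map M L F"
    and c: "coord M U \<Phi>" and d: "coord L V \<psi>" and FV: "F ` U \<subseteq> V"
    and eq: "\<And>q j. q \<in> U \<Longrightarrow> j < mdim L \<Longrightarrow> \<Phi> q j = \<psi> (F q) j" and le: "mdim L \<le> mdim M" and m: "m \<in> U"
  shows "tangent_ker M L F m = slice_space M (mdim L) \<Phi> m"
proof -
  have mt: "m \<in> topspace (mtop M)" using openin_subset[OF coordD(2)[OF c]] m by blast
  have key: "v (\<lambda>q. \<Phi> q j) = v (\<lambda>q. \<psi> (F q) j)" if v: "v \<in> tangent_space M m" and j: "j < mdim L" for v j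
    by (rule tangent_cong[OF v M smooth_near_coord_component[OF c m] coordD(2)[OF c] m])
      (use eq j le in auto)
  have Fm: "F m \<in> V" using FV m by blast
  have "(\<forall>j<mdim L. v (\<lambda>q. \<psi> (F q) j) = 0) \<longleftrightarrow> (\<forall>j<mdim L. v (\<lambda>q. \<Phi> q j) = 0)"
    if v: "v \<in> tangent_space M m" for v
    using key[OF v] by metis
  then show ?thesis
    unfolding tangent_ker_coord[OF M L F mt d Fm] slice_space_def by blast
qed

lemma hamiltonian_field_tangent:
  "poisson_manifold M \<Xi> \<Longrightarrow> m \<in> topspace (mtop M) \<Longrightarrow> hamiltonian_field M \<Xi> H m \<in> tangent_space M m"
  unfolding hamiltonian_field_def by (rule sharp_tangent[OF _ _ differential_cotangent])

text \<open>The coordinates are those of a local inverse of \<open>\<Sigma>\<close>, with the coordinates of L first. In them the partial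
  solutions are slices. The Hamilton--Jacobi equation displays X as the image of \<open>p\<^sub>* X\<close> under
  \<open>\<sigma>\<^sub>*\<close>, so X is tangent to the slices.\<close>

lemma comm_integrable_of_complete_solution:
  assumes P: "poisson_manifold M \<Xi>" and N: "smooth_manifold N" and p: "smooth_map M N p"
    and X: "\<And>m. m \<in> topspace (mtop M) \<Longrightarrow> X m \<in> tangent_space M m"
    and S: "lagrangian_complete_solution M \<Xi> X N p L \<Sigma>" and m: "m \<in> topspace (mtop M)"
  shows "\<exists>U. openin (mtop M) U \<and> m \<in> U \<and> comm_integrable TYPE(nat \<Rightarrow> real) (submanifold M U) \<Xi> X"
proof -
  let ?P = "prod_manifold N L" and ?a = "mdim N" and ?b = "mdim L"
  have M: "smooth_manifold M" using P unfolding poisson_manifold_def by blast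
  have L: "smooth_manifold L" and dim: "mdim M = ?a + ?b" and ld: "local_diffeomorphism ?P M \<Sigma>"
    and surj: "\<Sigma> ` topspace (mtop ?P) = topspace (mtop M)"
    and HJE: "\<And>l. l \<in> topspace (mtop L) \<Longrightarrow> HJE_solution M X N p (\<lambda>n. \<Sigma> (n, l))"
    and lag: "\<And>n l. l \<in> topspace (mtop L) \<Longrightarrow> n \<in> topspace (mtop N) \<Longrightarrow>
       lagrangian M \<Xi> (\<Sigma> (n, l)) (tangent_im N M (\<lambda>n. \<Sigma> (n, l)) n)"
    using S unfolding lagrangian_complete_solution_def complete_solution_def by blast+
  note Ma = smooth_manifold_atlas[OF M] and Na = smooth_manifold_atlas[OF N] and La = smooth_manifold_atlas[OF L]
  note Pa = smooth_atlas_prod[OF Na La]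
  have dimP: "mdim ?P = mdim M" using dim by simp
  obtain z0 where z0: "z0 \<in> topspace (mtop ?P)" "\<Sigma> z0 = m" using m surj by (metis imageE)
  obtain W V where W: "openin (mtop ?P) W" "z0 \<in> W" and V: "openin (mtop M) V"
    and dif: "diffeomorphism (submanifold ?P W) (submanifold M V) \<Sigma>"
    using ld z0(1) unfolding local_diffeomorphism_def by blast
  have \<Sigma>: "smooth_map ?P M \<Sigma>" using ld unfolding local_diffeomorphism_def by blast
  have WP: "topspace (mtop (submanifold ?P W)) = W" and VM: "topspace (mtop (submanifold M V)) = V"
    using openin_subset[OF W(1)] openin_subset[OF V] by (auto simp: topspace_subtopology)
  obtain g where f': "smooth_map (submanifold ?P W) (submanifold M V) \<Sigma>"
    and g: "smooth_map (submanifold M V) (submanifold ?P W) g"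
    and gf: "\<And>z. z \<in> W \<Longrightarrow> g (\<Sigma> z) = z" and fg: "\<And>q. q \<in> V \<Longrightarrow> \<Sigma> (g q) = q"
    using dif unfolding diffeomorphism_def WP VM by blast
  have "fst z0 \<in> topspace (mtop N)" "snd z0 \<in> topspace (mtop L)"
    using z0(1) by (simp_all add: mem_Times_iff)
  then obtain V1 \<phi>1 V2 \<phi>2 where C1: "(V1, \<phi>1) \<in> charts N" "fst z0 \<in> V1" and C2: "(V2, \<phi>2) \<in> charts L" "snd z0 \<in> V2"
    using ex_chart[OF Na] ex_chart[OF La] by metis
  note c1 = chart_coord[OF Na C1(1)] and c2 = chart_coord[OF La C2(1)]
  let ?J = "join_chart ?a \<phi>1 \<phi>2"
  define A where "A = W \<inter> V1 \<times> V2"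
  have cP: "coord ?P (V1 \<times> V2) ?J" by (rule coord_prod[OF Na La c1 c2])
  have A: "openin (mtop ?P) A" unfolding A_def by (rule openin_Int[OF W(1) coordD(2)[OF cP]])
  have cA: "coord ?P A ?J" by (rule coord_restrict[OF Pa cP A]) (auto simp: A_def)
  \<comment> \<open>Product charts list the coordinates of N first; the permutation puts those of L in front.\<close>
  define \<pi> where "\<pi> i = (if i < ?b then i + ?a else if i < ?b + ?a then i - ?b else i)" for i
  define \<rho> where "\<rho> i = (if i < ?a then i + ?b else if i < ?b + ?a then i - ?a else i)" for i
  define \<Psi> where "\<Psi> = (\<lambda>z i. ?J z (\<pi> i))"
  have "ediff (mdim ?P) (?J ` A) (\<lambda>x i. x (\<pi> i))"
    by (rule ediff_permute[where \<rho> = \<rho>, OF coordD(4)[OF cA]]) (auto simp: \<pi>_def \<rho>_def)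
  from coord_ediff[OF Pa cA subset_refl this]
  have cA': "coord ?P A \<Psi>" unfolding \<Psi>_def by (simp cong: conj_cong)
  have \<Psi>: "\<Psi> (n, l) = join ?b (\<phi>2 l) (\<phi>1 n)" if "(n, l) \<in> A" for n l
  proof
    fix i
    have z: "\<phi>1 n j = 0" if "j \<ge> ?a" for j using coord_zero[OF c1 _ that] \<open>(n, l) \<in> A\<close> by (auto simp: A_def)
    have z2: "\<phi>2 l j = 0" if "j \<ge> ?b" for j using coord_zero[OF c2 _ that] \<open>(n, l) \<in> A\<close> by (auto simp: A_def)
    show "\<Psi> (n, l) i = join ?b (\<phi>2 l) (\<phi>1 n) i"
      using z[of "i - ?b"] z2[of "i - ?a"] by (auto simp: \<Psi>_def \<pi>_def join_chart_def join_def)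
  qed
  have cT: "coord M (\<Sigma> ` A) (\<lambda>q. \<Psi> (g q))"
    by (rule coord_transport[OF Pa Ma W(1) V f' g gf fg cA' _ dimP]) (auto simp: A_def)
  let ?\<Phi> = "\<lambda>q. \<Psi> (g q)"
  have "z0 \<in> A" using W(2) C1(2) C2(2) by (auto simp: A_def mem_Times_iff)
  then have mA: "m \<in> \<Sigma> ` A" using z0(2) by blast
  obtain e U where e: "e > 0" and U: "openin (mtop M) U" "m \<in> U" "U \<subseteq> \<Sigma> ` A" and cU: "coord M U ?\<Phi>"
    and img: "?\<Phi> ` U = cube (mdim M) (?\<Phi> m) e"
    by (rule coord_cube[OF Ma cT coordD(2)[OF cT] mA subset_refl])
  have slice: "tangent_im N M (\<lambda>n. \<Sigma> (n, l)) n = slice_space M ?b ?\<Phi> (\<Sigma> (n, l))"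
    if nl: "(n, l) \<in> A" "\<Sigma> (n, l) \<in> U" for n l
  proof -
    let ?\<sigma> = "\<lambda>n. \<Sigma> (n, l)"
    have lL: "l \<in> topspace (mtop L)" and nN: "n \<in> topspace (mtop N)"
      using nl(1) openin_subset[OF A] by auto
    have \<sigma>: "smooth_map N M ?\<sigma>" using HJE[OF lL] unfolding HJE_solution_def smooth_section_def by blast
    let ?V = "{n' \<in> topspace (mtop N). (n', l) \<in> A \<inter> {z \<in> topspace (mtop ?P). \<Sigma> z \<in> U}}"
    have "openin (mtop ?P) (A \<inter> {z \<in> topspace (mtop ?P). \<Sigma> z \<in> U})"
      by (rule openin_Int[OF A openin_continuous_map_preimage[OF smooth_mapD(1)[OF \<Sigma>] U(1)]])
    moreover have "continuous_map (mtop N) (mtop ?P) (\<lambda>n'. (n', l))"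
      unfolding prod_manifold_simps continuous_map_paired using lL by simp
    ultimately have oV: "openin (mtop N) ?V" by (rule openin_continuous_map_preimage[rotated])
    have cV: "coord N ?V \<phi>1" by (rule coord_restrict[OF Na c1 oV]) (auto simp: A_def)
    show ?thesis
    proof (rule tangent_slice(1)[OF Ma Na \<sigma> cU cV])
      show "n \<in> ?V" using nl nN openin_subset[OF A] by blast
      show "?\<sigma> ` ?V \<subseteq> U" by blast
      show "?\<Phi> (\<Sigma> (y, l)) = join ?b (\<phi>2 l) (\<phi>1 y)" if "y \<in> ?V" for y
        using that gf[of "(y, l)"] \<Psi>[of y l] by (simp add: A_def)
    qed (use dim in simp)
  qed
  have point: "X q \<in> slice_space M ?b ?\<Phi> q \<and> lagrangian M \<Xi> q (slice_space M ?b ?\<Phi> q)" if q: "q \<in> U" for q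
  proof -
    obtain n l where nl: "(n, l) \<in> A" "q = \<Sigma> (n, l)" using q U(3) by auto
    have lL: "l \<in> topspace (mtop L)" and nN: "n \<in> topspace (mtop N)"
      using nl(1) openin_subset[OF A] by auto
    have qM: "q \<in> topspace (mtop M)" using q openin_subset[OF U(1)] by blast
    have s: "tangent_im N M (\<lambda>n. \<Sigma> (n, l)) n = slice_space M ?b ?\<Phi> q"
      using slice[OF nl(1)] q nl(2) by simp
    have "p q = n" "tangent_map M (\<lambda>n. \<Sigma> (n, l)) n (tangent_map N p q (X q)) = X q"
      using HJE[OF lL] nN nl(2) unfolding HJE_solution_def smooth_section_def by auto
    moreover have "tangent_map N p q (X q) \<in> tangent_space N (p q)"
      by (rule tangent_map_tangent[OF Ma Na p qM X[OF qM]])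
    ultimately have "X q \<in> tangent_im N M (\<lambda>n. \<Sigma> (n, l)) n" unfolding tangent_im_def by (metis imageI)
    then show ?thesis using lag[OF lL nN] nl(2) s by simp
  qed
  have "comm_integrable TYPE(nat \<Rightarrow> real) (submanifold M U) \<Xi> X"
    by (rule comm_integrable_of_coordinates[OF M cU _ _ e]) (use dim img point in \<open>auto simp: add.commute\<close>)
  then show ?thesis using U by blast
qed

section \<open>From integrability to complete solutions\<close>

lemma comm_integrable_byD:
  assumes "comm_integrable_by M \<Xi> X L F"
  shows "smooth_manifold L" "smooth_map M L F" "m \<in> topspace (mtop M) \<Longrightarrow> tangent_im M L F m = tangent_space L (F m)"
    "m \<in> topspace (mtop M) \<Longrightarrow> X m \<in> tangent_ker M L F m"
    "m \<in> topspace (mtop M) \<Longrightarrow> lagrangian M \<Xi> m (tangent_ker M L F m)"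
  using assms unfolding comm_integrable_by_def noncomm_integrable_by_def fibration_def by blast+

text \<open>By surjectivity, each coordinate vector of L is the image of a vector v. On v the given combination
  takes the value of a single coefficient.\<close>

lemma submersion_independent:
  assumes M: "smooth_atlas M" and L: "smooth_atlas L" and im: "tangent_im M L F m = tangent_space L (F m)"
    and d: "coord L V \<psi>" and FV: "F m \<in> V"
    and c: "\<And>v. v \<in> tangent_space M m \<Longrightarrow> (\<Sum>j<mdim L. c j * v (\<lambda>q. \<psi> (F q) j)) = 0" and j: "j < mdim L"
  shows "c j = 0"
proof -
  have "coord_basis L V \<psi> (F m) j \<in> tangent_im M L F m" unfolding im by (rule coord_vector_tangent[OF L d FV])
  then obtain v where v: "v \<in> tangent_space M m" "coord_basis L V \<psi> (F m) j = tangent_map L F m v"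
    unfolding tangent_im_def by blast
  have "v (\<lambda>q. \<psi> (F q) i) = (if i = j then 1 else 0)" if i: "i < mdim L" for i
    using tangent_map_component[where f = F and m = m and v = v, OF d FV i] coord_vector_component[OF d FV i, of "\<lambda>k. if k = j then 1 else 0"] v(2) by simp
  then have "(\<Sum>i<mdim L. c i * v (\<lambda>q. \<psi> (F q) i)) = (\<Sum>i<mdim L. if i = j then c i else 0)"
    by (intro sum.cong) auto
  then show ?thesis using c[OF v(1)] j by simp
qed

text \<open>The fibration \<open>\<pi>\<close> consists of arbitrary coordinates that complete those of F.\<close>

lemma complete_solution_of_comm_integrable:
  assumes P: "poisson_manifold M \<Xi>" and CI: "comm_integrable_by M \<Xi> X L F" and m: "m \<in> topspace (mtop M)"
  shows "\<exists>U. openin (mtop M) U \<and> m \<in> U \<and>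
    (\<exists>(N' :: (nat \<Rightarrow> real) manifold) \<pi>. smooth_manifold N' \<and> fibration (submanifold M U) N' \<pi> \<and>
      (\<exists>(L' :: (nat \<Rightarrow> real) manifold) \<Sigma>. lagrangian_complete_solution (submanifold M U) \<Xi> X N' \<pi> L' \<Sigma>))"
proof -
  have M: "smooth_manifold M" using P unfolding poisson_manifold_def by blast
  note C = comm_integrable_byD[OF CI]
  note Ma = smooth_manifold_atlas[OF M] and La = smooth_manifold_atlas[OF C(1)]
  let ?b = "mdim L"
  obtain V \<psi> where D: "(V, \<psi>) \<in> charts L" "F m \<in> V" using ex_chart[OF La smooth_map_mem[OF C(2) m]] .
  note d = chart_coord[OF La D(1)]
  have "?b \<le> mdim M \<and> (\<exists>U \<Phi>. coord M U \<Phi> \<and> m \<in> U \<and> (\<forall>q\<in>U. \<forall>j<?b. \<Phi> q j = \<psi> (F q) j))"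
  proof (rule complete_to_coordinates[OF Ma m])
    show "smooth_near M m (\<lambda>q. \<psi> (F q) j)" if "j < ?b" for j
      by (rule smooth_near_pullback[OF Ma La C(2) m smooth_near_coord_component[OF d D(2) that]])
    show "\<forall>j<?b. c j = 0" if "\<And>v. v \<in> tangent_space M m \<Longrightarrow> (\<Sum>j<?b. c j * v (\<lambda>q. \<psi> (F q) j)) = 0" for c
      using submersion_independent[OF Ma La C(3)[OF m] d D(2) that] by blast
  qed
  then obtain U0 \<Phi> where le: "?b \<le> mdim M" and c0: "coord M U0 \<Phi>" and m0: "m \<in> U0"
    and eq: "\<And>q j. q \<in> U0 \<Longrightarrow> j < ?b \<Longrightarrow> \<Phi> q j = \<psi> (F q) j" by blast
  let ?O = "U0 \<inter> {q \<in> topspace (mtop M). F q \<in> V}"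
  have O': "openin (mtop M) ?O"
    by (rule openin_Int[OF coordD(2)[OF c0] openin_continuous_map_preimage[OF smooth_mapD(1)[OF C(2)] coordD(2)[OF d]]])
  have mO: "m \<in> ?O" using m m0 D(2) by blast
  obtain e U where e: "e > 0" and U: "openin (mtop M) U" "m \<in> U" "U \<subseteq> ?O" and cU: "coord M U \<Phi>"
    and img: "\<Phi> ` U = cube (mdim M) (\<Phi> m) e"
    by (rule coord_cube[OF Ma c0 O' mO Int_lower1])
  obtain a where a: "mdim M = ?b + a" using le by (metis le_Suc_ex)
  let ?N = "eucl_manifold a (cube a (tail ?b (\<Phi> m)) e)"
  interpret product_coordinates M U \<Phi> ?N "\<lambda>x. x" "\<lambda>q. tail ?b (\<Phi> q)" ?b "\<Phi> m" e
    by (rule product_coordinates_eucl[OF M cU a]) (use img a in simp)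
  have ker: "tangent_ker M L F q = slice_space M ?b \<Phi> q" if "q \<in> U" for q
    by (rule tangent_ker_adapted[OF Ma La C(2) cU d _ _ le that]) (use U(3) eq in auto)
  have UM: "q \<in> topspace (mtop M)" if "q \<in> U" for q using openin_subset[OF U(1)] that by blast
  have "lagrangian_complete_solution MU \<Xi> X ?N (\<lambda>q. tail ?b (\<Phi> q)) (eucl_manifold ?b (cube ?b (\<Phi> m) e)) sol"
    by (rule lagrangian_complete_solution_sol) (use C(4,5) UM ker in metis)+
  moreover have "(\<lambda>i. if i < ?b then \<Phi> m i else 0) \<in> cube ?b (\<Phi> m) e" using e by (simp add: cube_def)
  then have "fibration MU ?N (\<lambda>q. tail ?b (\<Phi> q))" by (intro fibration_p) auto
  ultimately show ?thesis using U N by blast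
qed

lemma sum_lessThan_add: "(\<Sum>j<b + a. g j) = (\<Sum>j<b. g j) + (\<Sum>i<a. g (i + b))"
  for g :: "nat \<Rightarrow> real"
  by (induction a) (simp_all add: add_ac)

text \<open>The coordinates of F and p together have independent differentials: on \<open>Ker p\<^sub>*\<close> a combination
  reduces to its F-part, and on \<open>Ker F\<^sub>*\<close> the F-part vanishes. So the F-part of a vanishing combination is 0 on
  the sum of both kernels. By surjectivity of \<open>F\<^sub>*\<close> its coefficients are 0, and then so are those of the p-part. A coordinate vector that is left
  over would lie in \<open>Ker p\<^sub>* \<inter> Ker F\<^sub>*\<close>. So F and p form a coordinate system.\<close>

lemma transverse_complete_solution_of_comm_integrable:
  assumes P: "poisson_manifold M \<Xi>" and N: "smooth_manifold N" and p: "fibration M N p"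
    and CI: "comm_integrable_by M \<Xi> X L F" and T: "transverse M N p L F" and m: "m \<in> topspace (mtop M)"
  shows "\<exists>U. openin (mtop M) U \<and> m \<in> U \<and>
    (\<exists>(L' :: (nat \<Rightarrow> real) manifold) \<Sigma>.
      lagrangian_complete_solution (submanifold M U) \<Xi> X (submanifold N (p ` U)) p L' \<Sigma>)"
proof -
  have M: "smooth_manifold M" using P unfolding poisson_manifold_def by blast
  note C = comm_integrable_byD[OF CI]
  note Ma = smooth_manifold_atlas[OF M] and La = smooth_manifold_atlas[OF C(1)] and Na = smooth_manifold_atlas[OF N]
  have ps: "smooth_map M N p" and pim: "tangent_im M N p m = tangent_space N (p m)"
    using p m unfolding fibration_def by blast+
  let ?b = "mdim L" and ?a = "mdim N"
  obtain V \<psi> where D: "(V, \<psi>) \<in> charts L" "F m \<in> V" using ex_chart[OF La smooth_map_mem[OF C(2) m]] .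
  note d = chart_coord[OF La D(1)]
  obtain V1 \<phi> where D1: "(V1, \<phi>) \<in> charts N" "p m \<in> V1" using ex_chart[OF Na smooth_map_mem[OF ps m]] .
  note d1 = chart_coord[OF Na D1(1)]
  let ?f = "\<lambda>j q. if j < ?b then \<psi> (F q) j else \<phi> (p q) (j - ?b)"
  have kerF: "tangent_ker M L F m = {v \<in> tangent_space M m. \<forall>j<?b. v (\<lambda>q. \<psi> (F q) j) = 0}"
    by (rule tangent_ker_coord[OF Ma La C(2) m d D(2)])
  have kerp: "tangent_ker M N p m = {v \<in> tangent_space M m. \<forall>i<?a. v (\<lambda>q. \<phi> (p q) i) = 0}"
    by (rule tangent_ker_coord[OF Ma Na ps m d1 D1(2)])
  have split: "(\<Sum>j<?b + ?a. c j * v (?f j)) =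
      (\<Sum>j<?b. c j * v (\<lambda>q. \<psi> (F q) j)) + (\<Sum>i<?a. c (i + ?b) * v (\<lambda>q. \<phi> (p q) i))"
    for c :: "nat \<Rightarrow> real" and v :: "'a tangent"
    using sum_lessThan_add[where g = "\<lambda>j. c j * v (?f j)" and b = ?b and a = ?a] by simp
  have "?b + ?a \<le> mdim M \<and> (\<exists>U \<Phi>. coord M U \<Phi> \<and> m \<in> U \<and> (\<forall>q\<in>U. \<forall>j<?b + ?a. \<Phi> q j = ?f j q))"
  proof (rule complete_to_coordinates[OF Ma m])
    show "smooth_near M m (?f j)" if "j < ?b + ?a" for j
    proof (cases "j < ?b")
      case True
      then show ?thesis using smooth_near_pullback[OF Ma La C(2) m smooth_near_coord_component[OF d D(2) True]] by simp
    next
      case False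
      then have "j - ?b < ?a" using that by simp
      then show ?thesis
        using smooth_near_pullback[OF Ma Na ps m smooth_near_coord_component[OF d1 D1(2), of "j - ?b"]] False by simp
    qed
    fix c assume c: "\<And>v. v \<in> tangent_space M m \<Longrightarrow> (\<Sum>j<?b + ?a. c j * v (?f j)) = 0"
    have decomp: "\<exists>x\<in>tangent_ker M N p m. \<exists>y\<in>tangent_ker M L F m. v = (\<lambda>g. x g + y g)" if "v \<in> tangent_space M m" for v
      using T m that unfolding transverse_def by blast
    have F0: "(\<Sum>j<?b. c j * v (\<lambda>q. \<psi> (F q) j)) = 0" if v: "v \<in> tangent_space M m" for v
    proof -
      obtain x y where x: "x \<in> tangent_ker M N p m" and y: "y \<in> tangent_ker M L F m" and vxy: "v = (\<lambda>g. x g + y g)"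
        using decomp[OF v] by blast
      have "(\<Sum>j<?b. c j * v (\<lambda>q. \<psi> (F q) j)) = (\<Sum>j<?b. c j * x (\<lambda>q. \<psi> (F q) j))"
        using y unfolding vxy kerF by (intro sum.cong) auto
      also have "\<dots> = 0" using c[of x] x unfolding split kerp by simp
      finally show ?thesis .
    qed
    have low: "c j = 0" if "j < ?b" for j
      by (rule submersion_independent[OF Ma La C(3)[OF m] d D(2) F0 that])
    have p0: "(\<Sum>i<?a. c (i + ?b) * v (\<lambda>q. \<phi> (p q) i)) = 0" if v: "v \<in> tangent_space M m" for v
      using c[OF v] low unfolding split by simp
    have high: "c (i + ?b) = 0" if "i < ?a" for i
      by (rule submersion_independent[where c = "\<lambda>i. c (i + ?b)", OF Ma Na pim d1 D1(2) p0 that])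
    show "\<forall>j<?b + ?a. c j = 0"
    proof (intro allI impI)
      fix j assume j: "j < ?b + ?a"
      show "c j = 0"
      proof (cases "j < ?b")
        case False
        then have "j - ?b < ?a" "j - ?b + ?b = j" using j by simp_all
        then show ?thesis using high[of "j - ?b"] by simp
      qed (use low in blast)
    qed
  qed
  then obtain U0 \<Phi> where le: "?b + ?a \<le> mdim M" and c0: "coord M U0 \<Phi>" and m0: "m \<in> U0"
    and eq: "\<And>q j. q \<in> U0 \<Longrightarrow> j < ?b + ?a \<Longrightarrow> \<Phi> q j = ?f j q" by blast
  have dim: "mdim M = ?b + ?a"
  proof (rule ccontr)
    assume "mdim M \<noteq> ?b + ?a"
    then have lt: "?b + ?a < mdim M" using le by simp
    let ?v = "coord_basis M U0 \<Phi> m (?b + ?a)"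
    have v: "?v \<in> tangent_space M m" by (rule coord_vector_tangent[OF Ma c0 m0])
    have "?v (?f j) = 0" if j: "j < ?b + ?a" for j
    proof -
      have jM: "j < mdim M" using j lt by simp
      have "?v (?f j) = ?v (\<lambda>q. \<Phi> q j)"
        by (rule tangent_cong[OF v Ma smooth_near_coord_component[OF c0 m0 jM] coordD(2)[OF c0] m0, symmetric])
          (use eq j in blast)
      then show ?thesis using coord_vector_component[OF c0 m0 jM] j by simp
    qed note vf = this
    have "?v (\<lambda>q. \<psi> (F q) j) = 0" if "j < ?b" for j using vf[of j] that by simp
    moreover have "?v (\<lambda>q. \<phi> (p q) i) = 0" if "i < ?a" for i using vf[of "i + ?b"] that by simp
    ultimately have "?v \<in> tangent_ker M N p m \<inter> tangent_ker M L F m" unfolding kerF kerp using v by blast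
    then have "?v = (\<lambda>g. 0)" using T m unfolding transverse_def by blast
    then show False using coord_vector_component[OF c0 m0 lt, of "\<lambda>j. if j = ?b + ?a then 1 else 0"] by simp
  qed
  let ?O = "U0 \<inter> ({q \<in> topspace (mtop M). F q \<in> V} \<inter> {q \<in> topspace (mtop M). p q \<in> V1})"
  have O': "openin (mtop M) ?O"
    by (intro openin_Int coordD(2)[OF c0] openin_continuous_map_preimage[OF smooth_mapD(1)[OF C(2)] coordD(2)[OF d]]
        openin_continuous_map_preimage[OF smooth_mapD(1)[OF ps] coordD(2)[OF d1]])
  have mO: "m \<in> ?O" using m m0 D(2) D1(2) by blast
  obtain e U where e: "e > 0" and U: "openin (mtop M) U" "m \<in> U" "U \<subseteq> ?O" and cU: "coord M U \<Phi>"
    and img: "\<Phi> ` U = cube (mdim M) (\<Phi> m) e"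
    by (rule coord_cube[OF Ma c0 O' mO Int_lower1])
  have p_tail: "\<phi> (p q) = tail ?b (\<Phi> q)" if q: "q \<in> U" for q
  proof
    fix i
    have q': "q \<in> U0" "p q \<in> V1" using q U(3) by auto
    show "\<phi> (p q) i = tail ?b (\<Phi> q) i"
      using eq[OF q'(1), of "i + ?b"] coord_zero[OF d1 q'(2), of i] coord_zero[OF c0 q'(1), of "i + ?b"] dim
      by (cases "i < ?a") (auto simp: tail_def)
  qed
  have tail_image: "tail ?b ` \<Phi> ` U = cube ?a (tail ?b (\<Phi> m)) e"
    unfolding img dim
  proof (intro equalityI subsetI)
    fix x assume x: "x \<in> cube ?a (tail ?b (\<Phi> m)) e"
    have "\<Phi> m \<in> cube (?b + ?a) (\<Phi> m) e" using center_in_cube[OF coord_zero[OF c0 m0] e] dim by simp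
    then have "join ?b (head ?b (\<Phi> m)) x \<in> cube (?b + ?a) (\<Phi> m) e" by (rule join_in_cube[OF head_in_cube x])
    then show "x \<in> tail ?b ` cube (?b + ?a) (\<Phi> m) e"
      using image_eqI[of x "tail ?b" "join ?b (head ?b (\<Phi> m)) x"] by (simp add: tail_join)
  qed (use tail_in_cube in blast)
  have p_image: "\<phi> ` p ` U = tail ?b ` \<Phi> ` U" using p_tail by (force simp: image_iff)
  have pU: "p ` U = {n \<in> V1. \<phi> n \<in> cube ?a (tail ?b (\<Phi> m)) e}"
  proof (intro equalityI subsetI)
    fix n assume n: "n \<in> p ` U"
    then have "\<phi> n \<in> cube ?a (tail ?b (\<Phi> m)) e"
      unfolding tail_image[symmetric] p_image[symmetric] by (rule imageI)
    then show "n \<in> {n \<in> V1. \<phi> n \<in> cube ?a (tail ?b (\<Phi> m)) e}" using n U(3) by blast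
  next
    fix n assume n: "n \<in> {n \<in> V1. \<phi> n \<in> cube ?a (tail ?b (\<Phi> m)) e}"
    then have "\<phi> n \<in> tail ?b ` \<Phi> ` U" unfolding tail_image by simp
    then obtain q where q: "q \<in> U" "\<phi> n = tail ?b (\<Phi> q)" by blast
    have "\<phi> (p q) = \<phi> n" unfolding p_tail[OF q(1)] q(2) ..
    then have "p q = n" using coordD(3)[OF d1] n q(1) U(3) by (auto dest: inj_onD)
    then show "n \<in> p ` U" using q(1) by blast
  qed
  have pU_open: "openin (mtop N) (p ` U)" unfolding pU by (rule coord_vimage_open[OF d1 eopen_cube])
  have pU_V1: "p ` U \<subseteq> V1" using pU by blast
  have top: "topspace (mtop (submanifold N (p ` U))) = p ` U"
    using openin_subset[OF pU_open] by (auto simp: topspace_subtopology)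
  interpret product_coordinates M U \<Phi> "submanifold N (p ` U)" \<phi> p ?b "\<Phi> m" e
  proof
    show "coord (submanifold N (p ` U)) (topspace (mtop (submanifold N (p ` U)))) \<phi>"
      unfolding top by (rule coord_submanifold[OF Na pU_open coord_restrict[OF Na d1 pU_open pU_V1] subset_refl])
    show "smooth_manifold (submanifold N (p ` U))" by (rule smooth_manifold_submanifold[OF N pU_open])
    show "\<phi> ` topspace (mtop (submanifold N (p ` U))) = cube (mdim (submanifold N (p ` U))) (tail ?b (\<Phi> m)) e"
      unfolding top p_image tail_image by simp
    show "p q \<in> topspace (mtop (submanifold N (p ` U)))" if "q \<in> U" for q unfolding top using that by blast
  qed (use M cU dim img p_tail in simp_all)
  have ker: "tangent_ker M L F q = slice_space M ?b \<Phi> q" if "q \<in> U" for q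
  proof (rule tangent_ker_adapted[OF Ma La C(2) cU d _ _ _ that])
    show "F ` U \<subseteq> V" using U(3) by blast
    show "\<Phi> q j = \<psi> (F q) j" if "q \<in> U" "j < ?b" for q j using eq[of q j] that U(3) by auto
  qed (use dim in simp)
  have UM: "q \<in> topspace (mtop M)" if "q \<in> U" for q using openin_subset[OF U(1)] that by blast
  have "lagrangian_complete_solution MU \<Xi> X (submanifold N (p ` U)) p (eucl_manifold ?b (cube ?b (\<Phi> m) e)) sol"
    by (rule lagrangian_complete_solution_sol) (use C(4,5) UM ker in metis)+
  then show ?thesis using U by blast
qed

theorem theorem4p25:
  fixes M :: "'a manifold" and N :: "'b manifold" and \<Xi> :: "'a bivector"
    and H :: "'a \<Rightarrow> real" and p :: "'a \<Rightarrow> 'b"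
  assumes "poisson_manifold M \<Xi>"
    and "smooth_fun_on M (topspace (mtop M)) H"
    and "smooth_manifold N"
    and "fibration M N p"
  defines "X \<equiv> hamiltonian_field M \<Xi> H"
  shows
    "((\<exists>(L :: 'c manifold) \<Sigma>. lagrangian_complete_solution M \<Xi> X N p L \<Sigma>) \<longrightarrow>
        (\<forall>m \<in> topspace (mtop M). \<exists>U. openin (mtop M) U \<and> m \<in> U \<and>
           comm_integrable TYPE(nat \<Rightarrow> real) (submanifold M U) \<Xi> X))
     \<and>
     (\<forall>(L :: 'd manifold) F. comm_integrable_by M \<Xi> X L F \<and> transverse M N p L F \<longrightarrow>
        (\<forall>m \<in> topspace (mtop M). \<exists>U. openin (mtop M) U \<and> m \<in> U \<and>
           (\<exists>(L' :: (nat \<Rightarrow> real) manifold) \<Sigma>.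
              lagrangian_complete_solution (submanifold M U) \<Xi> X (submanifold N (p ` U)) p L' \<Sigma>)))
     \<and>
     (comm_integrable TYPE('e) M \<Xi> X \<longrightarrow>
        (\<forall>m \<in> topspace (mtop M). \<exists>U. openin (mtop M) U \<and> m \<in> U \<and>
           (\<exists>(N' :: (nat \<Rightarrow> real) manifold) \<pi>.
              smooth_manifold N' \<and> fibration (submanifold M U) N' \<pi> \<and>
              (\<exists>(L' :: (nat \<Rightarrow> real) manifold) \<Sigma>.
                 lagrangian_complete_solution (submanifold M U) \<Xi> X N' \<pi> L' \<Sigma>))))"
proof (intro conjI impI allI ballI; (elim exE conjE)?)
  fix L :: "'c manifold" and \<Sigma> m
  assume S: "lagrangian_complete_solution M \<Xi> X N p L \<Sigma>" and m: "m \<in> topspace (mtop M)"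
  have "smooth_map M N p" using assms(4) unfolding fibration_def by blast
  then show "\<exists>U. openin (mtop M) U \<and> m \<in> U \<and> comm_integrable TYPE(nat \<Rightarrow> real) (submanifold M U) \<Xi> X"
    by (rule comm_integrable_of_complete_solution[OF assms(1,3) _ _ S m])
      (use hamiltonian_field_tangent[OF assms(1)] in \<open>simp add: X_def\<close>)
next
  fix L :: "'d manifold" and F m
  assume "comm_integrable_by M \<Xi> X L F" "transverse M N p L F" "m \<in> topspace (mtop M)"
  then show "\<exists>U. openin (mtop M) U \<and> m \<in> U \<and>
           (\<exists>(L' :: (nat \<Rightarrow> real) manifold) \<Sigma>.
              lagrangian_complete_solution (submanifold M U) \<Xi> X (submanifold N (p ` U)) p L' \<Sigma>)"
    by (rule transverse_complete_solution_of_comm_integrable[OF assms(1,3,4)])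
next
  fix m assume "comm_integrable TYPE('e) M \<Xi> X" and m: "m \<in> topspace (mtop M)"
  then obtain L :: "'e manifold" and F where "comm_integrable_by M \<Xi> X L F" unfolding comm_integrable_def by blast
  from complete_solution_of_comm_integrable[OF assms(1) this m]
  show "\<exists>U. openin (mtop M) U \<and> m \<in> U \<and>
           (\<exists>(N' :: (nat \<Rightarrow> real) manifold) \<pi>.
              smooth_manifold N' \<and> fibration (submanifold M U) N' \<pi> \<and>
              (\<exists>(L' :: (nat \<Rightarrow> real) manifold) \<Sigma>.
                 lagrangian_complete_solution (submanifold M U) \<Xi> X N' \<pi> L' \<Sigma>))" .
qed

end
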